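(* Let $\Omega\subset\mathbb{R}^n$ be open and let $P(D)=\sum_{|\alpha|\le m}a_\alpha D^\alpha$ be a partial differential operator with constant generalized coefficients $a_\alpha\in\widetilde{\mathbb{C}}$. Assume that $\widetilde{P}^2(\xi_0)$ is invertible (in $\widetilde{\mathbb{C}}$) for some $\xi_0\in\mathbb{R}^n$. Then for every $f\in\mathcal{G}_{\mathrm c}(\Omega)$ there is a solution $u\in\mathcal{G}(\Omega)$ of the equation $P(D)u=f$.
   Context: Colombeau algebra: for $\Omega\subset\mathbb{R}^n$ open, $\mathcal{E}_{\mathrm M}(\Omega)$ is the set of nets $(u_\varepsilon)_{\varepsilon\in(0,1]}$ in $C^\infty(\Omega)$ such that for every compact $K\subset\Omega$ and $\alpha\in\mathbb{N}_0^n$ there is $p\ge0$ with $\sup_{K}|\partial^\alpha u_\varepsilon|=O(\varepsilon^{-p})$ as $\varepsilon\to0$; $\mathcal{N}(\Omega)$ is the set of nets such that for all $K,\alpha$ and all $q\ge0$, $\sup_{K}|\partial^\alpha u_\varepsilon|=O(\varepsilon^{q})$. $\mathcal{G}(\Omega)=\mathcal{E}_{\mathrm M}(\Omega)/\mathcal{N}(\Omega)$, with operations on representatives; $\Omega\mapsto\mathcal{G}(\Omega)$ is a sheaf, so supports are defined, and $\mathcal{G}_{\mathrm c}(\Omega)$ is the subalgebra of elements with compact support in $\Omega$. $\widetilde{\mathbb{C}}$: nets $(c_\varepsilon)_{\varepsilon\in(0,1]}$ in $\mathbb{C}$ with $|c_\varepsilon|=O(\varepsilon^{-p})$ for some $p$,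 modulo those with $|c_\varepsilon|=O(\varepsilon^q)$ for all $q$; it is a commutative ring. $D=(-i\partial_1,\dots,-i\partial_n)$. With representatives $(a_\alpha^\varepsilon)_\varepsilon$ of the coefficients, $P_\varepsilon(\xi)=\sum_{|\alpha|\le m}a^\varepsilon_\alpha\xi^\alpha$. Associated weight function: $\widetilde{P}^2\in\mathcal{G}(\mathbb{R}^n)$ is the class of $\widetilde{P}^2_\varepsilon(\xi)=\sum_{|\alpha|\le m}|\partial_\xi^\alpha P_\varepsilon(\xi)|^2$, and $\widetilde{P}^2(\xi_0)$ is the class of $(\widetilde{P}^2_\varepsilon(\xi_0))_\varepsilon$. *)

theory Defs
  imports "HOL-Analysis.Analysis" "HOL-Library.Landau_Symbols"
begin

section \<open>Generalized complex numbers\<close>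

text \<open>
  Nets indexed by \<open>\<epsilon> \<in> (0,1]\<close> are total functions of a real parameter. All conditions on
  scalar nets are asymptotic as \<open>\<epsilon> \<rightarrow> 0+\<close>, so values at other parameters are identified
  in the quotient.
\<close>

definition moderate :: "(real \<Rightarrow> complex) \<Rightarrow> bool" where
  "moderate c \<longleftrightarrow> (\<exists>p\<ge>0. c \<in> O[at_right 0](\<lambda>\<epsilon>. of_real (\<epsilon> powr (- p))))"

definition negligible_net :: "(real \<Rightarrow> complex) \<Rightarrow> bool" where
  "negligible_net c \<longleftrightarrow> (\<forall>q\<ge>0. c \<in> O[at_right 0](\<lambda>\<epsilon>. of_real (\<epsilon> powr q)))"

definition gc_rel :: "(real \<Rightarrow> complex) \<Rightarrow> (real \<Rightarrow> complex) \<Rightarrow> bool" where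
  "gc_rel c d \<longleftrightarrow> moderate c \<and> moderate d \<and> negligible_net (\<lambda>\<epsilon>. c \<epsilon> - d \<epsilon>)"

lemma powr_bigo_mono:
  assumes "a \<le> b"
  shows "(\<lambda>\<epsilon>. of_real (\<epsilon> powr b) :: complex) \<in> O[at_right 0](\<lambda>\<epsilon>. of_real (\<epsilon> powr a))"
proof (rule bigoI[where c = 1])
  have "eventually (\<lambda>\<epsilon>::real. \<epsilon> \<in> {0<..<1}) (at_right 0)"
    by (rule eventually_at_right_real) simp
  then show "\<forall>\<^sub>F \<epsilon> in at_right 0. norm (of_real (\<epsilon> powr b) :: complex)
      \<le> 1 * norm (of_real (\<epsilon> powr a) :: complex)"
    by eventually_elim (use assms in \<open>auto intro: powr_mono'\<close>)
qed

lemma moderate_add: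
  assumes "moderate c" "moderate d"
  shows "moderate (\<lambda>\<epsilon>. c \<epsilon> + d \<epsilon>)"
proof -
  obtain p q where p: "p \<ge> 0" "c \<in> O[at_right 0](\<lambda>\<epsilon>. of_real (\<epsilon> powr (- p)))"
    and q: "q \<ge> 0" "d \<in> O[at_right 0](\<lambda>\<epsilon>. of_real (\<epsilon> powr (- q)))"
    using assms unfolding moderate_def by blast
  have "c \<in> O[at_right 0](\<lambda>\<epsilon>. of_real (\<epsilon> powr (- max p q)))"
    by (rule landau_o.big_trans[OF p(2) powr_bigo_mono]) auto
  moreover have "d \<in> O[at_right 0](\<lambda>\<epsilon>. of_real (\<epsilon> powr (- max p q)))"
    by (rule landau_o.big_trans[OF q(2) powr_bigo_mono]) auto
  ultimately show ?thesis
    unfolding moderate_def using p(1) by (intro exI[of _ "max p q"]) (auto intro: sum_in_bigo)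
qed

lemma moderate_uminus: "moderate c \<Longrightarrow> moderate (\<lambda>\<epsilon>. - c \<epsilon>)"
  unfolding moderate_def by simp

lemma moderate_diff: "moderate c \<Longrightarrow> moderate d \<Longrightarrow> moderate (\<lambda>\<epsilon>. c \<epsilon> - d \<epsilon>)"
  using moderate_add[OF _ moderate_uminus] by fastforce

lemma moderate_const: "moderate (\<lambda>_. k)"
  unfolding moderate_def
proof (intro exI[of _ 0] conjI bigoI[where c = "norm k"])
  have "eventually (\<lambda>\<epsilon>::real. \<epsilon> \<in> {0<..<1}) (at_right 0)"
    by (rule eventually_at_right_real) simp
  then show "\<forall>\<^sub>F \<epsilon> in at_right 0. norm k \<le> norm k * norm (of_real (\<epsilon> powr (- 0)) :: complex)"
    by eventually_elim auto
qed simp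

lemma moderate_mult:
  assumes "moderate c" "moderate d"
  shows "moderate (\<lambda>\<epsilon>. c \<epsilon> * d \<epsilon>)"
proof -
  obtain p q where p: "p \<ge> 0" "c \<in> O[at_right 0](\<lambda>\<epsilon>. of_real (\<epsilon> powr (- p)))"
    and q: "q \<ge> 0" "d \<in> O[at_right 0](\<lambda>\<epsilon>. of_real (\<epsilon> powr (- q)))"
    using assms unfolding moderate_def by blast
  have "(\<lambda>\<epsilon>. c \<epsilon> * d \<epsilon>) \<in> O[at_right 0](\<lambda>\<epsilon>. of_real (\<epsilon> powr (- p)) * of_real (\<epsilon> powr (- q)))"
    using p(2) q(2) by (rule landau_o.big.mult)
  also have "(\<lambda>\<epsilon>. of_real (\<epsilon> powr (- p)) * of_real (\<epsilon> powr (- q)))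
      = (\<lambda>\<epsilon>. of_real (\<epsilon> powr (- (p + q))) :: complex)"
    by (simp add: fun_eq_iff powr_add[symmetric] flip: of_real_mult)
  finally show ?thesis
    unfolding moderate_def using p(1) q(1) by (intro exI[of _ "p + q"]) auto
qed

lemma negligible_net_zero: "negligible_net (\<lambda>_. 0)"
  by (simp add: negligible_net_def)

lemma negligible_net_add:
  "negligible_net c \<Longrightarrow> negligible_net d \<Longrightarrow> negligible_net (\<lambda>\<epsilon>. c \<epsilon> + d \<epsilon>)"
  unfolding negligible_net_def by (auto intro: sum_in_bigo)

lemma negligible_net_uminus: "negligible_net c \<Longrightarrow> negligible_net (\<lambda>\<epsilon>. - c \<epsilon>)"
  unfolding negligible_net_def by simp

lemma negligible_net_mult:
  assumes "negligible_net c" "moderate d"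
  shows "negligible_net (\<lambda>\<epsilon>. c \<epsilon> * d \<epsilon>)"
  unfolding negligible_net_def
proof (intro allI impI)
  fix q :: real assume "q \<ge> 0"
  obtain p where p: "p \<ge> 0" "d \<in> O[at_right 0](\<lambda>\<epsilon>. of_real (\<epsilon> powr (- p)))"
    using assms(2) unfolding moderate_def by blast
  have "c \<in> O[at_right 0](\<lambda>\<epsilon>. of_real (\<epsilon> powr (q + p)))"
    using assms(1) p(1) \<open>q \<ge> 0\<close> unfolding negligible_net_def by simp
  then have "(\<lambda>\<epsilon>. c \<epsilon> * d \<epsilon>) \<in> O[at_right 0](\<lambda>\<epsilon>. of_real (\<epsilon> powr (q + p)) * of_real (\<epsilon> powr (- p)))"
    using p(2) by (rule landau_o.big.mult)
  also have "(\<lambda>\<epsilon>. of_real (\<epsilon> powr (q + p)) * of_real (\<epsilon> powr (- p)))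
      = (\<lambda>\<epsilon>. of_real (\<epsilon> powr q) :: complex)"
    by (simp add: fun_eq_iff powr_add[symmetric] flip: of_real_mult)
  finally show "(\<lambda>\<epsilon>. c \<epsilon> * d \<epsilon>) \<in> O[at_right 0](\<lambda>\<epsilon>. of_real (\<epsilon> powr q))" .
qed

lemma not_negligible_net_one: "\<not> negligible_net (\<lambda>_. 1)"
proof
  assume "negligible_net (\<lambda>_. 1)"
  then have "(\<lambda>_. 1 :: complex) \<in> O[at_right 0](\<lambda>\<epsilon>. of_real (\<epsilon> powr 1))"
    unfolding negligible_net_def using zero_le_one by blast
  then obtain C where C: "C > 0"
      "\<forall>\<^sub>F \<epsilon> in at_right 0. norm (1::complex) \<le> C * norm (of_real (\<epsilon> powr 1) :: complex)"
    by (rule landau_o.bigE)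
  have "eventually (\<lambda>\<epsilon>::real. \<epsilon> \<in> {0<..<1 / C}) (at_right 0)"
    by (rule eventually_at_right_real) (use C(1) in simp)
  with C(2) have "\<forall>\<^sub>F \<epsilon> in at_right (0::real). False"
  proof eventually_elim
    case (elim \<epsilon>)
    then have "C * \<epsilon> < 1" "1 \<le> C * \<epsilon>"
      using C(1) by (auto simp: field_simps)
    then show False by simp
  qed
  then show False by (simp add: trivial_limit_def[symmetric])
qed

lemma gc_rel_refl: "moderate c \<Longrightarrow> gc_rel c c"
  by (simp add: gc_rel_def negligible_net_zero)

lemma part_equivp_gc_rel: "part_equivp gc_rel"
proof (rule part_equivpI)
  show "\<exists>c. gc_rel c c"
    using gc_rel_refl[OF moderate_const] by blast
  show "symp gc_rel"
    unfolding symp_def gc_rel_def using negligible_net_uminus by fastforce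
  show "transp gc_rel"
  proof (rule transpI)
    fix x y z assume "gc_rel x y" "gc_rel y z"
    then show "gc_rel x z"
      unfolding gc_rel_def
      using negligible_net_add[of "\<lambda>\<epsilon>. x \<epsilon> - y \<epsilon>" "\<lambda>\<epsilon>. y \<epsilon> - z \<epsilon>"] by simp
  qed
qed

quotient_type gcomplex = "real \<Rightarrow> complex" / partial: gc_rel
  by (rule part_equivp_gc_rel)

lemma gc_rel_add:
  assumes "gc_rel a a'" "gc_rel b b'"
  shows "gc_rel (\<lambda>\<epsilon>. a \<epsilon> + b \<epsilon>) (\<lambda>\<epsilon>. a' \<epsilon> + b' \<epsilon>)"
  using assms negligible_net_add[of "\<lambda>\<epsilon>. a \<epsilon> - a' \<epsilon>" "\<lambda>\<epsilon>. b \<epsilon> - b' \<epsilon>"]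
  by (simp add: gc_rel_def moderate_add algebra_simps)

lemma gc_rel_uminus:
  assumes "gc_rel a a'"
  shows "gc_rel (\<lambda>\<epsilon>. - a \<epsilon>) (\<lambda>\<epsilon>. - a' \<epsilon>)"
  using assms negligible_net_uminus[of "\<lambda>\<epsilon>. a \<epsilon> - a' \<epsilon>"]
  by (simp add: gc_rel_def moderate_uminus algebra_simps)

lemma gc_rel_mult:
  assumes "gc_rel a a'" "gc_rel b b'"
  shows "gc_rel (\<lambda>\<epsilon>. a \<epsilon> * b \<epsilon>) (\<lambda>\<epsilon>. a' \<epsilon> * b' \<epsilon>)"
proof -
  have "negligible_net (\<lambda>\<epsilon>. (a \<epsilon> - a' \<epsilon>) * b \<epsilon> + (b \<epsilon> - b' \<epsilon>) * a' \<epsilon>)"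
    using assms by (intro negligible_net_add negligible_net_mult) (auto simp: gc_rel_def)
  also have "(\<lambda>\<epsilon>. (a \<epsilon> - a' \<epsilon>) * b \<epsilon> + (b \<epsilon> - b' \<epsilon>) * a' \<epsilon>) = (\<lambda>\<epsilon>. a \<epsilon> * b \<epsilon> - a' \<epsilon> * b' \<epsilon>)"
    by (simp add: algebra_simps)
  finally show ?thesis
    using assms by (simp add: gc_rel_def moderate_mult)
qed

instantiation gcomplex :: comm_ring_1
begin

lift_definition zero_gcomplex :: gcomplex is "\<lambda>_. 0"
  by (rule gc_rel_refl[OF moderate_const])

lift_definition one_gcomplex :: gcomplex is "\<lambda>_. 1"
  by (rule gc_rel_refl[OF moderate_const])

lift_definition plus_gcomplex :: "gcomplex \<Rightarrow> gcomplex \<Rightarrow> gcomplex" is "\<lambda>c d \<epsilon>. c \<epsilon> + d \<epsilon>"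
  by (rule gc_rel_add)

lift_definition uminus_gcomplex :: "gcomplex \<Rightarrow> gcomplex" is "\<lambda>c \<epsilon>. - c \<epsilon>"
  by (rule gc_rel_uminus)

lift_definition minus_gcomplex :: "gcomplex \<Rightarrow> gcomplex \<Rightarrow> gcomplex" is "\<lambda>c d \<epsilon>. c \<epsilon> - d \<epsilon>"
  using gc_rel_add[OF _ gc_rel_uminus] by fastforce

lift_definition times_gcomplex :: "gcomplex \<Rightarrow> gcomplex \<Rightarrow> gcomplex" is "\<lambda>c d \<epsilon>. c \<epsilon> * d \<epsilon>"
  by (rule gc_rel_mult)

instance
proof
  show "(0::gcomplex) \<noteq> 1"
    by transfer
      (use negligible_net_uminus not_negligible_net_one in \<open>fastforce simp: gc_rel_def\<close>)
qed (transfer; force simp: algebra_simps gc_rel_def negligible_net_zero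
       intro!: moderate_const moderate_add moderate_mult moderate_uminus moderate_diff)+

end

text \<open>\<^const>\<open>rep_gcomplex\<close> selects some moderate representative of a class.\<close>

lemma gc_rel_rep: "gc_rel (rep_gcomplex c) (rep_gcomplex c)"
  using Quotient3_rep_reflp[OF Quotient3_gcomplex] .

lemma abs_rep_gcomplex: "abs_gcomplex (rep_gcomplex c) = c"
  using Quotient3_abs_rep[OF Quotient3_gcomplex] .


section \<open>Multi-indices and smooth functions\<close>

definition mi_order :: "('n::finite \<Rightarrow> nat) \<Rightarrow> nat" where
  "mi_order \<alpha> = (\<Sum>i\<in>UNIV. \<alpha> i)"

definition mi_upto :: "nat \<Rightarrow> ('n::finite \<Rightarrow> nat) set" where
  "mi_upto m = {\<alpha>. mi_order \<alpha> \<le> m}"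

lemma finite_mi_upto: "finite (mi_upto m :: ('n::finite \<Rightarrow> nat) set)"
proof (rule finite_subset)
  show "mi_upto m \<subseteq> (PiE UNIV (\<lambda>_. {..m}) :: ('n \<Rightarrow> nat) set)"
  proof
    fix \<alpha> :: "'n \<Rightarrow> nat" assume "\<alpha> \<in> mi_upto m"
    moreover have "\<alpha> i \<le> mi_order \<alpha>" for i
      unfolding mi_order_def by (rule member_le_sum) auto
    ultimately show "\<alpha> \<in> PiE UNIV (\<lambda>_. {..m})"
      unfolding mi_upto_def by (auto simp: PiE_def intro: order_trans)
  qed
qed (simp add: finite_PiE)

definition partial_deriv :: "'n \<Rightarrow> (real^'n::finite \<Rightarrow> complex) \<Rightarrow> real^'n \<Rightarrow> complex" where
  "partial_deriv i f x = frechet_derivative f (at x) (axis i 1)"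

fun partial_derivs :: "'n list \<Rightarrow> (real^'n::finite \<Rightarrow> complex) \<Rightarrow> real^'n \<Rightarrow> complex" where
  "partial_derivs [] f = f"
| "partial_derivs (i # is) f = partial_deriv i (partial_derivs is f)"

text \<open>
  The index type carries no order, so the order in which the partial derivatives of a
  multi-index are taken is left to a choice. It is irrelevant on \<open>C\<^sup>\<infinity>(\<Omega>)\<close>, where partial
  derivatives commute.
\<close>

definition mi_deriv :: "('n \<Rightarrow> nat) \<Rightarrow> (real^'n::finite \<Rightarrow> complex) \<Rightarrow> real^'n \<Rightarrow> complex" where
  "mi_deriv \<alpha> = partial_derivs (SOME is. \<forall>i. count_list is i = \<alpha> i)"

lemma ex_mi_list: "\<exists>is. \<forall>i. count_list is i = (\<alpha> :: 'n::finite \<Rightarrow> nat) i"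
proof -
  obtain xs :: "'n list" where xs: "set xs = UNIV" "distinct xs"
    using finite_distinct_list[of "UNIV :: 'n set"] by auto
  have rep: "count_list (replicate k j) i = (if i = j then k else 0)" for k and i j :: 'n
    by (induction k) auto
  have "count_list (concat (map (\<lambda>j. replicate (\<alpha> j) j) ys)) i = (if i \<in> set ys then \<alpha> i else 0)"
    if "distinct ys" for ys i
    using that by (induction ys) (auto simp: rep)
  from this[OF xs(2)] show ?thesis using xs(1) by auto
qed

text \<open>\<open>C\<^sup>\<infinity>(\<Omega>)\<close>, for open \<open>\<Omega>\<close>; the functions are total, their values outside \<open>\<Omega>\<close> play no role.\<close>

definition smooth_on :: "(real^'n::finite) set \<Rightarrow> (real^'n \<Rightarrow> complex) \<Rightarrow> bool" where
  "smooth_on \<Omega> f \<longleftrightarrow> (\<forall>is. \<forall>x\<in>\<Omega>. partial_derivs is f differentiable (at x))"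

text \<open>\<open>D\<^sup>\<alpha>\<close> for \<open>D = (-i\<partial>\<^sub>1, \<dots>, -i\<partial>\<^sub>n)\<close>, and \<open>\<xi>\<^sup>\<alpha>\<close>.\<close>

definition mi_D :: "('n \<Rightarrow> nat) \<Rightarrow> (real^'n::finite \<Rightarrow> complex) \<Rightarrow> real^'n \<Rightarrow> complex" where
  "mi_D \<alpha> f x = (- \<i>) ^ mi_order \<alpha> * mi_deriv \<alpha> f x"

definition mi_power :: "real^'n::finite \<Rightarrow> ('n \<Rightarrow> nat) \<Rightarrow> complex" where
  "mi_power \<xi> \<alpha> = (\<Prod>i\<in>UNIV. of_real (\<xi> $ i) ^ \<alpha> i)"

lemma frechet_derivative_cong_open:
  assumes "open \<Omega>" "x \<in> \<Omega>" "\<And>y. y \<in> \<Omega> \<Longrightarrow> f y = g y"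
  shows "frechet_derivative f (at x) = frechet_derivative g (at x)"
proof -
  have "(f has_derivative D) (at x) \<longleftrightarrow> (g has_derivative D) (at x)" for D
    using has_derivative_transform_within_open[OF _ assms(1,2), of f D UNIV g]
      has_derivative_transform_within_open[OF _ assms(1,2), of g D UNIV f] assms(3) by auto
  then show ?thesis unfolding frechet_derivative_def by simp
qed

lemma differentiable_cong_open:
  assumes "open \<Omega>" "x \<in> \<Omega>" "\<And>y. y \<in> \<Omega> \<Longrightarrow> f y = g y" "f differentiable (at x)"
  shows "g differentiable (at x)"
  using assms has_derivative_transform_within_open[OF _ assms(1,2), of f _ UNIV g]
  unfolding differentiable_def by blast

lemma partial_derivs_cong_open:
  assumes "open \<Omega>" "x \<in> \<Omega>" "\<And>y. y \<in> \<Omega> \<Longrightarrow> f y = g y"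
  shows "partial_derivs is f x = partial_derivs is g x"
  using assms(2)
proof (induction "is" arbitrary: x)
  case (Cons i "is")
  show ?case
    using frechet_derivative_cong_open[OF assms(1) Cons.prems Cons.IH]
    by (simp add: partial_deriv_def)
qed (use assms in auto)

lemma partial_derivs_append: "partial_derivs (is @ js) f = partial_derivs is (partial_derivs js f)"
  by (induction "is") auto

lemma smooth_on_partial_derivs: "smooth_on \<Omega> f \<Longrightarrow> smooth_on \<Omega> (partial_derivs js f)"
  unfolding smooth_on_def partial_derivs_append[symmetric] by blast

lemma smooth_on_partial_deriv: "smooth_on \<Omega> f \<Longrightarrow> smooth_on \<Omega> (partial_deriv i f)"
  using smooth_on_partial_derivs[of \<Omega> f "[i]"] by simp

lemma partial_derivs_linear:
  assumes "open \<Omega>" "smooth_on \<Omega> f" "smooth_on \<Omega> g" "x \<in> \<Omega>"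
  shows "partial_derivs is (\<lambda>y. c * f y + d * g y) x
    = c * partial_derivs is f x + d * partial_derivs is g x"
  using assms(4)
proof (induction "is" arbitrary: x)
  case (Cons i "is")
  let ?F = "partial_derivs is f" and ?G = "partial_derivs is g"
  have F: "(?F has_derivative frechet_derivative ?F (at x)) (at x)"
    and G: "(?G has_derivative frechet_derivative ?G (at x)) (at x)"
    using assms(2,3) Cons.prems by (auto simp: smooth_on_def frechet_derivative_works[symmetric])
  have "((\<lambda>y. c * ?F y + d * ?G y) has_derivative
      (\<lambda>h. c * frechet_derivative ?F (at x) h + d * frechet_derivative ?G (at x) h)) (at x)"
    by (intro derivative_intros F G)
  then have "frechet_derivative (\<lambda>y. c * ?F y + d * ?G y) (at x)
      = (\<lambda>h. c * frechet_derivative ?F (at x) h + d * frechet_derivative ?G (at x) h)"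
    by (rule frechet_derivative_at[symmetric])
  then show ?case
    using frechet_derivative_cong_open[OF assms(1) Cons.prems Cons.IH]
    by (simp add: partial_deriv_def)
qed auto

lemma smooth_on_linear:
  assumes "open \<Omega>" "smooth_on \<Omega> f" "smooth_on \<Omega> g"
  shows "smooth_on \<Omega> (\<lambda>y. c * f y + d * g y)"
  unfolding smooth_on_def
proof (intro allI ballI)
  fix "is" x assume x: "x \<in> \<Omega>"
  have "(\<lambda>y. c * partial_derivs is f y + d * partial_derivs is g y) differentiable (at x)"
    using assms(2,3) x unfolding smooth_on_def by (intro derivative_intros) auto
  then show "partial_derivs is (\<lambda>y. c * f y + d * g y) differentiable (at x)"
    by (rule differentiable_cong_open[OF assms(1) x, rotated])
      (rule partial_derivs_linear[OF assms, symmetric])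
qed

lemma smooth_on_step:
  assumes "\<And>x. x \<in> \<Omega> \<Longrightarrow> f differentiable (at x)" "\<And>i. smooth_on \<Omega> (partial_deriv i f)"
  shows "smooth_on \<Omega> f"
  unfolding smooth_on_def
proof
  fix "is" show "\<forall>x\<in>\<Omega>. partial_derivs is f differentiable (at x)"
  proof (cases "is" rule: rev_cases)
    case (snoc js j)
    then show ?thesis using assms(2)[of j] by (simp add: smooth_on_def partial_derivs_append)
  qed (use assms(1) in auto)
qed

lemma partial_deriv_mult:
  assumes "f differentiable (at x)" "g differentiable (at x)"
  shows "partial_deriv i (\<lambda>y. f y * g y) x = f x * partial_deriv i g x + partial_deriv i f x * g x"
proof -
  have "((\<lambda>y. f y * g y) has_derivative (\<lambda>h. f x * frechet_derivative g (at x) h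
      + frechet_derivative f (at x) h * g x)) (at x)"
    using assms by (intro has_derivative_mult) (auto simp: frechet_derivative_works[symmetric])
  from frechet_derivative_at[OF this, symmetric] show ?thesis
    by (simp add: partial_deriv_def)
qed

lemma smooth_on_mult:
  assumes "open \<Omega>" "smooth_on \<Omega> f" "smooth_on \<Omega> g"
  shows "smooth_on \<Omega> (\<lambda>y. f y * g y)"
proof -
  let ?S = "\<lambda>ps y. \<Sum>(f, g)\<leftarrow>ps. f y * g y"
  let ?d = "\<lambda>i ps. concat (map (\<lambda>(f, g). [(f, partial_deriv i g), (partial_deriv i f, g)]) ps)"
  have diff0: "f differentiable (at x)" if "smooth_on \<Omega> f" "x \<in> \<Omega>" for f x
    using that unfolding smooth_on_def by (metis partial_derivs.simps(1))
  have diff: "?S ps differentiable (at x)"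
    if "\<forall>(f, g)\<in>set ps. smooth_on \<Omega> f \<and> smooth_on \<Omega> g" "x \<in> \<Omega>" for ps x
    using that
    by (induction ps) (auto intro!: differentiable_add differentiable_mult intro: diff0)
  have step: "partial_deriv i (?S ps) x = ?S (?d i ps) x"
    if "\<forall>(f, g)\<in>set ps. smooth_on \<Omega> f \<and> smooth_on \<Omega> g" "x \<in> \<Omega>" for i ps x
    using that
  proof (induction ps)
    case Nil
    show ?case by (simp add: partial_deriv_def)
  next
    case (Cons p ps)
    obtain f g where p: "p = (f, g)" by (cases p)
    have fg: "f differentiable (at x)" "g differentiable (at x)"
      using Cons.prems diff0 by (auto simp: p)
    have "partial_deriv i (\<lambda>y. f y * g y + ?S ps y) x
        = partial_deriv i (\<lambda>y. f y * g y) x + partial_deriv i (?S ps) x"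
    proof -
      have "((\<lambda>y. f y * g y + ?S ps y) has_derivative
          (\<lambda>h. frechet_derivative (\<lambda>y. f y * g y) (at x) h + frechet_derivative (?S ps) (at x) h)) (at x)"
        by (intro has_derivative_add)
          (use fg diff[of ps x] Cons.prems in
            \<open>auto simp: frechet_derivative_works[symmetric] intro: differentiable_mult\<close>)
      from frechet_derivative_at[OF this, symmetric] show ?thesis
        by (simp add: partial_deriv_def)
    qed
    then show ?case
      using Cons by (simp add: p partial_deriv_mult[OF fg])
  qed
  have main: "\<forall>x\<in>\<Omega>. partial_derivs is (?S ps) differentiable (at x)"
    if "\<forall>(f, g)\<in>set ps. smooth_on \<Omega> f \<and> smooth_on \<Omega> g" for "is" ps
    using that
  proof (induction "is" arbitrary: ps rule: rev_induct)
    case Nil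
    then show ?case using diff by simp
  next
    case (snoc i "is")
    have "\<forall>(f, g)\<in>set (?d i ps). smooth_on \<Omega> f \<and> smooth_on \<Omega> g"
      using snoc.prems by (auto intro: smooth_on_partial_deriv)
    note d = snoc.IH[OF this]
    show ?case
    proof
      fix x assume x: "x \<in> \<Omega>"
      show "partial_derivs (is @ [i]) (?S ps) differentiable (at x)"
      proof (rule differentiable_cong_open[OF assms(1) x])
        show "partial_derivs is (?S (?d i ps)) differentiable (at x)" using d x by blast
        show "partial_derivs is (?S (?d i ps)) y = partial_derivs (is @ [i]) (?S ps) y"
          if "y \<in> \<Omega>" for y
          unfolding partial_derivs_append partial_derivs.simps
          by (rule partial_derivs_cong_open[OF assms(1) that]) (rule step[OF snoc.prems, symmetric])
      qed
    qed
  qed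
  show ?thesis
    unfolding smooth_on_def using main[of "[(f, g)]"] assms(2,3) by simp
qed

lemma partial_deriv_const [simp]: "partial_deriv i (\<lambda>_. k) = (\<lambda>_. 0)"
  by (simp add: partial_deriv_def fun_eq_iff)

lemma partial_derivs_const: "partial_derivs is (\<lambda>_. k) = (\<lambda>_. if is = [] then k else 0)"
  by (induction "is") auto

lemma smooth_on_const: "smooth_on \<Omega> (\<lambda>_. k)"
  by (simp add: smooth_on_def partial_derivs_const)

lemma smooth_on_coord: "smooth_on (\<Omega> :: (real^'n::finite) set) (\<lambda>x. of_real (x $ i))"
proof (rule smooth_on_step)
  have D: "((\<lambda>x::real^'n. complex_of_real (x $ i)) has_derivative (\<lambda>h. of_real (h $ i))) (at x)" for x
    by (intro bounded_linear_imp_has_derivative bounded_linear_compose[OF bounded_linear_of_real]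
          bounded_linear_vec_nth)
  show "(\<lambda>x::real^'n. complex_of_real (x $ i)) differentiable (at x)" for x
    using D unfolding differentiable_def by blast
  have "partial_deriv j (\<lambda>x::real^'n. complex_of_real (x $ i)) = (\<lambda>_. of_real (axis j 1 $ i))" for j
    by (simp add: partial_deriv_def fun_eq_iff frechet_derivative_at[OF D, symmetric])
  then show "smooth_on \<Omega> (partial_deriv j (\<lambda>x. of_real (x $ i)))" for j
    by (simp add: smooth_on_const)
qed

lemma smooth_on_mi_power: "open \<Omega> \<Longrightarrow> smooth_on \<Omega> (\<lambda>\<xi>. mi_power \<xi> \<alpha>)"
proof -
  assume O: "open \<Omega>"
  have pow: "smooth_on \<Omega> (\<lambda>\<xi>. of_real (\<xi> $ i) ^ k)" for i k
    by (induction k) (auto intro!: smooth_on_mult smooth_on_const smooth_on_coord O)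
  have "smooth_on \<Omega> (\<lambda>\<xi>. \<Prod>i\<in>I. of_real (\<xi> $ i) ^ \<alpha> i)" if "finite I" for I
    using that by (induction I) (auto intro!: smooth_on_mult smooth_on_const pow O)
  then show ?thesis unfolding mi_power_def by simp
qed


section \<open>The Colombeau algebra\<close>

type_synonym 'n net = "real \<Rightarrow> real^'n \<Rightarrow> complex"

definition smooth_net :: "(real^'n::finite) set \<Rightarrow> 'n net \<Rightarrow> bool" where
  "smooth_net \<Omega> u \<longleftrightarrow> (\<forall>\<epsilon>\<in>{0<..1}. smooth_on \<Omega> (u \<epsilon>))"

text \<open>Only nonempty \<open>K\<close> is considered, because the supremum of the empty set of reals is
  unspecified.\<close>

definition EM :: "(real^'n::finite) set \<Rightarrow> 'n net set" where
  "EM \<Omega> = {u. smooth_net \<Omega> u \<and>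
     (\<forall>K \<alpha>. compact K \<and> K \<noteq> {} \<and> K \<subseteq> \<Omega> \<longrightarrow>
       (\<exists>p\<ge>0. (\<lambda>\<epsilon>. SUP x\<in>K. norm (mi_deriv \<alpha> (u \<epsilon>) x)) \<in> O[at_right 0](\<lambda>\<epsilon>. \<epsilon> powr (- p))))}"

definition Null :: "(real^'n::finite) set \<Rightarrow> 'n net set" where
  "Null \<Omega> = {u. smooth_net \<Omega> u \<and>
     (\<forall>K \<alpha>. compact K \<and> K \<noteq> {} \<and> K \<subseteq> \<Omega> \<longrightarrow>
       (\<forall>q\<ge>0. (\<lambda>\<epsilon>. SUP x\<in>K. norm (mi_deriv \<alpha> (u \<epsilon>) x)) \<in> O[at_right 0](\<lambda>\<epsilon>. \<epsilon> powr q)))}"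

definition colombeau_rel :: "(real^'n::finite) set \<Rightarrow> ('n net \<times> 'n net) set" where
  "colombeau_rel \<Omega> = {(u, v). u \<in> EM \<Omega> \<and> v \<in> EM \<Omega> \<and> (\<lambda>\<epsilon> x. u \<epsilon> x - v \<epsilon> x) \<in> Null \<Omega>}"

lemma smooth_net_diff:
  assumes "open \<Omega>" "smooth_net \<Omega> u" "smooth_net \<Omega> v"
  shows "smooth_net \<Omega> (\<lambda>\<epsilon> x. u \<epsilon> x - v \<epsilon> x)"
  using assms(2,3) smooth_on_linear[OF assms(1), where c = 1 and d = "-1"]
  unfolding smooth_net_def by simp

lemma mi_deriv_linear:
  assumes "open \<Omega>" "smooth_on \<Omega> f" "smooth_on \<Omega> g" "x \<in> \<Omega>"
  shows "mi_deriv \<alpha> (\<lambda>y. c * f y + d * g y) x = c * mi_deriv \<alpha> f x + d * mi_deriv \<alpha> g x"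
  unfolding mi_deriv_def by (rule partial_derivs_linear[OF assms])

lemma bdd_above_mi_deriv:
  assumes "smooth_on \<Omega> f" "compact K" "K \<subseteq> \<Omega>"
  shows "bdd_above ((\<lambda>x. norm (mi_deriv \<alpha> f x)) ` K)"
proof -
  have "continuous_on K (mi_deriv \<alpha> f)"
    unfolding mi_deriv_def using assms(1,3)
    by (intro continuous_at_imp_continuous_on ballI differentiable_imp_continuous_within)
      (auto simp: smooth_on_def)
  then have "compact ((\<lambda>x. norm (mi_deriv \<alpha> f x)) ` K)"
    using assms(2) by (intro compact_continuous_image continuous_intros)
  then show ?thesis by (intro bounded_imp_bdd_above compact_imp_bounded)
qed

lemma Null_add:
  assumes "open \<Omega>" "u \<in> Null \<Omega>" "v \<in> Null \<Omega>"
  shows "(\<lambda>\<epsilon> x. u \<epsilon> x + v \<epsilon> x) \<in> Null \<Omega>"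
proof -
  have s: "smooth_on \<Omega> (u \<epsilon>)" "smooth_on \<Omega> (v \<epsilon>)" if "\<epsilon> \<in> {0<..1}" for \<epsilon>
    using assms that by (auto simp: Null_def smooth_net_def)
  have ev: "eventually (\<lambda>\<epsilon>::real. \<epsilon> \<in> {0<..<1}) (at_right 0)"
    by (rule eventually_at_right_real) simp
  have "(\<lambda>\<epsilon>. SUP x\<in>K. norm (mi_deriv \<alpha> (\<lambda>x. u \<epsilon> x + v \<epsilon> x) x)) \<in> O[at_right 0](\<lambda>\<epsilon>. \<epsilon> powr q)"
    if K: "compact K" "K \<noteq> {}" "K \<subseteq> \<Omega>" and q: "q \<ge> 0" for K \<alpha> and q :: real
  proof -
    let ?N = "\<lambda>w \<epsilon>. SUP x\<in>K. norm (mi_deriv \<alpha> (w \<epsilon>) x)"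
    have "?N u \<in> O[at_right 0](\<lambda>\<epsilon>. \<epsilon> powr q)" "?N v \<in> O[at_right 0](\<lambda>\<epsilon>. \<epsilon> powr q)"
      using assms K q by (auto simp: Null_def)
    then have sum: "(\<lambda>\<epsilon>. ?N u \<epsilon> + ?N v \<epsilon>) \<in> O[at_right 0](\<lambda>\<epsilon>. \<epsilon> powr q)"
      by (rule sum_in_bigo)
    have "\<forall>\<^sub>F \<epsilon> in at_right 0. norm (?N (\<lambda>\<epsilon> x. u \<epsilon> x + v \<epsilon> x) \<epsilon>) \<le> 1 * norm (?N u \<epsilon> + ?N v \<epsilon>)"
      using ev
    proof eventually_elim
      case (elim \<epsilon>)
      then have \<epsilon>: "\<epsilon> \<in> {0<..1}" by auto
      have ss: "smooth_on \<Omega> (\<lambda>x. u \<epsilon> x + v \<epsilon> x)"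
        using smooth_on_linear[OF assms(1) s(1)[OF \<epsilon>] s(2)[OF \<epsilon>], of 1 1] by simp
      have le: "norm (mi_deriv \<alpha> (\<lambda>x. u \<epsilon> x + v \<epsilon> x) x) \<le> ?N u \<epsilon> + ?N v \<epsilon>" if "x \<in> K" for x
      proof -
        have "mi_deriv \<alpha> (\<lambda>x. u \<epsilon> x + v \<epsilon> x) x = mi_deriv \<alpha> (u \<epsilon>) x + mi_deriv \<alpha> (v \<epsilon>) x"
          using mi_deriv_linear[OF assms(1) s(1)[OF \<epsilon>] s(2)[OF \<epsilon>], of x \<alpha> 1 1] that K(3) by auto
        also have "norm \<dots> \<le> norm (mi_deriv \<alpha> (u \<epsilon>) x) + norm (mi_deriv \<alpha> (v \<epsilon>) x)"
          by (rule norm_triangle_ineq)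
        also have "\<dots> \<le> ?N u \<epsilon> + ?N v \<epsilon>"
          using that s[OF \<epsilon>] K by (intro add_mono cSUP_upper bdd_above_mi_deriv) auto
        finally show ?thesis .
      qed
      have up: "?N (\<lambda>\<epsilon> x. u \<epsilon> x + v \<epsilon> x) \<epsilon> \<le> ?N u \<epsilon> + ?N v \<epsilon>"
        by (rule cSUP_least[OF K(2) le])
      obtain x where x: "x \<in> K" using K(2) by auto
      have "norm (mi_deriv \<alpha> (\<lambda>x. u \<epsilon> x + v \<epsilon> x) x) \<le> ?N (\<lambda>\<epsilon> x. u \<epsilon> x + v \<epsilon> x) \<epsilon>"
        using x ss K by (intro cSUP_upper bdd_above_mi_deriv) auto
      then have "0 \<le> ?N (\<lambda>\<epsilon> x. u \<epsilon> x + v \<epsilon> x) \<epsilon>" by (rule order_trans[OF norm_ge_zero])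
      with up show ?case by simp
    qed
    then show ?thesis by (rule landau_o.big_trans[OF bigoI sum])
  qed
  moreover have "smooth_net \<Omega> (\<lambda>\<epsilon> x. u \<epsilon> x + v \<epsilon> x)"
    using s smooth_on_linear[OF assms(1), where c = 1 and d = 1] unfolding smooth_net_def by simp
  ultimately show ?thesis unfolding Null_def by blast
qed

lemma Null_zero: "(\<lambda>_ _. 0) \<in> Null \<Omega>"
  by (simp add: Null_def smooth_net_def smooth_on_const mi_deriv_def partial_derivs_const)

lemma Null_uminus:
  assumes "open \<Omega>" "u \<in> Null \<Omega>"
  shows "(\<lambda>\<epsilon> x. - u \<epsilon> x) \<in> Null \<Omega>"
proof -
  have s: "smooth_on \<Omega> (u \<epsilon>)" if "\<epsilon> \<in> {0<..1}" for \<epsilon>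
    using assms that by (auto simp: Null_def smooth_net_def)
  have ev: "eventually (\<lambda>\<epsilon>::real. \<epsilon> \<in> {0<..<1}) (at_right 0)"
    by (rule eventually_at_right_real) simp
  have "(\<lambda>\<epsilon>. SUP x\<in>K. norm (mi_deriv \<alpha> (\<lambda>x. - u \<epsilon> x) x)) \<in> O[at_right 0](\<lambda>\<epsilon>. \<epsilon> powr q)"
    if K: "compact K" "K \<noteq> {}" "K \<subseteq> \<Omega>" and q: "q \<ge> 0" for K \<alpha> and q :: real
  proof -
    have "\<forall>\<^sub>F \<epsilon> in at_right 0. (SUP x\<in>K. norm (mi_deriv \<alpha> (u \<epsilon>) x))
        = (SUP x\<in>K. norm (mi_deriv \<alpha> (\<lambda>x. - u \<epsilon> x) x))"
      using ev
    proof eventually_elim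
      case (elim \<epsilon>)
      then have \<epsilon>: "\<epsilon> \<in> {0<..1}" by auto
      have "mi_deriv \<alpha> (\<lambda>x. - u \<epsilon> x) x = - mi_deriv \<alpha> (u \<epsilon>) x" if "x \<in> K" for x
        using mi_deriv_linear[OF assms(1) s[OF \<epsilon>] s[OF \<epsilon>], of x \<alpha> "-1" 0] that K(3) by auto
      then show ?case by (intro SUP_cong) auto
    qed
    moreover have "(\<lambda>\<epsilon>. SUP x\<in>K. norm (mi_deriv \<alpha> (u \<epsilon>) x)) \<in> O[at_right 0](\<lambda>\<epsilon>. \<epsilon> powr q)"
      using assms K q by (auto simp: Null_def)
    ultimately show ?thesis by (simp add: landau_o.big.in_cong)
  qed
  moreover have "smooth_net \<Omega> (\<lambda>\<epsilon> x. - u \<epsilon> x)"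
    unfolding smooth_net_def
  proof
    fix \<epsilon> :: real assume "\<epsilon> \<in> {0<..1}"
    from smooth_on_linear[OF assms(1) s[OF this] s[OF this], of "-1" 0]
    show "smooth_on \<Omega> (\<lambda>x. - u \<epsilon> x)" by simp
  qed
  ultimately show ?thesis unfolding Null_def by blast
qed

lemma equiv_colombeau_rel:
  assumes "open \<Omega>"
  shows "equiv (EM \<Omega>) (colombeau_rel \<Omega>)"
proof (rule equivI)
  show "colombeau_rel \<Omega> \<subseteq> EM \<Omega> \<times> EM \<Omega>"
    by (auto simp: colombeau_rel_def)
  show "refl_on (EM \<Omega>) (colombeau_rel \<Omega>)"
    using Null_zero by (auto simp: refl_on_def colombeau_rel_def)
  show "sym (colombeau_rel \<Omega>)"
    using Null_uminus[OF assms] by (fastforce simp: sym_def colombeau_rel_def)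
  show "trans (colombeau_rel \<Omega>)"
  proof (rule transI)
    fix u v w assume "(u, v) \<in> colombeau_rel \<Omega>" "(v, w) \<in> colombeau_rel \<Omega>"
    then show "(u, w) \<in> colombeau_rel \<Omega>"
      using Null_add[OF assms, of "\<lambda>\<epsilon> x. u \<epsilon> x - v \<epsilon> x" "\<lambda>\<epsilon> x. v \<epsilon> x - w \<epsilon> x"]
      by (simp add: colombeau_rel_def)
  qed
qed

definition colombeau :: "(real^'n::finite) set \<Rightarrow> 'n net set set" where
  "colombeau \<Omega> = EM \<Omega> // colombeau_rel \<Omega>"

definition gclass :: "(real^'n::finite) set \<Rightarrow> 'n net \<Rightarrow> 'n net set" where
  "gclass \<Omega> u = colombeau_rel \<Omega> `` {u}"

text \<open>
  Operations on classes are unions over all representatives \<open>u \<in> U\<close>; by independence of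
  the representative all members of such a union are the same class.
\<close>

definition grestrict :: "(real^'n::finite) set \<Rightarrow> 'n net set \<Rightarrow> 'n net set" where
  "grestrict W U = (\<Union>u\<in>U. gclass W u)"

definition gsupp :: "(real^'n::finite) set \<Rightarrow> 'n net set \<Rightarrow> (real^'n) set" where
  "gsupp \<Omega> U = \<Omega> - \<Union>{W. open W \<and> W \<subseteq> \<Omega> \<and> grestrict W U = gclass W (\<lambda>_ _. 0)}"

definition colombeau_c :: "(real^'n::finite) set \<Rightarrow> 'n net set set" where
  "colombeau_c \<Omega> = {U \<in> colombeau \<Omega>. compact (gsupp \<Omega> U)}"


section \<open>Operators with constant generalized coefficients\<close>

text \<open>
  A polynomial \<open>P\<close> of order at most \<open>m\<close> is given by the family \<open>a\<close> of its coefficients, of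
  which only the \<open>a \<alpha>\<close> with \<open>|\<alpha>| \<le> m\<close> are used.
  \<open>gweight2\<close> is the value \<open>P\<^sup>~\<^sup>2(\<xi>)\<close> of the associated weight function, and \<open>gPD\<close> is
  \<open>P(D)\<close>; both are computed from the representatives \<open>rep_gcomplex (a \<alpha>)\<close> of the
  coefficients, and the result does not depend on them (\<open>gweight2_eq\<close> below for the weight).
\<close>

definition symbol :: "nat \<Rightarrow> (('n \<Rightarrow> nat) \<Rightarrow> complex) \<Rightarrow> real^'n::finite \<Rightarrow> complex" where
  "symbol m c \<xi> = (\<Sum>\<alpha>\<in>mi_upto m. c \<alpha> * mi_power \<xi> \<alpha>)"

definition weight2 :: "nat \<Rightarrow> (('n \<Rightarrow> nat) \<Rightarrow> complex) \<Rightarrow> real^'n::finite \<Rightarrow> real" where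
  "weight2 m c \<xi> = (\<Sum>\<alpha>\<in>mi_upto m. (norm (mi_deriv \<alpha> (symbol m c) \<xi>))\<^sup>2)"

definition gweight2 :: "nat \<Rightarrow> (('n \<Rightarrow> nat) \<Rightarrow> gcomplex) \<Rightarrow> real^'n::finite \<Rightarrow> gcomplex" where
  "gweight2 m a \<xi> = abs_gcomplex (\<lambda>\<epsilon>. of_real (weight2 m (\<lambda>\<alpha>. rep_gcomplex (a \<alpha>) \<epsilon>) \<xi>))"

lemma mi_deriv_symbol:
  "mi_deriv \<beta> (symbol m c) \<xi> = (\<Sum>\<alpha>\<in>mi_upto m. c \<alpha> * mi_deriv \<beta> (\<lambda>\<xi>. mi_power \<xi> \<alpha>) \<xi>)"
proof -
  have "smooth_on UNIV (\<lambda>\<xi>. \<Sum>\<alpha>\<in>A. c \<alpha> * mi_power \<xi> \<alpha>) \<and>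
      mi_deriv \<beta> (\<lambda>\<xi>. \<Sum>\<alpha>\<in>A. c \<alpha> * mi_power \<xi> \<alpha>) \<xi>
        = (\<Sum>\<alpha>\<in>A. c \<alpha> * mi_deriv \<beta> (\<lambda>\<xi>. mi_power \<xi> \<alpha>) \<xi>)"
    if "finite A" for A
    using that
  proof (induction A)
    case empty
    show ?case by (simp add: smooth_on_const mi_deriv_def partial_derivs_const)
  next
    case (insert \<alpha> A)
    let ?f = "\<lambda>\<xi>. mi_power \<xi> \<alpha>" and ?g = "\<lambda>\<xi>. \<Sum>\<alpha>\<in>A. c \<alpha> * mi_power \<xi> \<alpha>"
    have f: "smooth_on UNIV ?f" by (rule smooth_on_mi_power) simp
    have g: "smooth_on UNIV ?g" using insert.IH by simp
    show ?case
      using smooth_on_linear[OF open_UNIV f g, of "c \<alpha>" 1] insert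
        mi_deriv_linear[OF open_UNIV f g, of \<xi> \<beta> "c \<alpha>" 1]
      by simp
  qed
  from this[OF finite_mi_upto] show ?thesis
    unfolding symbol_def[abs_def] by blast
qed

lemma gc_rel_sum:
  assumes "finite A" "\<And>i. i \<in> A \<Longrightarrow> gc_rel (c i) (d i)"
  shows "gc_rel (\<lambda>\<epsilon>. \<Sum>i\<in>A. c i \<epsilon>) (\<lambda>\<epsilon>. \<Sum>i\<in>A. d i \<epsilon>)"
  using assms by (induction A) (auto intro: gc_rel_add gc_rel_refl moderate_const)

lemma gc_rel_cnj: "gc_rel c d \<Longrightarrow> gc_rel (\<lambda>\<epsilon>. cnj (c \<epsilon>)) (\<lambda>\<epsilon>. cnj (d \<epsilon>))"
proof -
  have *: "(\<lambda>\<epsilon>. cnj (f \<epsilon>)) \<in> O[F](g) \<longleftrightarrow> f \<in> O[F](g)" for f :: "real \<Rightarrow> complex" and g F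
    by (subst landau_o.big.norm_iff[symmetric], subst (2) landau_o.big.norm_iff[symmetric]) simp
  assume "gc_rel c d"
  then show ?thesis
    unfolding gc_rel_def moderate_def negligible_net_def by (simp add: * flip: complex_cnj_diff)
qed

lemma gc_rel_weight2:
  assumes "\<And>\<alpha>. \<alpha> \<in> mi_upto m \<Longrightarrow> gc_rel (c \<alpha>) (d \<alpha>)"
  shows "gc_rel (\<lambda>\<epsilon>. of_real (weight2 m (\<lambda>\<alpha>. c \<alpha> \<epsilon>) \<xi>)) (\<lambda>\<epsilon>. of_real (weight2 m (\<lambda>\<alpha>. d \<alpha> \<epsilon>) \<xi>))"
  unfolding weight2_def mi_deriv_symbol of_real_sum complex_norm_square
  by (intro gc_rel_sum finite_mi_upto gc_rel_mult gc_rel_cnj assms gc_rel_refl[OF moderate_const])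

lemma gweight2_eq:
  assumes "\<And>\<alpha>. \<alpha> \<in> mi_upto m \<Longrightarrow> moderate (c \<alpha>)" "\<And>\<alpha>. \<alpha> \<in> mi_upto m \<Longrightarrow> a \<alpha> = abs_gcomplex (c \<alpha>)"
  shows "gweight2 m a \<xi> = abs_gcomplex (\<lambda>\<epsilon>. of_real (weight2 m (\<lambda>\<alpha>. c \<alpha> \<epsilon>) \<xi>))"
  unfolding gweight2_def
proof (rule Quotient3_rel_abs[OF Quotient3_gcomplex], rule gc_rel_weight2)
  fix \<alpha> :: "'a \<Rightarrow> nat" assume "\<alpha> \<in> mi_upto m"
  then show "gc_rel (rep_gcomplex (a \<alpha>)) (c \<alpha>)"
    using assms Quotient3_rel[OF Quotient3_gcomplex, of "rep_gcomplex (a \<alpha>)" "c \<alpha>"]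
    by (simp add: gc_rel_rep gc_rel_refl abs_rep_gcomplex)
qed

definition gPD :: "(real^'n::finite) set \<Rightarrow> nat \<Rightarrow> (('n \<Rightarrow> nat) \<Rightarrow> gcomplex)
    \<Rightarrow> 'n net set \<Rightarrow> 'n net set" where
  "gPD \<Omega> m a U = (\<Union>u\<in>U. gclass \<Omega>
     (\<lambda>\<epsilon> x. \<Sum>\<alpha>\<in>mi_upto m. rep_gcomplex (a \<alpha>) \<epsilon> * mi_D \<alpha> (u \<epsilon>) x))"

end

theory Submission
  imports Defs "HOL-Computational_Algebra.Polynomial"
begin

text \<open>
  No fundamental solution is needed. For fixed \<open>\<epsilon>\<close> a representative \<open>F\<close> of the right-hand side
  with compact support is replaced by the trigonometric polynomial
  \<open>g(x) = \<Sum>\<^sub>k c\<^sub>k (ft F)(\<xi>\<^sub>k) e\<^bsup>i\<xi>\<^sub>k\<cdot>x\<^esup>\<close> with frequencies \<open>\<xi>\<^sub>k = \<epsilon>k + \<theta>\<close>, \<open>k \<in> \<int>\<^sup>n\<close>, where the \<open>c\<^sub>k\<close> are the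
  Fourier coefficients of an approximate identity of period \<open>2\<pi>/\<epsilon>\<close> and \<open>\<theta>\<close> is a shift in the unit
  cube. The period grows as \<open>\<epsilon> \<rightarrow> 0\<close>, so every compact set eventually lies in one cell, and the
  approximate identity may be taken so narrow that \<open>g - F\<close> is negligible. The equation for \<open>g\<close> is
  solved by dividing the coefficients by \<open>P\<^sub>\<epsilon>(\<xi>\<^sub>k)\<close>. A shift \<open>\<theta>\<close> with
  \<open>|P\<^sub>\<epsilon>(\<xi>\<^sub>k)| \<ge> C A\<^sub>\<epsilon> \<Prod>\<^sub>i(1 + |k\<^sub>i|)\<^bsup>-q\<^esup>\<close> for all \<open>k\<close>, \<open>A\<^sub>\<epsilon>\<close> being the sum of the moduli of the coefficients,
  exists because sublevel sets of polynomials are small; invertibility of the weight function bounds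
  \<open>A\<^sub>\<epsilon>\<close> from below by a power of \<open>\<epsilon>\<close>, and the rapid decay of the Fourier transform \<open>ft F\<close>
  absorbs the powers of \<open>k\<close>.
\<close>

section \<open>Partial derivatives\<close>

text \<open>The number of frequencies that a negligible error requires grows faster than every power
  of 1/\<epsilon>, so the bounds that make the solution moderate must not see that number. They do
  not: the Fourier coefficients of the kernel lie between 0 and 1, and the exceptional shifts
  belonging to the index k have measure of order at most the product of the (1 + |k_i|)^(-2), which
  is summable over the whole lattice. Accuracy is therefore free. A shift is unavoidable, because
  \<open>P\<^sub>\<epsilon>\<close> may vanish at points of the unshifted lattice; a shift along a
  curve is enough, which reduces small values of a symbol to small values of polynomials in one
  variable. The size of \<open>P\<^sub>\<epsilon>\<close> is measured by its coefficients and not by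
  its value at a point, because translation of the symbol changes that measure only by a factor
  polynomial in the translation. In this way invertibility of the weight at a single point controls
  all frequencies at once.\<close>

lemma smooth_on_differentiable: "smooth_on \<Omega> f \<Longrightarrow> x \<in> \<Omega> \<Longrightarrow> f differentiable (at x)"
  unfolding smooth_on_def by (metis partial_derivs.simps(1))

lemma smooth_on_subset: "smooth_on \<Omega> f \<Longrightarrow> W \<subseteq> \<Omega> \<Longrightarrow> smooth_on W f"
  unfolding smooth_on_def by blast

lemma smooth_on_cong_open:
  assumes "open \<Omega>" "\<And>y. y \<in> \<Omega> \<Longrightarrow> f y = g y" "smooth_on \<Omega> f"
  shows "smooth_on \<Omega> g"
  unfolding smooth_on_def
proof (intro allI ballI)
  fix "is" x assume x: "x \<in> \<Omega>"
  show "partial_derivs is g differentiable at x"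
    by (rule differentiable_cong_open[OF assms(1) x partial_derivs_cong_open[OF assms(1) _ assms(2)]])
      (use assms(3) x in \<open>auto simp: smooth_on_def\<close>)
qed

lemma smooth_on_continuous_on: "smooth_on \<Omega> f \<Longrightarrow> continuous_on \<Omega> f"
  by (intro continuous_at_imp_continuous_on ballI differentiable_imp_continuous_within
      smooth_on_differentiable)

lemma partial_deriv_cong_open:
  assumes "open \<Omega>" "x \<in> \<Omega>" "\<And>y. y \<in> \<Omega> \<Longrightarrow> f y = g y"
  shows "partial_deriv i f x = partial_deriv i g x"
  using frechet_derivative_cong_open[OF assms] by (simp add: partial_deriv_def)

text \<open>Iterated derivatives never have to be computed: it is enough to find a class
  \<open>S\<close> of differentiable functions that is closed, up to equality on
  \<open>\<Omega>\<close>, under each partial derivative. The flat functions and reciprocals are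
  both treated through such a class.\<close>

lemma smooth_on_coinduct:
  assumes "open \<Omega>" "f \<in> S"
    and diff: "\<And>g x. g \<in> S \<Longrightarrow> x \<in> \<Omega> \<Longrightarrow> g differentiable (at x)"
    and step: "\<And>g i. g \<in> S \<Longrightarrow> \<exists>h\<in>S. \<forall>x\<in>\<Omega>. partial_deriv i g x = h x"
  shows "smooth_on \<Omega> f"
proof -
  have "\<exists>h\<in>S. \<forall>x\<in>\<Omega>. partial_derivs is f x = h x" for "is"
  proof (induction "is")
    case (Cons i "is")
    then obtain h where h: "h \<in> S" "\<forall>x\<in>\<Omega>. partial_derivs is f x = h x" by blast
    from step[OF h(1), of i] obtain k where k: "k \<in> S" "\<forall>x\<in>\<Omega>. partial_deriv i h x = k x"
      by blast
    have "partial_derivs (i # is) f x = k x" if "x \<in> \<Omega>" for x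
      using partial_deriv_cong_open[OF assms(1) that, of "partial_derivs is f" h] h k that by simp
    with k(1) show ?case by blast
  qed (use assms in auto)
  then show ?thesis
    unfolding smooth_on_def using diff differentiable_cong_open[OF assms(1)] by metis
qed

lemma has_vector_derivative_partial_deriv:
  fixes f :: "real^'n::finite \<Rightarrow> complex"
  assumes "f differentiable (at (x + t *\<^sub>R axis i 1))"
  shows "((\<lambda>t. f (x + t *\<^sub>R axis i 1)) has_vector_derivative partial_deriv i f (x + t *\<^sub>R axis i 1)) (at t)"
proof -
  let ?F = "frechet_derivative f (at (x + t *\<^sub>R axis i 1))"
  have "(f has_derivative ?F) (at (x + t *\<^sub>R axis i 1))"
    using assms by (simp add: frechet_derivative_works)
  then have 1: "(f has_derivative ?F) (at (x + t *\<^sub>R axis i 1) within range (\<lambda>t. x + t *\<^sub>R axis i 1))"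
    by (rule has_derivative_at_withinI)
  have "((\<lambda>t. x + t *\<^sub>R axis i 1) has_derivative (\<lambda>h. h *\<^sub>R axis i 1)) (at t)"
    by (auto intro!: derivative_eq_intros)
  from has_derivative_in_compose[OF this 1]
  have "((\<lambda>t. f (x + t *\<^sub>R axis i 1)) has_derivative (\<lambda>h. ?F (h *\<^sub>R axis i 1))) (at t)" .
  moreover have "?F (h *\<^sub>R axis i 1) = h *\<^sub>R partial_deriv i f (x + t *\<^sub>R axis i 1)" for h
    using linear_frechet_derivative[OF assms] by (simp add: linear_scale partial_deriv_def)
  ultimately show ?thesis by (simp add: has_vector_derivative_def)
qed

text \<open>The mean value theorem is applied in direction \<open>i\<close> to the increment in
  direction \<open>j\<close>, and then in direction \<open>j\<close> to the derivative so obtained.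
  It needs real values, hence the functional \<open>L\<close>, later taken to be the real and the
  imaginary part.\<close>

lemma real_mixed_difference:
  fixes f :: "real^'n::finite \<Rightarrow> complex" and L :: "complex \<Rightarrow> real"
  assumes L: "bounded_linear L" and h: "h > 0"
    and d1: "\<And>a b. a \<in> {0..h} \<Longrightarrow> b \<in> {0..h} \<Longrightarrow> f differentiable (at (x + a *\<^sub>R axis i 1 + b *\<^sub>R axis j 1))"
    and d2: "\<And>a b. a \<in> {0..h} \<Longrightarrow> b \<in> {0..h} \<Longrightarrow>
      partial_deriv i f differentiable (at (x + a *\<^sub>R axis i 1 + b *\<^sub>R axis j 1))"
  shows "\<exists>a\<in>{0..h}. \<exists>b\<in>{0..h}.
    L (f (x + h *\<^sub>R axis i 1 + h *\<^sub>R axis j 1) - f (x + h *\<^sub>R axis i 1) - f (x + h *\<^sub>R axis j 1) + f x)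
     = h * h * L (partial_deriv j (partial_deriv i f) (x + a *\<^sub>R axis i 1 + b *\<^sub>R axis j 1))"
proof -
  interpret L: bounded_linear L by fact
  let ?e = "axis i 1 :: real^'n" and ?k = "axis j 1 :: real^'n"
  let ?g = "\<lambda>a. L (f (x + h *\<^sub>R ?k + a *\<^sub>R ?e)) - L (f (x + a *\<^sub>R ?e))"
  have "\<exists>a::real. a > 0 \<and> a < h \<and> ?g h - ?g 0 = (h - 0) *
      (L (partial_deriv i f (x + h *\<^sub>R ?k + a *\<^sub>R ?e)) - L (partial_deriv i f (x + a *\<^sub>R ?e)))"
  proof (rule MVT2[OF h])
    fix a assume a: "0 \<le> a" "a \<le> h"
    have 1: "((\<lambda>a. f (x + h *\<^sub>R ?k + a *\<^sub>R ?e)) has_vector_derivative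
        partial_deriv i f (x + h *\<^sub>R ?k + a *\<^sub>R ?e)) (at a)"
      by (rule has_vector_derivative_partial_deriv) (use d1[of a h] a h in \<open>simp add: algebra_simps\<close>)
    have 2: "((\<lambda>a. f (x + a *\<^sub>R ?e)) has_vector_derivative partial_deriv i f (x + a *\<^sub>R ?e)) (at a)"
      by (rule has_vector_derivative_partial_deriv) (use d1[of a 0] a h in simp)
    show "(?g has_real_derivative
        L (partial_deriv i f (x + h *\<^sub>R ?k + a *\<^sub>R ?e)) - L (partial_deriv i f (x + a *\<^sub>R ?e))) (at a)"
      unfolding has_real_derivative_iff_has_vector_derivative
      by (intro has_vector_derivative_diff L.has_vector_derivative 1 2)
  qed
  then obtain a where "0 < a" "a < h" and "?g h - ?g 0 = (h - 0) *
      (L (partial_deriv i f (x + h *\<^sub>R ?k + a *\<^sub>R ?e)) - L (partial_deriv i f (x + a *\<^sub>R ?e)))"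
    by blast
  then have a: "a \<in> {0..h}" and ga: "?g h - ?g 0 = h *
      (L (partial_deriv i f (x + h *\<^sub>R ?k + a *\<^sub>R ?e)) - L (partial_deriv i f (x + a *\<^sub>R ?e)))"
    by simp_all
  let ?G = "\<lambda>b. L (partial_deriv i f (x + a *\<^sub>R ?e + b *\<^sub>R ?k))"
  have "\<exists>b::real. b > 0 \<and> b < h \<and> ?G h - ?G 0 = (h - 0) *
      L (partial_deriv j (partial_deriv i f) (x + a *\<^sub>R ?e + b *\<^sub>R ?k))"
  proof (rule MVT2[OF h])
    fix b assume b: "0 \<le> b" "b \<le> h"
    show "(?G has_real_derivative L (partial_deriv j (partial_deriv i f) (x + a *\<^sub>R ?e + b *\<^sub>R ?k))) (at b)"
      unfolding has_real_derivative_iff_has_vector_derivative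
      by (intro L.has_vector_derivative has_vector_derivative_partial_deriv) (use d2[of a b] a b in simp)
  qed
  then obtain b where "0 < b" "b < h" and "?G h - ?G 0 = (h - 0) *
      L (partial_deriv j (partial_deriv i f) (x + a *\<^sub>R ?e + b *\<^sub>R ?k))"
    by blast
  then have b: "b \<in> {0..h}" and Gb: "?G h - ?G 0 = h *
      L (partial_deriv j (partial_deriv i f) (x + a *\<^sub>R ?e + b *\<^sub>R ?k))"
    by simp_all
  have "L (f (x + h *\<^sub>R ?e + h *\<^sub>R ?k) - f (x + h *\<^sub>R ?e) - f (x + h *\<^sub>R ?k) + f x) = ?g h - ?g 0"
    by (simp add: L.add L.diff algebra_simps)
  also have "\<dots> = h * (?G h - ?G 0)"
    unfolding ga by (simp add: algebra_simps)
  finally show ?thesis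
    using a b Gb by (intro bexI[of _ a] bexI[of _ b]) auto
qed

text \<open>
  \<^const>\<open>EM\<close> and \<^const>\<open>Null\<close> control each derivative only in the order chosen by \<^const>\<open>mi_deriv\<close>,
  but products lead to all orders of differentiation.
\<close>

lemma partial_deriv_commute:
  fixes f :: "real^'n::finite \<Rightarrow> complex"
  assumes "open \<Omega>" "smooth_on \<Omega> f" "x \<in> \<Omega>"
  shows "partial_deriv j (partial_deriv i f) x = partial_deriv i (partial_deriv j f) x"
proof -
  let ?A = "partial_deriv j (partial_deriv i f)" and ?B = "partial_deriv i (partial_deriv j f)"
  have AB: "isCont ?A x" "isCont ?B x"
    using assms by (auto intro!: differentiable_imp_continuous_within smooth_on_differentiable smooth_on_partial_deriv)
  \<comment> \<open>Schwarz's argument: the second difference is symmetric in \<open>i\<close> and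
    \<open>j\<close>, so the two mixed derivatives take equal values at two points near
    \<open>x\<close>. By continuity they cannot then differ by \<open>2 * e\<close> at
    \<open>x\<close>.\<close>
  have "L (?A x) = L (?B x)" if L: "bounded_linear L" for L :: "complex \<Rightarrow> real"
  proof (rule ccontr)
    interpret L: bounded_linear L by fact
    assume "L (?A x) \<noteq> L (?B x)"
    define e where "e = \<bar>L (?A x) - L (?B x)\<bar> / 2"
    have e: "e > 0" using \<open>L (?A x) \<noteq> L (?B x)\<close> by (simp add: e_def)
    have "isCont (\<lambda>x. L (?A x)) x" "isCont (\<lambda>x. L (?B x)) x"
      using AB by (auto intro: L.isCont)
    then have "\<exists>d>0. \<forall>y. dist y x < d \<longrightarrow> \<bar>L (?A y) - L (?A x)\<bar> < e"
        "\<exists>d>0. \<forall>y. dist y x < d \<longrightarrow> \<bar>L (?B y) - L (?B x)\<bar> < e"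
      using e unfolding continuous_at_eps_delta dist_real_def by blast+
    then obtain d1 d2 where d: "d1 > 0" "\<And>y. dist y x < d1 \<Longrightarrow> \<bar>L (?A y) - L (?A x)\<bar> < e"
        "d2 > 0" "\<And>y. dist y x < d2 \<Longrightarrow> \<bar>L (?B y) - L (?B x)\<bar> < e"
      by blast
    obtain d3 where d3: "d3 > 0" "ball x d3 \<subseteq> \<Omega>" using assms open_contains_ball by blast
    define h where "h = min d1 (min d2 d3) / 3"
    have h: "h > 0" "3 * h \<le> d1" "3 * h \<le> d2" "3 * h \<le> d3" using d d3 by (auto simp: h_def)
    have near: "dist (x + a *\<^sub>R axis i 1 + b *\<^sub>R axis j 1) x < 3 * h"
      "x + a *\<^sub>R axis i 1 + b *\<^sub>R axis j 1 \<in> \<Omega>" if "a \<in> {0..h}" "b \<in> {0..h}" for a b i j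
    proof -
      have "norm (a *\<^sub>R axis i 1 + b *\<^sub>R axis j (1::real))
          \<le> norm (a *\<^sub>R axis i (1::real)) + norm (b *\<^sub>R axis j (1::real))"
        by (rule norm_triangle_ineq)
      also have "\<dots> \<le> 2 * h" using that by (simp add: norm_axis_1)
      finally show *: "dist (x + a *\<^sub>R axis i 1 + b *\<^sub>R axis j 1) x < 3 * h"
        using h(1) by (simp add: dist_norm)
      show "x + a *\<^sub>R axis i 1 + b *\<^sub>R axis j 1 \<in> \<Omega>"
        using d3(2) * h(4) by (auto simp: dist_commute)
    qed
    note D = smooth_on_differentiable[OF assms(2)] smooth_on_differentiable[OF smooth_on_partial_deriv[OF assms(2)]]
    let ?D = "L (f (x + h *\<^sub>R axis i 1 + h *\<^sub>R axis j 1) - f (x + h *\<^sub>R axis i 1) - f (x + h *\<^sub>R axis j 1) + f x)"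
    obtain a b where ab: "a \<in> {0..h}" "b \<in> {0..h}"
      "?D = h * h * L (?A (x + a *\<^sub>R axis i 1 + b *\<^sub>R axis j 1))"
      using real_mixed_difference[OF L h(1) D(1) D(2), OF near(2) near(2), of i j] by blast
    obtain a' b' where ab': "a' \<in> {0..h}" "b' \<in> {0..h}"
      "L (f (x + h *\<^sub>R axis j 1 + h *\<^sub>R axis i 1) - f (x + h *\<^sub>R axis j 1) - f (x + h *\<^sub>R axis i 1) + f x)
        = h * h * L (?B (x + a' *\<^sub>R axis j 1 + b' *\<^sub>R axis i 1))"
      using real_mixed_difference[OF L h(1) D(1) D(2), OF near(2) near(2), of j i] by blast
    have "h * h * L (?A (x + a *\<^sub>R axis i 1 + b *\<^sub>R axis j 1)) = h * h * L (?B (x + a' *\<^sub>R axis j 1 + b' *\<^sub>R axis i 1))"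
      using ab(3) ab'(3) by (simp add: algebra_simps)
    then have "L (?A (x + a *\<^sub>R axis i 1 + b *\<^sub>R axis j 1)) = L (?B (x + a' *\<^sub>R axis j 1 + b' *\<^sub>R axis i 1))"
      using h(1) by simp
    moreover have "\<bar>L (?A (x + a *\<^sub>R axis i 1 + b *\<^sub>R axis j 1)) - L (?A x)\<bar> < e"
      by (rule d(2)[OF less_le_trans[OF near(1)[OF ab(1,2)] h(2)]])
    moreover have "\<bar>L (?B (x + a' *\<^sub>R axis j 1 + b' *\<^sub>R axis i 1)) - L (?B x)\<bar> < e"
      by (rule d(4)[OF less_le_trans[OF near(1)[OF ab'(1,2)] h(3)]])
    ultimately show False unfolding e_def by (simp add: abs_if split: if_splits)
  qed
  from this[OF bounded_linear_Re] this[OF bounded_linear_Im] show ?thesis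
    by (simp add: complex_eq_iff)
qed

lemma partial_derivs_move_front:
  assumes "open \<Omega>" "smooth_on \<Omega> f" "x \<in> \<Omega>" "j \<in> set is"
  shows "partial_derivs is f x = partial_derivs (j # remove1 j is) f x"
  using assms(3,4)
proof (induction "is" arbitrary: x)
  case (Cons i "is")
  show ?case
  proof (cases "i = j")
    case False
    then have j: "j \<in> set is" using Cons.prems by auto
    have "partial_derivs (i # is) f x = partial_derivs (i # j # remove1 j is) f x"
      using partial_deriv_cong_open[OF assms(1) Cons.prems(1) Cons.IH[OF _ j]] by simp
    also have "\<dots> = partial_derivs (j # i # remove1 j is) f x"
      using partial_deriv_commute[OF assms(1) smooth_on_partial_derivs[OF assms(2)] Cons.prems(1)] by simp
    finally show ?thesis using False by simp
  qed simp
qed simp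

lemma partial_derivs_perm:
  assumes "open \<Omega>" "smooth_on \<Omega> f" "x \<in> \<Omega>" "\<And>i. count_list is i = count_list js i"
  shows "partial_derivs is f x = partial_derivs js f x"
  using assms(3,4)
proof (induction js arbitrary: "is" x)
  case Nil
  have "i \<notin> set is" for i using Nil(2)[of i] by (simp add: count_list_0_iff)
  then have "is = []" by (cases "is") auto
  then show ?case by simp
next
  case (Cons j js)
  then have j: "j \<in> set is" by (metis count_list_0_iff list.set_intros(1))
  have c: "count_list (remove1 j is) i = count_list js i" for i
  proof -
    have "count_list (remove1 j is) i = count_list is i - (if i = j then 1 else 0)"
      by (induction "is") auto
    with Cons.prems(2)[of i] show ?thesis by auto
  qed
  have "partial_derivs is f x = partial_derivs (j # remove1 j is) f x"
    by (rule partial_derivs_move_front[OF assms(1,2) Cons.prems(1) j])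
  also have "\<dots> = partial_derivs (j # js) f x"
    using partial_deriv_cong_open[OF assms(1) Cons.prems(1) Cons.IH[OF _ c]] by simp
  finally show ?case .
qed

lemma mi_deriv_eq_partial_derivs: "\<exists>is. mi_deriv \<alpha> = partial_derivs is \<and> (\<forall>i. count_list is i = \<alpha> i)"
  unfolding mi_deriv_def using someI_ex[OF ex_mi_list[of \<alpha>]] by blast

lemma partial_derivs_eq_mi_deriv:
  assumes "open \<Omega>" "smooth_on \<Omega> f" "x \<in> \<Omega>"
  shows "partial_derivs is f x = mi_deriv (count_list is) f x"
proof -
  obtain js where "mi_deriv (count_list is) = partial_derivs js" "\<forall>i. count_list js i = count_list is i"
    using mi_deriv_eq_partial_derivs by blast
  then show ?thesis using partial_derivs_perm[OF assms] by metis
qed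

text \<open>Leibniz's rule in the crude form in which every differentiation doubles the number of
  terms, whence the power of 2. The induction removes the innermost derivative, so that the
  hypotheses pass from the factors to their first derivatives.\<close>

lemma norm_partial_derivs_mult_le:
  assumes "open \<Omega>" "smooth_on \<Omega> f" "smooth_on \<Omega> g" "x \<in> \<Omega>"
    and "\<And>js. length js \<le> length is \<Longrightarrow> norm (partial_derivs js f x) \<le> A"
    and "\<And>js. length js \<le> length is \<Longrightarrow> norm (partial_derivs js g x) \<le> B"
  shows "norm (partial_derivs is (\<lambda>y. f y * g y) x) \<le> 2 ^ length is * (A * B)"
  using assms(2,3,5,6)
proof (induction "is" arbitrary: f g rule: rev_induct)
  case Nil
  from Nil(3)[of "[]"] Nil(4)[of "[]"] show ?case
    by (auto simp: norm_mult intro!: mult_mono intro: order_trans[OF norm_ge_zero])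
next
  case (snoc i "is")
  let ?F = "\<lambda>y. f y * partial_deriv i g y" and ?G = "\<lambda>y. partial_deriv i f y * g y"
  note s = snoc.prems(1,2) smooth_on_partial_deriv[OF snoc.prems(1)] smooth_on_partial_deriv[OF snoc.prems(2)]
  have A: "norm (partial_derivs js f x) \<le> A" "norm (partial_derivs js (partial_deriv i f) x) \<le> A"
    and B: "norm (partial_derivs js g x) \<le> B" "norm (partial_derivs js (partial_deriv i g) x) \<le> B"
    if "length js \<le> length is" for js
    using that snoc.prems(3)[of js] snoc.prems(3)[of "js @ [i]"] snoc.prems(4)[of js] snoc.prems(4)[of "js @ [i]"]
    by (simp_all add: partial_derivs_append)
  have "partial_derivs (is @ [i]) (\<lambda>y. f y * g y) x = partial_derivs is (\<lambda>y. 1 * ?F y + 1 * ?G y) x"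
    unfolding partial_derivs_append partial_derivs.simps
    by (rule partial_derivs_cong_open[OF assms(1) assms(4)])
      (simp add: partial_deriv_mult smooth_on_differentiable[OF s(1)] smooth_on_differentiable[OF s(2)])
  also have "\<dots> = partial_derivs is ?F x + partial_derivs is ?G x"
    by (subst partial_derivs_linear[OF assms(1) _ _ assms(4)]) (auto intro!: smooth_on_mult assms(1) s)
  also have "norm \<dots> \<le> norm (partial_derivs is ?F x) + norm (partial_derivs is ?G x)"
    by (rule norm_triangle_ineq)
  also have "\<dots> \<le> 2 ^ length is * (A * B) + 2 ^ length is * (A * B)"
    using A B by (intro add_mono snoc.IH s)
  finally show ?case by (simp add: mult_ac)
qed

section \<open>Trigonometric sums and their derivatives\<close>

definition trig_sum :: "'k set \<Rightarrow> ('k \<Rightarrow> complex) \<Rightarrow> ('k \<Rightarrow> real^'n) \<Rightarrow> real^'n::finite \<Rightarrow> complex" where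
  "trig_sum A c \<xi> x = (\<Sum>k\<in>A. c k * cis (\<xi> k \<bullet> x))"

lemma has_derivative_trig_sum:
  "(trig_sum A c \<xi> has_derivative (\<lambda>h. \<Sum>k\<in>A. c k * (\<i> * of_real (\<xi> k \<bullet> h) * cis (\<xi> k \<bullet> x)))) (at x)"
proof -
  have "((\<lambda>x. cis (\<xi> \<bullet> x)) has_derivative (\<lambda>h. \<i> * of_real (\<xi> \<bullet> h) * cis (\<xi> \<bullet> x))) (at x)" for \<xi> :: "real^'a"
  proof -
    have "((\<lambda>x. \<i> * of_real (\<xi> \<bullet> x)) has_derivative (\<lambda>h. \<i> * of_real (\<xi> \<bullet> h))) (at x)"
      by (auto intro!: derivative_eq_intros)
    from has_derivative_compose[OF this DERIV_exp[unfolded has_field_derivative_def]]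
    show ?thesis by (simp add: cis_conv_exp mult_ac)
  qed
  then show ?thesis unfolding trig_sum_def[abs_def] by (intro derivative_intros)
qed

lemma partial_deriv_trig_sum:
  "partial_deriv i (trig_sum A c \<xi>) = trig_sum A (\<lambda>k. c k * (\<i> * of_real (\<xi> k $ i))) \<xi>"
  using frechet_derivative_at[OF has_derivative_trig_sum[of A c \<xi>], symmetric]
  by (simp add: fun_eq_iff partial_deriv_def trig_sum_def inner_axis mult_ac)

text \<open>Differentiation only multiplies the coefficients. Trigonometric sums with given
  frequencies are thus stable under all operators in use, and estimates of derivatives reduce to
  estimates of coefficients.\<close>

lemma partial_derivs_trig_sum:
  "partial_derivs is (trig_sum A c \<xi>) = trig_sum A (\<lambda>k. c k * (\<Prod>i\<leftarrow>is. \<i> * of_real (\<xi> k $ i))) \<xi>"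
  by (induction "is") (simp_all add: partial_deriv_trig_sum mult_ac)

lemma smooth_on_trig_sum: "smooth_on \<Omega> (trig_sum A c \<xi>)"
  unfolding smooth_on_def partial_derivs_trig_sum
  using has_derivative_trig_sum differentiable_def by blast

lemma prod_list_eq_mi_power:
  assumes "\<And>i. count_list is i = \<alpha> i"
  shows "(\<Prod>i\<leftarrow>is. \<i> * of_real (\<xi> $ i)) = \<i> ^ mi_order \<alpha> * mi_power \<xi> \<alpha>"
proof -
  have "(\<Prod>i\<leftarrow>is. \<i> * of_real (\<xi> $ i)) = (\<Prod>i\<in>UNIV. (\<i> * of_real (\<xi> $ i)) ^ count_list is i)"
  proof (induction "is")
    case (Cons j "is")
    have "(\<Prod>i\<in>UNIV. (\<i> * of_real (\<xi> $ i)) ^ count_list (j # is) i)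
       = (\<Prod>i\<in>UNIV. (\<i> * of_real (\<xi> $ i)) ^ count_list is i * (if i = j then \<i> * of_real (\<xi> $ i) else 1))"
      by (intro prod.cong) auto
    also have "\<dots> = (\<Prod>i\<in>UNIV. (\<i> * of_real (\<xi> $ i)) ^ count_list is i) * (\<i> * of_real (\<xi> $ j))"
      by (simp add: prod.distrib)
    finally show ?case using Cons by simp
  qed simp
  also have "\<dots> = \<i> ^ mi_order \<alpha> * mi_power \<xi> \<alpha>"
    using assms by (simp add: power_mult_distrib prod.distrib mi_power_def mi_order_def power_sum)
  finally show ?thesis .
qed

lemma mi_D_trig_sum: "mi_D \<alpha> (trig_sum A c \<xi>) = trig_sum A (\<lambda>k. c k * mi_power (\<xi> k) \<alpha>) \<xi>"
proof
  fix x
  obtain "is" where "is": "mi_deriv \<alpha> = partial_derivs is" "\<forall>i. count_list is i = \<alpha> i"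
    using mi_deriv_eq_partial_derivs by blast
  have "(- \<i>) ^ n * \<i> ^ n = 1" for n by (simp flip: power_mult_distrib)
  then have *: "(- \<i>) ^ n * (c * (\<i> ^ n * p) * z) = c * p * z" for n c p z
    by (metis (no_types, lifting) mult.assoc mult.left_commute mult_1)
  show "mi_D \<alpha> (trig_sum A c \<xi>) x = trig_sum A (\<lambda>k. c k * mi_power (\<xi> k) \<alpha>) \<xi> x"
    using "is" by (simp add: mi_D_def partial_derivs_trig_sum prod_list_eq_mi_power[of _ \<alpha>] trig_sum_def
        sum_distrib_left *)
qed

section \<open>Smooth cutoff functions\<close>

text \<open>With arbitrary \<open>p\<close>, so that the family is closed under differentiation.\<close>

definition flat :: "real poly \<Rightarrow> real \<Rightarrow> real" where
  "flat p s = (if s > 0 then poly p (1 / s) * exp (- (1 / s)) else 0)"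

lemma poly_times_exp_minus_tendsto_0: "((\<lambda>y::real. poly p y * exp (- y)) \<longlongrightarrow> 0) at_top"
proof -
  have "((\<lambda>y::real. \<Sum>i\<le>degree p. coeff p i * (y ^ i / exp y)) \<longlongrightarrow> (\<Sum>i\<le>degree p. coeff p i * 0)) at_top"
    by (intro tendsto_intros tendsto_power_div_exp_0)
  then show ?thesis
    by (simp add: poly_altdef exp_minus divide_inverse sum_distrib_left mult_ac)
qed

text \<open>For \<open>s > 0\<close> the derivative of \<open>p(1/s) exp(-1/s)\<close> is
  \<open>s^(-2) (p - p')(1/s) exp(-1/s)\<close>, which is of the same kind, with the polynomial
  multiplied by the square of its variable. At 0 the exponential beats every polynomial.\<close>

lemma DERIV_flat: "(flat p has_real_derivative flat ([:0, 0, 1:] * (p - pderiv p)) s) (at s)"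
proof -
  consider "s > 0" | "s < 0" | "s = 0" by linarith
  then show ?thesis
  proof cases
    case 1
    have "((\<lambda>s. poly p (1 / s) * exp (- (1 / s))) has_real_derivative
        flat ([:0, 0, 1:] * (p - pderiv p)) s) (at s)"
      using 1 by (auto intro!: derivative_eq_intros DERIV_chain2[OF poly_DERIV]
          simp: flat_def field_simps power2_eq_square)
    then show ?thesis
      by (rule DERIV_cong_ev[THEN iffD1, OF refl _ refl, rotated])
        (use eventually_nhds_in_open[of "{0<..}" s] 1 in \<open>auto elim!: eventually_mono simp: flat_def\<close>)
  next
    case 2
    have "((\<lambda>s. 0) has_real_derivative flat ([:0, 0, 1:] * (p - pderiv p)) s) (at s)"
      using 2 by (simp add: flat_def)
    then show ?thesis
      by (rule DERIV_cong_ev[THEN iffD1, OF refl _ refl, rotated])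
        (use eventually_nhds_in_open[of "{..<0}" s] 2 in \<open>auto elim!: eventually_mono simp: flat_def\<close>)
  next
    case 3
    \<comment> \<open>Dividing by \<open>h\<close> in the difference quotient adds one factor
      \<open>1/h\<close>, hence \<open>pCons 0 p\<close>.\<close>
    have "((\<lambda>h. poly (pCons 0 p) (inverse h) * exp (- inverse h)) \<longlongrightarrow> 0) (at_right (0::real))"
      using filterlim_compose[OF poly_times_exp_minus_tendsto_0 filterlim_inverse_at_top_right] .
    then have "((\<lambda>h. (flat p h - flat p 0) / h) \<longlongrightarrow> 0) (at_right 0)"
      by (rule Lim_transform_eventually)
        (auto simp: eventually_at_right_less flat_def divide_inverse
          intro!: eventually_at_rightI[of 0 1])
    moreover have "((\<lambda>h. (flat p h - flat p 0) / h) \<longlongrightarrow> 0) (at_left 0)"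
      by (rule Lim_transform_eventually[OF tendsto_const])
        (auto simp: flat_def intro!: eventually_at_leftI[of "-1" 0])
    ultimately have "((\<lambda>h. (flat p h - flat p 0) / h) \<longlongrightarrow> 0) (at 0)"
      by (simp add: filterlim_split_at)
    then show ?thesis using 3 by (simp add: DERIV_def flat_def)
  qed
qed

lemma smooth_on_flat:
  "smooth_on UNIV (\<lambda>x::real^'n::finite. complex_of_real (flat p (a * x $ i + b)))"
proof (rule smooth_on_coinduct[where S = "range (\<lambda>p x. complex_of_real (flat p (a * x $ i + b)))"])
  have D: "((\<lambda>x::real^'n. complex_of_real (flat p (a * x $ i + b))) has_derivative
      (\<lambda>h. of_real (flat ([:0, 0, 1:] * (p - pderiv p)) (a * x $ i + b) * (a * h $ i)))) (at x)" for p x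
  proof -
    have "((\<lambda>x::real^'n. a * x $ i + b) has_derivative (\<lambda>h. a * h $ i)) (at x)"
      by (auto intro!: derivative_eq_intros bounded_linear_imp_has_derivative bounded_linear_vec_nth)
    from has_derivative_compose[OF this DERIV_flat[unfolded has_field_derivative_def]]
    show ?thesis by (rule has_derivative_of_real)
  qed
  show "g differentiable at x" if "g \<in> range (\<lambda>p x. complex_of_real (flat p (a * x $ i + b)))"
    for g and x :: "real^'n"
    using that D differentiable_def by blast
  have flat_smult: "flat (smult c q) s = c * flat q s" for c q s by (simp add: flat_def)
  show "\<exists>h\<in>range (\<lambda>p x. complex_of_real (flat p (a * x $ i + b))). \<forall>x\<in>UNIV. partial_deriv j g x = h x"
    if "g \<in> range (\<lambda>p x. complex_of_real (flat p (a * x $ i + b)))" for g and j :: 'n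
  proof -
    from that obtain p where g: "g = (\<lambda>x. complex_of_real (flat p (a * x $ i + b)))" by blast
    have "partial_deriv j g x =
        complex_of_real (flat (smult (a * axis j 1 $ i) ([:0, 0, 1:] * (p - pderiv p))) (a * x $ i + b))"
      for x
      unfolding g partial_deriv_def frechet_derivative_at[OF D, symmetric] flat_smult
      by (simp add: mult_ac)
    then show ?thesis by blast
  qed
qed auto

text \<open>The class of all \<open>h / f^k\<close> with smooth \<open>h\<close> is closed under
  differentiation: the new numerator is \<open>h' f - k h f'\<close> and the exponent grows by
  one.\<close>

lemma smooth_on_inverse:
  fixes f :: "real^'n::finite \<Rightarrow> complex"
  assumes "open \<Omega>" "smooth_on \<Omega> f" "\<And>x. x \<in> \<Omega> \<Longrightarrow> f x \<noteq> 0"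
  shows "smooth_on \<Omega> (\<lambda>x. inverse (f x))"
proof -
  let ?S = "{\<lambda>x. h x * inverse (f x) ^ k |h k. smooth_on \<Omega> h}"
  have D: "((\<lambda>x. h x * inverse (f x) ^ k) has_derivative
      (\<lambda>v. (frechet_derivative h (at x) v * f x - of_nat k * h x * frechet_derivative f (at x) v)
        * inverse (f x) ^ Suc k)) (at x)"
    if h: "smooth_on \<Omega> h" and x: "x \<in> \<Omega>" for h k x
  proof -
    have "(h has_derivative frechet_derivative h (at x)) (at x)"
      "(f has_derivative frechet_derivative f (at x)) (at x)"
      using smooth_on_differentiable[OF h x] smooth_on_differentiable[OF assms(2) x]
      by (simp_all add: frechet_derivative_works[symmetric])
    note 1 = has_derivative_mult[OF this(1)
        has_derivative_power[OF Deriv.has_derivative_inverse[OF assms(3)[OF x] this(2)], of k]]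
    show ?thesis
    proof (rule has_derivative_eq_rhs[OF 1], rule ext)
      fix v
      show "h x * (of_nat k * - (inverse (f x) * frechet_derivative f (at x) v * inverse (f x)) *
          inverse (f x) ^ (k - 1)) + frechet_derivative h (at x) v * inverse (f x) ^ k
        = (frechet_derivative h (at x) v * f x - of_nat k * h x * frechet_derivative f (at x) v) *
          inverse (f x) ^ Suc k"
        using assms(3)[OF x] by (cases k) (simp_all add: field_simps)
    qed
  qed
  have "smooth_on \<Omega> (\<lambda>x. 1 * inverse (f x) ^ 1)"
  proof (rule smooth_on_coinduct[OF assms(1)])
    show "(\<lambda>x. 1 * inverse (f x) ^ 1) \<in> ?S"
      using smooth_on_const[of \<Omega> 1] by (intro CollectI exI[of _ "\<lambda>_. 1"] exI[of _ 1]) simp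
    show "g differentiable at x" if "g \<in> ?S" "x \<in> \<Omega>" for g x
      using that D differentiable_def by blast
    show "\<exists>h\<in>?S. \<forall>x\<in>\<Omega>. partial_deriv i g x = h x" if "g \<in> ?S" for g i
    proof -
      from that obtain h k where g: "g = (\<lambda>x. h x * inverse (f x) ^ k)" "smooth_on \<Omega> h" by blast
      let ?h = "\<lambda>x. 1 * (partial_deriv i h x * f x) + (- of_nat k) * (h x * partial_deriv i f x)"
      have "smooth_on \<Omega> ?h"
        using assms g by (intro smooth_on_linear smooth_on_mult smooth_on_partial_deriv) auto
      moreover have "partial_deriv i g x = ?h x * inverse (f x) ^ Suc k" if "x \<in> \<Omega>" for x
        unfolding g(1) partial_deriv_def frechet_derivative_at[OF D[OF g(2) that], symmetric]
        by (simp only: mult_1 mult_minus_left mult.assoc diff_conv_add_uminus)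
      moreover from calculation(1) have "(\<lambda>x. ?h x * inverse (f x) ^ Suc k) \<in> ?S"
        by (intro CollectI exI[of _ ?h] exI[of _ "Suc k"]) simp
      ultimately show ?thesis by (intro bexI[of _ "\<lambda>x. ?h x * inverse (f x) ^ Suc k"]) blast
    qed
  qed
  then show ?thesis by simp
qed

text \<open>The standard smooth transition from 0 on \<open>s \<le> 0\<close> to 1 on
  \<open>s \<ge> 1\<close>. The denominator never vanishes because \<open>s\<close> and
  \<open>1 - s\<close> are not both nonpositive.\<close>

definition step :: "real \<Rightarrow> real" where
  "step s = flat 1 s / (flat 1 s + flat 1 (1 - s))"

lemma flat_1_sum_pos: "flat 1 s + flat 1 (1 - s) > 0"
  by (cases "s > 0"; cases "s < 1") (auto simp: flat_def add_pos_pos)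

lemma step_eq_1: "s \<ge> 1 \<Longrightarrow> step s = 1"
  using flat_1_sum_pos[of s] by (auto simp: step_def flat_def)

lemma step_eq_0: "s \<le> 0 \<Longrightarrow> step s = 0"
  by (auto simp: step_def flat_def)

lemma smooth_on_step_function:
  "smooth_on UNIV (\<lambda>x::real^'n::finite. complex_of_real (step (a * x $ i + b)))"
proof -
  let ?f = "\<lambda>x::real^'n. complex_of_real (flat 1 (a * x $ i + b))"
    and ?g = "\<lambda>x::real^'n. complex_of_real (flat 1 ((- a) * x $ i + (1 - b)))"
  have "smooth_on UNIV (\<lambda>x. 1 * ?f x + 1 * ?g x)"
    by (rule smooth_on_linear[OF open_UNIV smooth_on_flat smooth_on_flat])
  moreover have "1 * ?f x + 1 * ?g x \<noteq> 0" for x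
  proof -
    have "1 * ?f x + 1 * ?g x = of_real (flat 1 (a * x $ i + b) + flat 1 (1 - (a * x $ i + b)))"
      by (simp add: algebra_simps)
    then show ?thesis using flat_1_sum_pos[of "a * x $ i + b"] by (simp del: of_real_add)
  qed
  ultimately have "smooth_on UNIV (\<lambda>x. inverse (1 * ?f x + 1 * ?g x))"
    by (intro smooth_on_inverse open_UNIV)
  then have "smooth_on UNIV (\<lambda>x. ?f x * inverse (1 * ?f x + 1 * ?g x))"
    by (rule smooth_on_mult[OF open_UNIV smooth_on_flat])
  moreover have "?f x * inverse (1 * ?f x + 1 * ?g x) = complex_of_real (step (a * x $ i + b))" for x
    by (simp add: step_def divide_inverse algebra_simps)
  ultimately show ?thesis by simp
qed

lemma smooth_on_prod:
  assumes "open \<Omega>" "finite A" "\<And>k. k \<in> A \<Longrightarrow> smooth_on \<Omega> (f k)"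
  shows "smooth_on \<Omega> (\<lambda>x. \<Prod>k\<in>A. f k x)"
  using assms(2,3) by (induction A) (auto intro!: smooth_on_const smooth_on_mult assms(1))

lemma ex_plateau:
  fixes a :: "real^'n::finite"
  assumes "R > 0"
  shows "\<exists>\<rho> r. r > 0 \<and> smooth_on UNIV \<rho> \<and> (\<forall>x\<in>ball a r. \<rho> x = 1) \<and> (\<forall>x. x \<notin> cball a R \<longrightarrow> \<rho> x = 0)"
proof -
  \<comment> \<open>A point farther than \<open>R\<close> from \<open>a\<close> has some coordinate
    off by at least \<open>2 * d\<close>, since otherwise the sum of the coordinate distances would
    be at most \<open>R\<close>.\<close>
  define d where "d = R / (2 * CARD('n))"
  have d: "d > 0" using assms by (simp add: d_def)
  \<comment> \<open>For each coordinate a rising and a falling transition: both are 1 while the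
    coordinate distance is at most \<open>d\<close>, and one of them is 0 once it reaches
    \<open>2 * d\<close>.\<close>
  define \<rho> where "\<rho> x = (\<Prod>i\<in>UNIV. complex_of_real (step (1 / d * x $ i + (2 - a $ i / d))) *
     complex_of_real (step ((- 1 / d) * x $ i + (2 + a $ i / d))))" for x :: "real^'n"
  have "smooth_on UNIV \<rho>"
    unfolding \<rho>_def[abs_def]
    by (intro smooth_on_prod open_UNIV finite smooth_on_mult smooth_on_step_function)
  moreover have "\<rho> x = 1" if "x \<in> ball a d" for x
    unfolding \<rho>_def
  proof (intro prod.neutral ballI)
    fix i
    have "\<bar>x $ i - a $ i\<bar> \<le> norm (x - a)"
      using component_le_norm_cart[of "x - a" i] by simp
    then have "\<bar>x $ i - a $ i\<bar> \<le> d" using that by (simp add: dist_norm norm_minus_commute)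
    then have "\<bar>(x $ i - a $ i) / d\<bar> \<le> 1" using d by simp
    then have "1 / d * x $ i + (2 - a $ i / d) \<ge> 1" "(- 1 / d) * x $ i + (2 + a $ i / d) \<ge> 1"
      unfolding abs_le_iff diff_divide_distrib by (simp_all add: algebra_simps)
    then show "complex_of_real (step (1 / d * x $ i + (2 - a $ i / d))) *
     complex_of_real (step ((- 1 / d) * x $ i + (2 + a $ i / d))) = 1"
      by (simp add: step_eq_1)
  qed
  moreover have "\<rho> x = 0" if "x \<notin> cball a R" for x
  proof -
    have "\<exists>i. 2 * d \<le> \<bar>x $ i - a $ i\<bar>"
    proof (rule ccontr)
      assume "\<nexists>i. 2 * d \<le> \<bar>x $ i - a $ i\<bar>"
      then have "(\<Sum>i\<in>UNIV. \<bar>(x - a) $ i\<bar>) \<le> (\<Sum>i\<in>(UNIV::'n set). 2 * d)"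
        by (intro sum_mono) (auto simp: not_le less_imp_le)
      also have "\<dots> = R" by (simp add: d_def)
      finally show False
        using norm_le_l1_cart[of "x - a"] that by (simp add: dist_norm norm_minus_commute)
    qed
    then obtain i where "2 * d \<le> x $ i - a $ i \<or> 2 * d \<le> a $ i - x $ i"
      by (auto simp: abs_if split: if_splits)
    then have "2 \<le> (x $ i - a $ i) / d \<or> 2 \<le> (a $ i - x $ i) / d"
      using d by (simp add: pos_le_divide_eq)
    then have "1 / d * x $ i + (2 - a $ i / d) \<le> 0 \<or> (- 1 / d) * x $ i + (2 + a $ i / d) \<le> 0"
      unfolding diff_divide_distrib by (auto simp: algebra_simps)
    then show ?thesis
      unfolding \<rho>_def by (intro prod_zero bexI[of _ i]) (auto simp: step_eq_0 simp del: divide_minus_left)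
  qed
  ultimately show ?thesis using d by blast
qed

lemma ex_smooth_cutoff:
  fixes S \<Omega> :: "(real^'n::finite) set"
  assumes "compact S" "open \<Omega>" "S \<subseteq> \<Omega>"
  obtains \<phi> W T where "smooth_on UNIV \<phi>" "open W" "S \<subseteq> W" "\<And>x. x \<in> W \<Longrightarrow> \<phi> x = 1"
    "compact T" "T \<subseteq> \<Omega>" "\<And>x. x \<notin> T \<Longrightarrow> \<phi> x = 0"
proof -
  have "\<exists>R>0. cball a R \<subseteq> \<Omega>" if "a \<in> S" for a
    using assms that open_contains_cball by blast
  then obtain R where R: "\<And>a. a \<in> S \<Longrightarrow> R a > 0 \<and> cball a (R a) \<subseteq> \<Omega>" by metis
  then have "\<exists>\<rho> r. r > 0 \<and> smooth_on UNIV \<rho> \<and> (\<forall>x\<in>ball a r. \<rho> x = 1) \<and> (\<forall>x. x \<notin> cball a (R a) \<longrightarrow> \<rho> x = 0)"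
    if "a \<in> S" for a using that ex_plateau by blast
  then obtain \<rho> r where \<rho>: "\<And>a. a \<in> S \<Longrightarrow> r a > 0 \<and> smooth_on UNIV (\<rho> a) \<and> (\<forall>x\<in>ball a (r a). \<rho> a x = 1)
      \<and> (\<forall>x. x \<notin> cball a (R a) \<longrightarrow> \<rho> a x = 0)"
    by metis
  obtain A where A: "A \<subseteq> S" "finite A" "S \<subseteq> (\<Union>a\<in>A. ball a (r a))"
  proof (rule compactE_image[OF assms(1), of S "\<lambda>a. ball a (r a)"])
    show "S \<subseteq> (\<Union>a\<in>S. ball a (r a))" using \<rho> by force
  qed auto
  \<comment> \<open>One minus the product of the complements is 1 as soon as one bump is 1, and 0
    where all bumps vanish. The explicit factors 1 and -1 match the shape of
    \<open>smooth_on_linear\<close>.\<close>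
  define \<phi> where "\<phi> x = 1 * 1 + (-1) * (\<Prod>a\<in>A. 1 * 1 + (-1) * \<rho> a x)" for x
  show thesis
  proof (rule that[of \<phi> "\<Union>a\<in>A. ball a (r a)" "\<Union>a\<in>A. cball a (R a)"])
    show "smooth_on UNIV \<phi>"
      unfolding \<phi>_def[abs_def]
      by (intro smooth_on_linear smooth_on_prod open_UNIV smooth_on_const A(2)) (use \<rho> A in auto)
    show "\<phi> x = 1" if "x \<in> (\<Union>a\<in>A. ball a (r a))" for x
    proof -
      from that obtain a where "a \<in> A" "\<rho> a x = 1" using \<rho> A(1) by blast
      then have "(\<Prod>a\<in>A. 1 * 1 + (-1) * \<rho> a x) = 0"
        using A(2) by (intro prod_zero) auto
      then show ?thesis by (simp add: \<phi>_def)
    qed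
    show "\<phi> x = 0" if "x \<notin> (\<Union>a\<in>A. cball a (R a))" for x
    proof -
      have "(\<Prod>a\<in>A. 1 * 1 + (-1) * \<rho> a x) = 1"
        using that \<rho> A by (intro prod.neutral) auto
      then show ?thesis by (simp add: \<phi>_def)
    qed
  qed (use A R in \<open>auto intro!: compact_UN\<close>)
qed

section \<open>Nets\<close>

lemma eventually_at_right_0_in_01: "\<forall>\<^sub>F e in at_right (0::real). 0 < e \<and> e < 1"
  using eventually_at_right_real[of 0 1] by simp

text \<open>A constant is absorbed by giving up any positive amount of the exponent. Thanks to this
  the estimates on nets below carry no constants.\<close>

lemma eventually_mult_powr_le:
  fixes C :: real
  assumes "b < a"
  shows "\<forall>\<^sub>F e in at_right 0. C * e powr a \<le> e powr b"
proof -
  have "\<forall>\<^sub>F e in at_right 0. (0::real) \<le> e"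
    using eventually_at_right_0_in_01 by eventually_elim auto
  then have "((\<lambda>e::real. e powr (a - b)) \<longlongrightarrow> 0 powr (a - b)) (at_right 0)"
    using assms by (intro tendsto_powr2 tendsto_ident_at tendsto_const) auto
  then have "((\<lambda>e::real. C * e powr (a - b)) \<longlongrightarrow> C * 0 powr (a - b)) (at_right 0)"
    by (rule tendsto_mult_left)
  then have "\<forall>\<^sub>F e in at_right 0. C * e powr (a - b) < 1"
    by (rule order_tendstoD) (use assms in simp)
  then show ?thesis
    using eventually_at_right_0_in_01
  proof eventually_elim
    case (elim e)
    then have "C * e powr (a - b) * e powr b \<le> 1 * e powr b"
      by (intro mult_right_mono) auto
    then show ?case by (simp add: mult.assoc flip: powr_add)
  qed
qed

abbreviation norm_le_powr :: "'a set \<Rightarrow> (real \<Rightarrow> 'a \<Rightarrow> 'b::real_normed_vector) \<Rightarrow> real \<Rightarrow> bool" where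
  "norm_le_powr X g r \<equiv> \<forall>\<^sub>F e in at_right 0. \<forall>x\<in>X. norm (g e x) \<le> e powr r"

text \<open>For \<epsilon> below 1 a larger \<open>p\<close> weakens the bound, so the sum of the
  absolute values of the exponents serves all members of a finite family.\<close>

lemma ex_uniform_powr_bound:
  fixes L :: "'k set"
  assumes L: "finite L"
    and g: "\<And>k. k \<in> L \<Longrightarrow> \<exists>p. norm_le_powr X (g k) (- p)"
  obtains p where "\<And>k. k \<in> L \<Longrightarrow> norm_le_powr X (g k) (- p)"
proof -
  have "\<forall>k\<in>L. \<exists>p. norm_le_powr X (g k) (- p)"
    using g by blast
  from bchoice[OF this] obtain p where
    p: "\<And>k. k \<in> L \<Longrightarrow> norm_le_powr X (g k) (- p k)" by blast
  show thesis
  proof (rule that)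
    fix k assume k: "k \<in> L"
    show "norm_le_powr X (g k) (- (\<Sum>k\<in>L. \<bar>p k\<bar>))"
      using p[OF k] eventually_at_right_0_in_01
    proof eventually_elim
      case (elim e)
      have "\<bar>p k\<bar> \<le> (\<Sum>k\<in>L. \<bar>p k\<bar>)" using k by (intro member_le_sum L) auto
      then have "e powr (- p k) \<le> e powr (- (\<Sum>k\<in>L. \<bar>p k\<bar>))" using elim by (intro powr_mono') auto
      with elim show ?case by (blast intro: order_trans)
    qed
  qed
qed

text \<open>The strict inequality of exponents pays for the constant hidden in the O-symbol.
  Boundedness is what makes the supremum dominate the individual values.\<close>

lemma bigo_SUP_imp_eventually_le:
  assumes "(\<lambda>e. SUP x\<in>K. norm (g e x)) \<in> O[at_right 0](\<lambda>e. e powr r)" "r' < r"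
    and "\<And>e. e \<in> {0<..1} \<Longrightarrow> bdd_above ((\<lambda>x. norm (g e x)) ` K)"
  shows "norm_le_powr K g r'"
proof -
  obtain C where "\<forall>\<^sub>F e in at_right 0. norm (SUP x\<in>K. norm (g e x)) \<le> C * norm (e powr r)"
    using assms(1) by (auto elim: landau_o.bigE)
  then show ?thesis
    using eventually_mult_powr_le[OF assms(2), of C] eventually_at_right_0_in_01
  proof eventually_elim
    case (elim e)
    show ?case
    proof
      fix x assume "x \<in> K"
      then have "norm (g e x) \<le> (SUP x\<in>K. norm (g e x))"
        using elim(3) by (intro cSUP_upper assms(3)) auto
      with elim show "norm (g e x) \<le> e powr r'" by simp
    qed
  qed
qed

lemma eventually_le_imp_bigo_SUP:
  assumes "norm_le_powr K g r" "K \<noteq> {}"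
  shows "(\<lambda>e. SUP x\<in>K. norm (g e x)) \<in> O[at_right 0](\<lambda>e. e powr r)"
proof (rule bigoI[where c = 1])
  show "\<forall>\<^sub>F e in at_right 0. norm (SUP x\<in>K. norm (g e x)) \<le> 1 * norm (e powr r)"
    using assms(1)
  proof eventually_elim
    case (elim e)
    have le: "(SUP x\<in>K. norm (g e x)) \<le> e powr r"
      using elim by (intro cSUP_least assms) auto
    obtain x where "x \<in> K" using assms by blast
    then have "norm (g e x) \<le> (SUP x\<in>K. norm (g e x))"
      using elim by (intro cSUP_upper bdd_aboveI2) auto
    then have "0 \<le> (SUP x\<in>K. norm (g e x))" by (rule order_trans[OF norm_ge_zero])
    with le show ?case by simp
  qed
qed

text \<open>Moderateness restated for derivatives taken in every order, as commuting partial
  derivatives allow, and without suprema, so that the empty compact set and exponents of either sign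
  are included.\<close>

lemma EM_iff:
  assumes "open \<Omega>"
  shows "u \<in> EM \<Omega> \<longleftrightarrow> smooth_net \<Omega> u \<and> (\<forall>K is. compact K \<and> K \<subseteq> \<Omega> \<longrightarrow>
    (\<exists>p. norm_le_powr K (\<lambda>e. partial_derivs is (u e)) (- p)))"
    (is "_ \<longleftrightarrow> _ \<and> ?R")
proof (intro iffI conjI allI impI; (elim conjE)?)
  assume u: "u \<in> EM \<Omega>"
  then show s: "smooth_net \<Omega> u" by (simp add: EM_def)
  fix K "is" assume K: "compact K" "K \<subseteq> \<Omega>"
  show "\<exists>p. norm_le_powr K (\<lambda>e. partial_derivs is (u e)) (- p)"
  proof (cases "K = {}")
    case False
    let ?\<alpha> = "count_list is"
    obtain p where "(\<lambda>e. SUP x\<in>K. norm (mi_deriv ?\<alpha> (u e) x)) \<in> O[at_right 0](\<lambda>e. e powr (- p))"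
      using u K False unfolding EM_def by blast
    then have "norm_le_powr K (\<lambda>e. mi_deriv ?\<alpha> (u e)) (- (p + 1))"
      by (rule bigo_SUP_imp_eventually_le)
        (use s K in \<open>auto simp: smooth_net_def intro!: bdd_above_mi_deriv\<close>)
    then have "norm_le_powr K (\<lambda>e. partial_derivs is (u e)) (- (p + 1))"
      using eventually_at_right_0_in_01
    proof eventually_elim
      case (elim e)
      then have "smooth_on \<Omega> (u e)" using s by (auto simp: smooth_net_def)
      then show ?case using elim K partial_derivs_eq_mi_deriv[OF assms] by (metis subsetD)
    qed
    then show ?thesis by blast
  qed auto
next
  assume s: "smooth_net \<Omega> u" and R: ?R
  have "\<exists>p\<ge>0. (\<lambda>e. SUP x\<in>K. norm (mi_deriv \<alpha> (u e) x)) \<in> O[at_right 0](\<lambda>e. e powr (- p))"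
    if K: "compact K" "K \<noteq> {}" "K \<subseteq> \<Omega>" for K \<alpha>
  proof -
    obtain "is" where "is": "mi_deriv \<alpha> = partial_derivs is"
      using mi_deriv_eq_partial_derivs by blast
    obtain p where p: "norm_le_powr K (\<lambda>e. mi_deriv \<alpha> (u e)) (- p)"
      using R K unfolding "is" by blast
    have "norm_le_powr K (\<lambda>e. mi_deriv \<alpha> (u e)) (- max p 0)"
      using p eventually_at_right_0_in_01
    proof eventually_elim
      case (elim e)
      then have "e powr (- p) \<le> e powr (- max p 0)" by (intro powr_mono') auto
      with elim show ?case by (blast intro: order_trans)
    qed
    from eventually_le_imp_bigo_SUP[OF this K(2)] show ?thesis by (intro exI[of _ "max p 0"]) simp
  qed
  with s show "u \<in> EM \<Omega>" by (simp add: EM_def)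
qed

lemma Null_iff:
  assumes "open \<Omega>"
  shows "u \<in> Null \<Omega> \<longleftrightarrow> smooth_net \<Omega> u \<and> (\<forall>K is q. compact K \<and> K \<subseteq> \<Omega> \<longrightarrow>
    (norm_le_powr K (\<lambda>e. partial_derivs is (u e)) q))"
    (is "_ \<longleftrightarrow> _ \<and> ?R")
proof (intro iffI conjI allI impI; (elim conjE)?)
  assume u: "u \<in> Null \<Omega>"
  then show s: "smooth_net \<Omega> u" by (simp add: Null_def)
  fix K "is" and q :: real assume K: "compact K" "K \<subseteq> \<Omega>"
  show "norm_le_powr K (\<lambda>e. partial_derivs is (u e)) q"
  proof (cases "K = {}")
    case False
    let ?\<alpha> = "count_list is"
    have "(\<lambda>e. SUP x\<in>K. norm (mi_deriv ?\<alpha> (u e) x)) \<in> O[at_right 0](\<lambda>e. e powr (\<bar>q\<bar> + 1))"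
      using u K False unfolding Null_def by auto
    then have "norm_le_powr K (\<lambda>e. mi_deriv ?\<alpha> (u e)) q"
      by (rule bigo_SUP_imp_eventually_le)
        (use s K in \<open>auto simp: smooth_net_def intro!: bdd_above_mi_deriv\<close>)
    then show ?thesis
      using eventually_at_right_0_in_01
    proof eventually_elim
      case (elim e)
      then have "smooth_on \<Omega> (u e)" using s by (auto simp: smooth_net_def)
      then show ?case using elim K partial_derivs_eq_mi_deriv[OF assms] by (metis subsetD)
    qed
  qed auto
next
  assume s: "smooth_net \<Omega> u" and R: ?R
  have "(\<lambda>e. SUP x\<in>K. norm (mi_deriv \<alpha> (u e) x)) \<in> O[at_right 0](\<lambda>e. e powr q)"
    if K: "compact K" "K \<noteq> {}" "K \<subseteq> \<Omega>" for K \<alpha> and q :: real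
  proof -
    obtain "is" where "is": "mi_deriv \<alpha> = partial_derivs is"
      using mi_deriv_eq_partial_derivs by blast
    show ?thesis
      by (rule eventually_le_imp_bigo_SUP[OF _ K(2)]) (use R K in \<open>simp add: "is"\<close>)
  qed
  with s show "u \<in> Null \<Omega>" by (simp add: Null_def)
qed

lemma smooth_net_subset: "smooth_net \<Omega> u \<Longrightarrow> W \<subseteq> \<Omega> \<Longrightarrow> smooth_net W u"
  unfolding smooth_net_def using smooth_on_subset by blast

lemma EM_subset:
  assumes "open \<Omega>" "open W" "W \<subseteq> \<Omega>"
  shows "EM \<Omega> \<subseteq> EM W"
proof
  fix u assume "u \<in> EM \<Omega>"
  with assms smooth_net_subset[of \<Omega> u W] show "u \<in> EM W" by (auto simp: EM_iff)
qed

text \<open>The locality half of the sheaf property: finitely many balls inside the given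
  neighbourhoods cover a compact set, and finitely many eventual statements hold jointly.\<close>

lemma Null_local:
  assumes \<Omega>: "open \<Omega>" and s: "smooth_net \<Omega> u"
    and loc: "\<And>x. x \<in> \<Omega> \<Longrightarrow> \<exists>W. open W \<and> x \<in> W \<and> u \<in> Null W"
  shows "u \<in> Null \<Omega>"
  unfolding Null_iff[OF \<Omega>]
proof (intro conjI s allI impI; elim conjE)
  fix K "is" and q :: real assume K: "compact K" "K \<subseteq> \<Omega>"
  have "\<exists>r>0. \<exists>W. open W \<and> u \<in> Null W \<and> cball x r \<subseteq> W" if "x \<in> K" for x
    using loc[of x] that K(2) open_contains_cball by (metis subsetD)
  then obtain r where r: "\<And>x. x \<in> K \<Longrightarrow> r x > 0 \<and> (\<exists>W. open W \<and> u \<in> Null W \<and> cball x (r x) \<subseteq> W)"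
    by metis
  obtain A where A: "A \<subseteq> K" "finite A" "K \<subseteq> (\<Union>a\<in>A. ball a (r a))"
  proof (rule compactE_image[OF K(1), of K "\<lambda>a. ball a (r a)"])
    show "K \<subseteq> (\<Union>a\<in>K. ball a (r a))" using r by force
  qed auto
  have "\<forall>\<^sub>F e in at_right 0. \<forall>a\<in>A. \<forall>x\<in>cball a (r a). norm (partial_derivs is (u e) x) \<le> e powr q"
  proof (rule eventually_ball_finite[OF A(2)], rule ballI)
    fix a assume "a \<in> A"
    with r A obtain W where W: "open W" "u \<in> Null W" "cball a (r a) \<subseteq> W" by blast
    then show "norm_le_powr (cball a (r a)) (\<lambda>e. partial_derivs is (u e)) q"
      using Null_iff[OF W(1), of u] compact_cball by blast
  qed
  then show "norm_le_powr K (\<lambda>e. partial_derivs is (u e)) q"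
    by eventually_elim (use A(3) in \<open>fastforce intro: less_imp_le\<close>)
qed

lemma bounded_partial_derivs_le:
  fixes g :: "real^'n::finite \<Rightarrow> complex"
  assumes "smooth_on \<Omega> g" "compact K" "K \<subseteq> \<Omega>"
  shows "\<exists>C>0. \<forall>js. length js \<le> n \<longrightarrow> (\<forall>x\<in>K. norm (partial_derivs js g x) \<le> C)"
proof -
  have fin: "finite {js :: 'n list. set js \<subseteq> UNIV \<and> length js \<le> n}"
    by (rule finite_lists_length_le) simp
  have "\<exists>C. \<forall>x\<in>K. norm (partial_derivs js g x) \<le> C" for js
  proof -
    have "continuous_on K (partial_derivs js g)"
      using smooth_on_continuous_on[OF smooth_on_partial_derivs[OF assms(1)]] assms(3)
      by (rule continuous_on_subset)
    then have "bounded (partial_derivs js g ` K)"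
      using assms(2) by (intro compact_imp_bounded compact_continuous_image)
    then show ?thesis by (auto simp: bounded_iff)
  qed
  then obtain C where C: "\<And>js x. x \<in> K \<Longrightarrow> norm (partial_derivs js g x) \<le> C js" by metis
  have "norm (partial_derivs js g x) \<le> (\<Sum>js | set js \<subseteq> UNIV \<and> length js \<le> n. \<bar>C js\<bar>) + 1"
    if "x \<in> K" "length js \<le> n" for js x
  proof -
    have "\<bar>C js\<bar> \<le> (\<Sum>js | set js \<subseteq> UNIV \<and> length js \<le> n. \<bar>C js\<bar>)"
      using that by (intro member_le_sum fin) auto
    then show ?thesis using C[OF that(1), of js] by linarith
  qed
  then show ?thesis
    by (intro exI[of _ "(\<Sum>js | set js \<subseteq> UNIV \<and> length js \<le> n. \<bar>C js\<bar>) + 1"])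
      (auto intro: add_nonneg_pos sum_nonneg)
qed

lemma smooth_net_mult:
  "open \<Omega> \<Longrightarrow> smooth_on \<Omega> g \<Longrightarrow> smooth_net \<Omega> u \<Longrightarrow> smooth_net \<Omega> (\<lambda>e x. g x * u e x)"
  unfolding smooth_net_def using smooth_on_mult by blast

lemma eventually_norm_mult_le:
  fixes g :: "real^'n::finite \<Rightarrow> complex"
  assumes "open \<Omega>" "smooth_on \<Omega> g" "smooth_net \<Omega> u" "compact K" "K \<subseteq> \<Omega>" "r' < r"
    and "\<And>js. length js \<le> length is \<Longrightarrow>
      norm_le_powr K (\<lambda>e. partial_derivs js (u e)) r"
  shows "norm_le_powr K (\<lambda>e. partial_derivs is (\<lambda>x. g x * u e x)) r'"
proof -
  obtain C where C: "C > 0" "\<And>js x. length js \<le> length is \<Longrightarrow> x \<in> K \<Longrightarrow> norm (partial_derivs js g x) \<le> C"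
    using bounded_partial_derivs_le[OF assms(2,4,5), of "length is"] by blast
  have "finite {js :: 'n list. set js \<subseteq> UNIV \<and> length js \<le> length is}"
    by (rule finite_lists_length_le) simp
  then have "\<forall>\<^sub>F e in at_right 0. \<forall>js\<in>{js. set js \<subseteq> UNIV \<and> length js \<le> length is}.
      \<forall>x\<in>K. norm (partial_derivs js (u e) x) \<le> e powr r"
    by (rule eventually_ball_finite) (use assms(7) in auto)
  then show ?thesis
    using eventually_mult_powr_le[OF assms(6), of "2 ^ length is * C"] eventually_at_right_0_in_01
  proof eventually_elim
    case (elim e)
    show ?case
    proof
      fix x assume x: "x \<in> K"
      have "norm (partial_derivs is (\<lambda>x. g x * u e x) x) \<le> 2 ^ length is * (C * e powr r)"
        using assms(2,3,5) elim x C
        by (intro norm_partial_derivs_mult_le[OF assms(1)]) (auto simp: smooth_net_def)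
      also have "\<dots> \<le> e powr r'" using elim(2) by (simp add: mult_ac)
      finally show "norm (partial_derivs is (\<lambda>x. g x * u e x) x) \<le> e powr r'" .
    qed
  qed
qed

lemma Null_mult:
  assumes "open \<Omega>" "smooth_on \<Omega> g" "u \<in> Null \<Omega>"
  shows "(\<lambda>e x. g x * u e x) \<in> Null \<Omega>"
  unfolding Null_iff[OF assms(1)]
proof (intro conjI allI impI; (elim conjE)?)
  have u: "smooth_net \<Omega> u" using assms Null_iff by blast
  then show "smooth_net \<Omega> (\<lambda>e x. g x * u e x)" by (rule smooth_net_mult[OF assms(1,2)])
  fix K "is" and q :: real assume K: "compact K" "K \<subseteq> \<Omega>"
  show "norm_le_powr K (\<lambda>e. partial_derivs is (\<lambda>x. g x * u e x)) q"
    by (rule eventually_norm_mult_le[OF assms(1,2) u K, of _ "q + 1"])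
      (use assms K in \<open>auto simp: Null_iff\<close>)
qed

lemma EM_mult:
  fixes g :: "real^'n::finite \<Rightarrow> complex"
  assumes "open \<Omega>" "smooth_on \<Omega> g" "u \<in> EM \<Omega>"
  shows "(\<lambda>e x. g x * u e x) \<in> EM \<Omega>"
  unfolding EM_iff[OF assms(1)]
proof (intro conjI allI impI; (elim conjE)?)
  have u: "smooth_net \<Omega> u" using assms EM_iff by blast
  then show "smooth_net \<Omega> (\<lambda>e x. g x * u e x)" by (rule smooth_net_mult[OF assms(1,2)])
  fix K and "is" :: "'n list" assume K: "compact K" "K \<subseteq> \<Omega>"
  have "finite {js :: 'n list. set js \<subseteq> UNIV \<and> length js \<le> length is}"
    by (rule finite_lists_length_le) simp
  then obtain p where "\<And>js. js \<in> {js. set js \<subseteq> UNIV \<and> length js \<le> length is} \<Longrightarrow>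
      norm_le_powr K (\<lambda>e. partial_derivs js (u e)) (- p)"
    by (rule ex_uniform_powr_bound[where X = K and g = "\<lambda>js e. partial_derivs js (u e)"])
      (use assms(3) K in \<open>auto simp: EM_iff[OF assms(1)]\<close>)
  then have "norm_le_powr K (\<lambda>e. partial_derivs is (\<lambda>x. g x * u e x)) (- (p + 1))"
    by (intro eventually_norm_mult_le[OF assms(1,2) u K, of _ "- p"]) auto
  then show "\<exists>p. norm_le_powr K (\<lambda>e. partial_derivs is (\<lambda>x. g x * u e x)) (- p)"
    by blast
qed

section \<open>Classes, supports and compactly supported representatives\<close>

lemma colombeau_relI:
  assumes "open \<Omega>" "u \<in> EM \<Omega>" "v \<in> EM \<Omega>" "(\<lambda>e x. u e x - v e x) \<in> Null \<Omega>"
  shows "gclass \<Omega> u = gclass \<Omega> v"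
  using assms equiv_class_eq[OF equiv_colombeau_rel[OF assms(1)], of u v]
  by (simp add: colombeau_rel_def gclass_def)

lemma gclass_self: "open \<Omega> \<Longrightarrow> u \<in> EM \<Omega> \<Longrightarrow> u \<in> gclass \<Omega> u"
  using Null_zero by (auto simp: gclass_def colombeau_rel_def)

lemma gclass_in_colombeau: "u \<in> EM \<Omega> \<Longrightarrow> gclass \<Omega> u \<in> colombeau \<Omega>"
  by (auto simp: colombeau_def gclass_def intro: quotientI)

lemma colombeau_cases:
  assumes "f \<in> colombeau \<Omega>"
  obtains u where "u \<in> EM \<Omega>" "f = gclass \<Omega> u"
  using assms by (auto simp: colombeau_def gclass_def elim: quotientE)

text \<open>Off the support there is a neighbourhood on which the restricted class is zero. The
  restriction is a union over representatives, and this union contains \<open>u\<close> itself,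
  which makes \<open>- u\<close> and hence \<open>u\<close> null there.\<close>

lemma Null_off_gsupp:
  assumes "open \<Omega>" "u \<in> EM \<Omega>" "x \<in> \<Omega>" "x \<notin> gsupp \<Omega> (gclass \<Omega> u)"
  shows "\<exists>W. open W \<and> x \<in> W \<and> W \<subseteq> \<Omega> \<and> u \<in> Null W"
proof -
  from assms obtain W where W: "open W" "W \<subseteq> \<Omega>" "x \<in> W"
    "grestrict W (gclass \<Omega> u) = gclass W (\<lambda>_ _. 0)"
    unfolding gsupp_def by blast
  have "u \<in> EM W" using EM_subset[OF assms(1) W(1,2)] assms(2) by blast
  then have "u \<in> gclass W u" by (rule gclass_self[OF W(1)])
  then have "u \<in> grestrict W (gclass \<Omega> u)"
    unfolding grestrict_def using gclass_self[OF assms(1,2)] by blast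
  then have "(\<lambda>e x. 0 - u e x) \<in> Null W"
    unfolding W(4) by (simp add: gclass_def colombeau_rel_def)
  from Null_uminus[OF W(1) this] have "u \<in> Null W" by simp
  with W show ?thesis by blast
qed

text \<open>A representative is multiplied by a cutoff that is 1 near the support. The product lives
  on the whole space with bounds uniform in \<open>x\<close>, as the Fourier transform requires. It
  differs from the original by a null net: near the support the difference vanishes, and elsewhere
  it is a smooth multiple of a locally null net.\<close>

lemma compactly_supported_representative:
  assumes \<Omega>: "open \<Omega>" and f: "f \<in> colombeau_c \<Omega>"
  obtains F T where "compact T" "\<And>e. e \<in> {0<..1} \<Longrightarrow> smooth_on UNIV (F e)"
    "\<And>e x. x \<notin> T \<Longrightarrow> F e x = 0"
    "\<And>is. \<exists>p. \<forall>\<^sub>F e in at_right 0. \<forall>x. norm (partial_derivs is (F e) x) \<le> e powr (- p)"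
    "F \<in> EM \<Omega>" "f = gclass \<Omega> F"
proof -
  obtain u where u: "u \<in> EM \<Omega>" "f = gclass \<Omega> u" and supp: "compact (gsupp \<Omega> f)"
    using f colombeau_cases unfolding colombeau_c_def by blast
  have su: "smooth_on \<Omega> (u e)" if "e \<in> {0<..1}" for e
    using u(1) that by (auto simp: EM_def smooth_net_def)
  have "gsupp \<Omega> f \<subseteq> \<Omega>" by (auto simp: gsupp_def)
  from ex_smooth_cutoff[OF supp \<Omega> this] obtain \<phi> W T where
    \<phi>: "smooth_on UNIV \<phi>" "open W" "gsupp \<Omega> f \<subseteq> W" "\<And>x. x \<in> W \<Longrightarrow> \<phi> x = 1"
    "compact T" "T \<subseteq> \<Omega>" "\<And>x. x \<notin> T \<Longrightarrow> \<phi> x = 0" by blast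
  define F where "F e x = \<phi> x * u e x" for e x
  have \<phi>': "smooth_on V \<phi>" for V using \<phi>(1) smooth_on_subset by blast
  have F: "F \<in> EM \<Omega>" unfolding F_def[abs_def] by (rule EM_mult[OF \<Omega> \<phi>' u(1)])
  have out: "open (- T)" using \<phi>(5) by (simp add: compact_imp_closed open_Compl)
  have F0: "F e x = 0" if "x \<notin> T" for e x using that \<phi>(7) by (simp add: F_def)
  \<comment> \<open>Smoothness on the whole space is glued from \<open>\<Omega>\<close> and the
    complement of \<open>T\<close>, which together cover it because
    \<open>T \<subseteq> \<Omega>\<close>.\<close>
  have smF: "smooth_on UNIV (F e)" if "e \<in> {0<..1}" for e
  proof -
    have "smooth_on \<Omega> (F e)" using F that by (auto simp: EM_def smooth_net_def)
    moreover have "smooth_on (- T) (F e)"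
      by (rule smooth_on_cong_open[OF out _ smooth_on_const[of _ 0]]) (use F0 in auto)
    ultimately show ?thesis using \<phi>(6) unfolding smooth_on_def by blast
  qed
  have bound: "\<exists>p. \<forall>\<^sub>F e in at_right 0. \<forall>x. norm (partial_derivs is (F e) x) \<le> e powr (- p)" for "is"
  proof -
    obtain p where "norm_le_powr T (\<lambda>e. partial_derivs is (F e)) (- p)"
      using F \<phi>(5,6) unfolding EM_iff[OF \<Omega>] by blast
    moreover have "partial_derivs is (F e) x = 0" if "x \<notin> T" for e x
      using partial_derivs_cong_open[OF out, of x "F e" "\<lambda>_. 0" "is"] that F0
      by (simp add: partial_derivs_const)
    ultimately have "\<forall>\<^sub>F e in at_right 0. \<forall>x. norm (partial_derivs is (F e) x) \<le> e powr (- p)"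
      by (elim eventually_mono) (metis norm_zero powr_ge_zero)
    then show ?thesis by blast
  qed
  have "(\<lambda>e x. F e x - u e x) \<in> Null \<Omega>"
  proof (rule Null_local[OF \<Omega>])
    show "smooth_net \<Omega> (\<lambda>e x. F e x - u e x)"
      using F u(1) by (intro smooth_net_diff[OF \<Omega>]) (auto simp: EM_def)
    fix x assume x: "x \<in> \<Omega>"
    show "\<exists>V. open V \<and> x \<in> V \<and> (\<lambda>e x. F e x - u e x) \<in> Null V"
    proof (cases "x \<in> W")
      case True
      have *: "partial_derivs is (\<lambda>x. F e x - u e x) y = 0" if "y \<in> W \<inter> \<Omega>" for "is" e y
        using partial_derivs_cong_open[of "W \<inter> \<Omega>" y "\<lambda>x. F e x - u e x" "\<lambda>_. 0" "is"] that \<phi> \<Omega>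
        by (simp add: F_def partial_derivs_const open_Int)
      have "smooth_net (W \<inter> \<Omega>) (\<lambda>e x. F e x - u e x)"
        unfolding smooth_net_def
      proof
        fix e :: real
        show "smooth_on (W \<inter> \<Omega>) (\<lambda>x. F e x - u e x)"
          by (rule smooth_on_cong_open[OF _ _ smooth_on_const[of _ 0]])
            (use \<phi> \<Omega> in \<open>auto simp: F_def\<close>)
      qed
      then have "(\<lambda>e x. F e x - u e x) \<in> Null (W \<inter> \<Omega>)"
        using \<phi>(2) \<Omega> * by (auto simp: Null_iff open_Int subset_iff)
      then show ?thesis using True x \<phi>(2) \<Omega> by (intro exI[of _ "W \<inter> \<Omega>"]) auto
    next
      case False
      then obtain V where V: "open V" "x \<in> V" "V \<subseteq> \<Omega>" "u \<in> Null V"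
        using Null_off_gsupp[OF \<Omega> u(1) x] u(2) \<phi>(3) by blast
      have "smooth_on V (\<lambda>x. 1 * \<phi> x + (-1) * 1)"
        by (intro smooth_on_linear V \<phi>' smooth_on_const)
      from Null_mult[OF V(1) this V(4)]
      have "(\<lambda>e x. F e x - u e x) \<in> Null V" by (simp add: F_def algebra_simps)
      with V show ?thesis by blast
    qed
  qed
  then have "gclass \<Omega> F = f" unfolding u(2) by (rule colombeau_relI[OF \<Omega> F u(1)])
  from that[OF \<phi>(5) smF F0 bound F this[symmetric]] show thesis .
qed

section \<open>Differential operators acting on nets\<close>

lemma moderate_imp_norm_le_powr:
  assumes "moderate c"
  shows "\<exists>p. \<forall>\<^sub>F e in at_right 0. norm (c e) \<le> e powr (- p)"
proof -
  obtain p where "c \<in> O[at_right 0](\<lambda>e. of_real (e powr (- p)))"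
    using assms unfolding moderate_def by blast
  then obtain C where "\<forall>\<^sub>F e in at_right 0. norm (c e) \<le> C * norm (of_real (e powr (- p)) :: complex)"
    by (auto elim: landau_o.bigE)
  then have "\<forall>\<^sub>F e in at_right 0. norm (c e) \<le> e powr (- (p + 1))"
    using eventually_mult_powr_le[of "- (p + 1)" "- p" C] by (auto elim: eventually_elim2)
  then show ?thesis by blast
qed

definition pdo :: "nat \<Rightarrow> (('n \<Rightarrow> nat) \<Rightarrow> complex) \<Rightarrow> (real^'n::finite \<Rightarrow> complex) \<Rightarrow> real^'n \<Rightarrow> complex" where
  "pdo m c v x = (\<Sum>\<alpha>\<in>mi_upto m. c \<alpha> * mi_D \<alpha> v x)"

text \<open>The list of directions that \<open>mi_deriv\<close> picks, named so that further
  derivatives can be put in front of it.\<close>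

definition mi_list :: "('n::finite \<Rightarrow> nat) \<Rightarrow> 'n list" where
  "mi_list \<alpha> = (SOME is. \<forall>i. count_list is i = \<alpha> i)"

lemma partial_derivs_sum:
  assumes "open \<Omega>" "finite A" "\<And>k. k \<in> A \<Longrightarrow> smooth_on \<Omega> (f k)"
  shows "smooth_on \<Omega> (\<lambda>x. \<Sum>k\<in>A. c k * f k x) \<and> (\<forall>x\<in>\<Omega>.
    partial_derivs is (\<lambda>x. \<Sum>k\<in>A. c k * f k x) x = (\<Sum>k\<in>A. c k * partial_derivs is (f k) x))"
  using assms(2,3)
proof (induction A)
  case (insert k A)
  have k: "smooth_on \<Omega> (f k)" and A: "smooth_on \<Omega> (\<lambda>x. \<Sum>k\<in>A. c k * f k x)"
    using insert by auto
  show ?case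
    using smooth_on_linear[OF assms(1) k A, of "c k" 1] partial_derivs_linear[OF assms(1) k A, of _ "is" "c k" 1]
      insert by simp
qed (simp add: smooth_on_const partial_derivs_const)

lemma partial_derivs_pdo:
  assumes "open \<Omega>" "smooth_on \<Omega> v"
  shows "smooth_on \<Omega> (pdo m c v)"
    and "x \<in> \<Omega> \<Longrightarrow> partial_derivs is (pdo m c v) x
      = (\<Sum>\<alpha>\<in>mi_upto m. c \<alpha> * (- \<i>) ^ mi_order \<alpha> * partial_derivs (is @ mi_list \<alpha>) v x)"
proof -
  have "pdo m c v = (\<lambda>x. \<Sum>\<alpha>\<in>mi_upto m. (c \<alpha> * (- \<i>) ^ mi_order \<alpha>) * partial_derivs (mi_list \<alpha>) v x)"
    by (simp add: fun_eq_iff pdo_def mi_D_def mi_deriv_def mi_list_def mult.assoc)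
  with partial_derivs_sum[OF assms(1) finite_mi_upto,
      of m "\<lambda>\<alpha>. partial_derivs (mi_list \<alpha>) v" "\<lambda>\<alpha>. c \<alpha> * (- \<i>) ^ mi_order \<alpha>",
      OF smooth_on_partial_derivs[OF assms(2)]]
  show "smooth_on \<Omega> (pdo m c v)"
    and "x \<in> \<Omega> \<Longrightarrow> partial_derivs is (pdo m c v) x
      = (\<Sum>\<alpha>\<in>mi_upto m. c \<alpha> * (- \<i>) ^ mi_order \<alpha> * partial_derivs (is @ mi_list \<alpha>) v x)"
    by (auto simp: partial_derivs_append)
qed

text \<open>The loss in the exponent is \<open>s\<close> for the coefficients and 1 for the number
  of terms, which does not depend on \<epsilon>.\<close>

lemma eventually_norm_pdo_le:
  fixes v :: "'n::finite net"
  assumes "open \<Omega>" "smooth_net \<Omega> v" "K \<subseteq> \<Omega>"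
    and c: "\<And>\<alpha>. \<alpha> \<in> mi_upto m \<Longrightarrow> \<forall>\<^sub>F e in at_right 0. norm (c \<alpha> e) \<le> e powr (- s)"
    and v: "\<And>\<alpha>. \<alpha> \<in> mi_upto m \<Longrightarrow> norm_le_powr K (\<lambda>e. partial_derivs (is @ mi_list \<alpha>) (v e)) r"
  shows "norm_le_powr K (\<lambda>e. partial_derivs is (pdo m (\<lambda>\<alpha>. c \<alpha> e) (v e))) (r - s - 1)"
proof -
  have "\<forall>\<^sub>F e in at_right 0. \<forall>\<alpha>\<in>mi_upto m. norm (c \<alpha> e) \<le> e powr (- s) \<and>
      (\<forall>x\<in>K. norm (partial_derivs (is @ mi_list \<alpha>) (v e) x) \<le> e powr r)"
    by (rule eventually_ball_finite[OF finite_mi_upto]) (intro ballI eventually_conj c v)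
  then show ?thesis
    using eventually_at_right_0_in_01
      eventually_mult_powr_le[of "r - s - 1" "r - s" "real (card (mi_upto m :: ('n \<Rightarrow> nat) set))", simplified]
  proof eventually_elim
    case (elim e)
    show ?case
    proof
      fix x assume x: "x \<in> K"
      have s: "smooth_on \<Omega> (v e)" using assms(2) elim by (auto simp: smooth_net_def)
      have "norm (partial_derivs is (pdo m (\<lambda>\<alpha>. c \<alpha> e) (v e)) x)
          \<le> (\<Sum>\<alpha>\<in>mi_upto m. norm (c \<alpha> e * (- \<i>) ^ mi_order \<alpha> * partial_derivs (is @ mi_list \<alpha>) (v e) x))"
        by (subst partial_derivs_pdo[OF assms(1) s]) (use x assms(3) in \<open>auto intro: norm_sum\<close>)
      also have "\<dots> \<le> (\<Sum>\<alpha>\<in>(mi_upto m :: ('n \<Rightarrow> nat) set). e powr (- s) * e powr r)"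
        using elim(1) x by (intro sum_mono) (auto simp: norm_mult norm_power intro!: mult_mono)
      also have "\<dots> = real (card (mi_upto m :: ('n \<Rightarrow> nat) set)) * e powr (r - s)"
        by (simp flip: powr_add)
      finally show "norm (partial_derivs is (pdo m (\<lambda>\<alpha>. c \<alpha> e) (v e)) x) \<le> e powr (r - s - 1)"
        using elim(3) by linarith
    qed
  qed
qed

lemma moderate_family_bound:
  assumes "finite A" and c: "\<And>k. k \<in> A \<Longrightarrow> moderate (c k)"
  obtains s where "\<And>k. k \<in> A \<Longrightarrow> \<forall>\<^sub>F e in at_right 0. norm (c k e) \<le> e powr (- s)"
  using ex_uniform_powr_bound[of A UNIV "\<lambda>k e _. c k e"] assms moderate_imp_norm_le_powr by auto

lemma smooth_net_pdo: "open \<Omega> \<Longrightarrow> smooth_net \<Omega> v \<Longrightarrow> smooth_net \<Omega> (\<lambda>e. pdo m (\<lambda>\<alpha>. c \<alpha> e) (v e))"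
  unfolding smooth_net_def using partial_derivs_pdo(1) by blast

lemma Null_pdo:
  assumes "open \<Omega>" "v \<in> Null \<Omega>" "\<And>\<alpha>. \<alpha> \<in> mi_upto m \<Longrightarrow> moderate (c \<alpha>)"
  shows "(\<lambda>e. pdo m (\<lambda>\<alpha>. c \<alpha> e) (v e)) \<in> Null \<Omega>"
  unfolding Null_iff[OF assms(1)]
proof (intro conjI allI impI; (elim conjE)?)
  have v: "smooth_net \<Omega> v" using assms(2) by (simp add: Null_def)
  then show "smooth_net \<Omega> (\<lambda>e. pdo m (\<lambda>\<alpha>. c \<alpha> e) (v e))" by (rule smooth_net_pdo[OF assms(1)])
  fix K "is" and q :: real assume K: "compact K" "K \<subseteq> \<Omega>"
  obtain s where s: "\<And>\<alpha>. \<alpha> \<in> mi_upto m \<Longrightarrow> \<forall>\<^sub>F e in at_right 0. norm (c \<alpha> e) \<le> e powr (- s)"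
    using moderate_family_bound[OF finite_mi_upto, of m c] assms(3) by blast
  show "norm_le_powr K (\<lambda>e. partial_derivs is (pdo m (\<lambda>\<alpha>. c \<alpha> e) (v e))) q"
    using eventually_norm_pdo_le[of \<Omega> v K m c s "is" "q + s + 1", OF assms(1) v K(2) s] assms(2) K
    unfolding Null_iff[OF assms(1)] by simp
qed

lemma EM_pdo:
  assumes "open \<Omega>" "v \<in> EM \<Omega>" "\<And>\<alpha>. \<alpha> \<in> mi_upto m \<Longrightarrow> moderate (c \<alpha>)"
  shows "(\<lambda>e. pdo m (\<lambda>\<alpha>. c \<alpha> e) (v e)) \<in> EM \<Omega>"
  unfolding EM_iff[OF assms(1)]
proof (intro conjI allI impI; (elim conjE)?)
  have v: "smooth_net \<Omega> v" using assms(2) by (simp add: EM_def)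
  then show "smooth_net \<Omega> (\<lambda>e. pdo m (\<lambda>\<alpha>. c \<alpha> e) (v e))" by (rule smooth_net_pdo[OF assms(1)])
  fix K "is" assume K: "compact K" "K \<subseteq> \<Omega>"
  obtain s where s: "\<And>\<alpha>. \<alpha> \<in> mi_upto m \<Longrightarrow> \<forall>\<^sub>F e in at_right 0. norm (c \<alpha> e) \<le> e powr (- s)"
    using moderate_family_bound[OF finite_mi_upto, of m c] assms(3) by blast
  obtain p where "\<And>\<alpha>. \<alpha> \<in> mi_upto m \<Longrightarrow>
      norm_le_powr K (\<lambda>e. partial_derivs (is @ mi_list \<alpha>) (v e)) (- p)"
    by (rule ex_uniform_powr_bound[OF finite_mi_upto,
          where X = K and g = "\<lambda>\<alpha> e. partial_derivs (is @ mi_list \<alpha>) (v e)"])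
      (use assms(2) K in \<open>auto simp: EM_iff[OF assms(1)]\<close>)
  note * = eventually_norm_pdo_le[of \<Omega> v K m c s "is" "- p", OF assms(1) v K(2) s this]
  have "- p - s - 1 = - (p + s + 1)" by simp
  from *[unfolded this] show "\<exists>p. norm_le_powr K (\<lambda>e. partial_derivs is (pdo m (\<lambda>\<alpha>. c \<alpha> e) (v e))) (- p)" by blast
qed

lemma Null_cong:
  assumes "open \<Omega>" "u \<in> Null \<Omega>" "\<And>e x. e \<in> {0<..1} \<Longrightarrow> x \<in> \<Omega> \<Longrightarrow> u e x = v e x"
  shows "v \<in> Null \<Omega>"
  unfolding Null_iff[OF assms(1)]
proof (intro conjI allI impI; (elim conjE)?)
  show "smooth_net \<Omega> v"
    unfolding smooth_net_def
  proof
    fix e :: real assume "e \<in> {0<..1}"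
    then show "smooth_on \<Omega> (v e)"
      using assms(2) by (intro smooth_on_cong_open[OF assms(1,3)]) (auto simp: Null_def smooth_net_def)
  qed
  fix K "is" and q :: real assume K: "compact K" "K \<subseteq> \<Omega>"
  then have "norm_le_powr K (\<lambda>e. partial_derivs is (u e)) q"
    using assms(2) unfolding Null_iff[OF assms(1)] by blast
  then show "norm_le_powr K (\<lambda>e. partial_derivs is (v e)) q"
    using eventually_at_right_0_in_01
  proof eventually_elim
    case (elim e)
    then have "partial_derivs is (v e) x = partial_derivs is (u e) x" if "x \<in> K" for x
      using partial_derivs_cong_open[OF assms(1), of x "u e" "v e"] assms(3) that K(2) by auto
    with elim show ?case by simp
  qed
qed

lemma moderate_rep: "moderate (rep_gcomplex a)"
  using gc_rel_rep[of a] by (simp add: gc_rel_def)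

text \<open>\<open>gPD\<close> is a union over all representatives of the class. The operator sends
  null nets to null nets, so every representative contributes the same class and one of them
  suffices to compute it.\<close>

lemma gPD_gclass:
  assumes \<Omega>: "open \<Omega>" and u: "u \<in> EM \<Omega>"
  shows "gPD \<Omega> m a (gclass \<Omega> u) = gclass \<Omega> (\<lambda>e. pdo m (\<lambda>\<alpha>. rep_gcomplex (a \<alpha>) e) (u e))"
proof -
  let ?P = "\<lambda>v e. pdo m (\<lambda>\<alpha>. rep_gcomplex (a \<alpha>) e) (v e)"
  have "gclass \<Omega> (?P v) = gclass \<Omega> (?P u)" if "v \<in> gclass \<Omega> u" for v
  proof (rule colombeau_relI[OF \<Omega>])
    have v: "v \<in> EM \<Omega>" "(\<lambda>e x. u e x - v e x) \<in> Null \<Omega>"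
      using that by (auto simp: gclass_def colombeau_rel_def)
    show "?P v \<in> EM \<Omega>" "?P u \<in> EM \<Omega>" using v u by (auto intro!: EM_pdo[OF \<Omega>] moderate_rep)
    have "(\<lambda>e x. v e x - u e x) \<in> Null \<Omega>" using Null_uminus[OF \<Omega> v(2)] by simp
    then have "?P (\<lambda>e x. v e x - u e x) \<in> Null \<Omega>" by (rule Null_pdo[OF \<Omega>]) (rule moderate_rep)
    then show "(\<lambda>e x. ?P v e x - ?P u e x) \<in> Null \<Omega>"
    proof (rule Null_cong[OF \<Omega>])
      fix e :: real and x assume e: "e \<in> {0<..1}" and x: "x \<in> \<Omega>"
      then have "smooth_on \<Omega> (v e)" "smooth_on \<Omega> (u e)"
        using u v by (auto simp: EM_def smooth_net_def)
      from mi_deriv_linear[OF \<Omega> this x, where c = 1 and d = "-1"]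
      show "?P (\<lambda>e x. v e x - u e x) e x = ?P v e x - ?P u e x"
        by (simp add: pdo_def mi_D_def right_diff_distrib sum_subtractf)
    qed
  qed
  then have "(\<Union>v\<in>gclass \<Omega> u. gclass \<Omega> (?P v)) = gclass \<Omega> (?P u)"
    using gclass_self[OF \<Omega> u] by blast
  then show ?thesis unfolding gPD_def pdo_def[abs_def] .
qed

section \<open>The Fourier transform\<close>

lemma frechet_derivative_eq_sum_partial:
  fixes f :: "real^'n::finite \<Rightarrow> complex"
  assumes "f differentiable (at x)"
  shows "frechet_derivative f (at x) v = (\<Sum>i\<in>UNIV. (v $ i) *\<^sub>R partial_deriv i f x)"
proof -
  have l: "linear (frechet_derivative f (at x))" by (rule linear_frechet_derivative[OF assms])
  have "frechet_derivative f (at x) v = frechet_derivative f (at x) (\<Sum>i\<in>UNIV. (v $ i) *\<^sub>R axis i 1)"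
    by (simp add: basis_expansion flip: scalar_mult_eq_scaleR)
  also have "\<dots> = (\<Sum>i\<in>UNIV. (v $ i) *\<^sub>R partial_deriv i f x)"
    by (simp add: linear_sum[OF l] linear_scale[OF l] partial_deriv_def)
  finally show ?thesis .
qed

text \<open>The mean value inequality along a segment. The distance is measured by the sum of the
  coordinate distances, since the moments of a product kernel are computed coordinate by
  coordinate.\<close>

lemma norm_diff_le_sum_partial:
  fixes f :: "real^'n::finite \<Rightarrow> complex"
  assumes d: "\<And>x. f differentiable (at x)" and B: "\<And>i x. norm (partial_deriv i f x) \<le> B"
  shows "norm (f y - f x) \<le> B * (\<Sum>i\<in>UNIV. \<bar>(y - x) $ i\<bar>)"
proof -
  let ?g = "\<lambda>t. f (x + t *\<^sub>R (y - x))"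
  have D: "(?g has_derivative (\<lambda>h. frechet_derivative f (at (x + t *\<^sub>R (y - x))) (h *\<^sub>R (y - x)))) (at t)" for t
  proof -
    have "((\<lambda>t. x + t *\<^sub>R (y - x)) has_derivative (\<lambda>h. h *\<^sub>R (y - x))) (at t)"
      by (auto intro!: derivative_eq_intros)
    moreover have "(f has_derivative frechet_derivative f (at (x + t *\<^sub>R (y - x)))) (at (x + t *\<^sub>R (y - x)))"
      using d by (simp add: frechet_derivative_works[symmetric])
    ultimately show ?thesis by (rule has_derivative_compose)
  qed
  have "\<exists>t\<in>{0<..<1}. norm (?g 1 - ?g 0) \<le> norm (frechet_derivative f (at (x + t *\<^sub>R (y - x))) ((1 - 0) *\<^sub>R (y - x)))"
    by (rule mvt_general[OF _ _ D]) (auto intro!: has_derivative_continuous_on has_derivative_at_withinI[OF D])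
  then obtain t where "norm (?g 1 - ?g 0) \<le> norm (frechet_derivative f (at (x + t *\<^sub>R (y - x))) (y - x))"
    by auto
  also have "\<dots> = norm (\<Sum>i\<in>UNIV. ((y - x) $ i) *\<^sub>R partial_deriv i f (x + t *\<^sub>R (y - x)))"
    by (simp add: frechet_derivative_eq_sum_partial[OF d])
  also have "\<dots> \<le> (\<Sum>i\<in>UNIV. \<bar>(y - x) $ i\<bar> * B)"
    by (rule sum_norm_le) (use B in \<open>auto intro!: mult_left_mono\<close>)
  also have "\<dots> = B * (\<Sum>i\<in>UNIV. \<bar>(y - x) $ i\<bar>)" by (simp add: sum_distrib_left mult_ac)
  finally show ?thesis by simp
qed

section \<open>Integrals of continuous functions with compact support\<close>

lemma integrable_compact_support:
  fixes H :: "real^'n::finite \<Rightarrow> complex"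
  assumes "continuous_on UNIV H" "\<And>x. x \<notin> cball 0 R \<Longrightarrow> H x = 0"
  shows "integrable lborel H"
proof -
  have "integrable lborel (\<lambda>x. indicator (cball 0 R) x *\<^sub>R H x)"
    using assms(1) by (intro borel_integrable_compact) (auto intro: continuous_on_subset)
  also have "(\<lambda>x. indicator (cball 0 R) x *\<^sub>R H x) = H"
    using assms(2) by (auto simp: fun_eq_iff indicator_def)
  finally show ?thesis .
qed

lemma norm_integral_compact_support_le:
  fixes H :: "real^'n::finite \<Rightarrow> complex"
  assumes "continuous_on UNIV H" "\<And>x. x \<notin> cball 0 R \<Longrightarrow> H x = 0" "\<And>x. norm (H x) \<le> B"
  shows "norm (\<integral>x. H x \<partial>lborel) \<le> B * measure lborel (cball (0 :: real^'n) R)"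
proof -
  have "norm (\<integral>x. H x \<partial>lborel) \<le> (\<integral>x. norm (H x) \<partial>lborel)"
    by (rule integral_norm_bound)
  also have "\<dots> \<le> (\<integral>x. B * indicator (cball (0 :: real^'n) R) x \<partial>lborel)"
    using integrable_compact_support[OF assms(1,2)] emeasure_lborel_cball_finite assms(2,3)
    by (intro integral_mono integrable_norm integrable_mult_right integrable_real_indicator)
      (auto simp: indicator_def)
  finally show ?thesis by simp
qed

lemma integral_lborel_shift:
  fixes f :: "real^'n::finite \<Rightarrow> complex"
  assumes "continuous_on UNIV f"
  shows "(\<integral>x. f (x + c) \<partial>lborel) = (\<integral>x. f x \<partial>lborel)"
proof -
  have "(\<integral>x. f x \<partial>lborel) = (\<integral>x. f x \<partial>distr lborel borel ((+) c))" by (simp add: lborel_distr_plus)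
  also have "\<dots> = (\<integral>x. f (c + x) \<partial>lborel)"
    using assms by (intro integral_distr) (auto intro: borel_measurable_continuous_onI)
  finally show ?thesis by (simp add: add.commute)
qed

lemma integral_lborel_reflect:
  fixes f :: "real^'n::finite \<Rightarrow> complex"
  assumes [measurable]: "f \<in> borel_measurable borel"
  shows "(\<integral>z. f (x - z) \<partial>lborel) = (\<integral>y. f y \<partial>lborel)"
proof -
  have "distr lborel borel (\<lambda>z. x - z) = (lborel :: (real^'n) measure)"
    using lborel_affine[of "-1" x] by (simp add: density_1)
  then have "(\<integral>y. f y \<partial>lborel) = (\<integral>y. f y \<partial>distr lborel borel (\<lambda>z. x - z))" by simp
  also have "\<dots> = (\<integral>z. f (x - z) \<partial>lborel)" by (intro integral_distr) auto
  finally show ?thesis by simp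
qed

lemma smooth_on_UNIV_D:
  assumes "smooth_on UNIV f"
  shows "f differentiable (at x)" "continuous_on UNIV f" "smooth_on UNIV (partial_deriv i f)"
  using assms smooth_on_differentiable smooth_on_continuous_on smooth_on_partial_deriv by auto

lemma partial_derivs_zero_outside:
  assumes "\<And>x. x \<notin> cball 0 R \<Longrightarrow> f x = 0" "x \<notin> cball 0 R"
  shows "partial_derivs is f x = 0"
proof -
  have "open (- cball 0 R :: (real^'a) set)" by (simp add: open_Compl)
  from partial_derivs_cong_open[OF this, of x f "\<lambda>_. 0" "is"] assms show ?thesis
    by (simp add: partial_derivs_const)
qed

text \<open>Every difference quotient has integral 0 by translation invariance of Lebesgue measure,
  and dominated convergence passes to the limit.\<close>

lemma integral_partial_deriv_eq_0:
  fixes G :: "real^'n::finite \<Rightarrow> complex"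
  assumes sm: "smooth_on UNIV G" and z: "\<And>x. x \<notin> cball 0 R \<Longrightarrow> G x = 0"
  shows "(\<integral>x. partial_deriv i G x \<partial>lborel) = 0"
proof -
  note G = smooth_on_UNIV_D[OF sm]
  have z': "partial_deriv j G x = 0" if "x \<notin> cball 0 R" for x j
    using partial_derivs_zero_outside[of R G x "[j]", OF z that] by simp
  have "\<exists>B. \<forall>x. norm (partial_deriv j G x) \<le> B" for j
  proof -
    have "bounded (partial_deriv j G ` cball 0 R)"
      using smooth_on_UNIV_D(2)[OF G(3)]
      by (intro compact_imp_bounded compact_continuous_image) (auto intro: continuous_on_subset)
    then obtain B where "\<forall>x\<in>cball 0 R. norm (partial_deriv j G x) \<le> B" by (auto simp: bounded_iff)
    then have "norm (partial_deriv j G x) \<le> max B 0" for x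
      using z'[of x j] by (cases "x \<in> cball 0 R") force+
    then show ?thesis by blast
  qed
  then obtain b where b: "\<And>j x. norm (partial_deriv j G x) \<le> b j" by metis
  define B where "B = (\<Sum>j\<in>UNIV. \<bar>b j\<bar>)"
  have B: "norm (partial_deriv j G x) \<le> B" for j x
  proof -
    have "\<bar>b j\<bar> \<le> B" unfolding B_def by (intro member_le_sum) auto
    then show ?thesis using b[of j x] by linarith
  qed
  \<comment> \<open>Increments of at most 1 keep all difference quotients supported in the ball of
    radius \<open>R + 1\<close>, on which the dominating function is constant.\<close>
  define h where "h n = 1 / real (Suc n)" for n
  have h: "h n > 0" "h n \<le> 1" for n by (auto simp: h_def)
  define D where "D n x = (1 / h n) *\<^sub>R (G (x + h n *\<^sub>R axis i 1) - G x)" for n x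
  have int: "integrable lborel G" by (rule integrable_compact_support[OF G(2) z])
  have z1: "G (x + c) = 0" if "x \<notin> cball 0 (R + norm c)" for x c
    using that norm_triangle_ineq4[of "x + c" c] by (intro z) auto
  have c1: "continuous_on UNIV (\<lambda>x. G (x + c))" for c
    by (rule continuous_on_compose2[OF G(2)]) (auto intro!: continuous_intros)
  have int1: "integrable lborel (\<lambda>x. G (x + c))" for c
    by (rule integrable_compact_support[OF c1 z1])
  have D0: "(\<integral>x. D n x \<partial>lborel) = 0" for n
    unfolding D_def by (simp add: Bochner_Integration.integral_diff[OF int1 int] integral_lborel_shift[OF G(2)])
  have "(\<lambda>n. \<integral>x. D n x \<partial>lborel) \<longlonglongrightarrow> (\<integral>x. partial_deriv i G x \<partial>lborel)"
  proof (rule integral_dominated_convergence[where w = "\<lambda>x. B * indicator (cball 0 (R + 1)) x"])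
    show "partial_deriv i G \<in> borel_measurable lborel"
      using smooth_on_UNIV_D(2)[OF G(3)] by (auto intro: borel_measurable_continuous_onI)
    show "D n \<in> borel_measurable lborel" for n
      unfolding D_def[abs_def] by (intro borel_measurable_integrable integrable_scaleR_right
        Bochner_Integration.integrable_diff int int1)
    show "integrable lborel (\<lambda>x. B * indicator (cball (0::real^'n) (R + 1)) x)"
      using emeasure_lborel_cball_finite by (intro integrable_mult_right integrable_real_indicator) auto
    show "AE x in lborel. (\<lambda>n. D n x) \<longlonglongrightarrow> partial_deriv i G x"
    proof (rule AE_I2)
      fix x
      have "((\<lambda>t. G (x + t *\<^sub>R axis i 1)) has_vector_derivative partial_deriv i G x) (at 0)"
        using has_vector_derivative_partial_deriv[of G x 0 i] G(1) by simp
      then have lim: "((\<lambda>t. norm (G (x + t *\<^sub>R axis i 1) - G x - t *\<^sub>R partial_deriv i G x) / norm t) \<longlongrightarrow> 0) (at 0)"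
        by (simp add: has_vector_derivative_def has_derivative_at)
      have h0: "filterlim h (at 0) sequentially"
        unfolding filterlim_at h_def[abs_def] using lim_1_over_n[where 'a = real, THEN LIMSEQ_Suc] by simp
      have eq: "norm (G (x + h n *\<^sub>R axis i 1) - G x - h n *\<^sub>R partial_deriv i G x) / norm (h n)
          = norm (D n x - partial_deriv i G x)" for n
      proof -
        have "D n x - partial_deriv i G x
            = (1 / h n) *\<^sub>R (G (x + h n *\<^sub>R axis i 1) - G x - h n *\<^sub>R partial_deriv i G x)"
          using h(1)[of n] by (simp add: D_def scaleR_diff_right)
        then show ?thesis using h(1)[of n] by simp
      qed
      from filterlim_compose[OF lim h0]
      have "(\<lambda>n. norm (D n x - partial_deriv i G x)) \<longlonglongrightarrow> 0" by (simp only: eq)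
      then show "(\<lambda>n. D n x) \<longlonglongrightarrow> partial_deriv i G x"
        by (simp add: tendsto_norm_zero_iff LIM_zero_iff)
    qed
    show "AE x in lborel. norm (D n x) \<le> B * indicator (cball 0 (R + 1)) x" for n
    proof (rule AE_I2)
      fix x
      show "norm (D n x) \<le> B * indicator (cball 0 (R + 1)) x"
      proof (cases "x \<in> cball 0 (R + 1)")
        case True
        have "norm (G (x + h n *\<^sub>R axis i 1) - G x) \<le> B * (\<Sum>j\<in>UNIV. \<bar>(x + h n *\<^sub>R axis i 1 - x) $ j\<bar>)"
          by (rule norm_diff_le_sum_partial[OF G(1) B])
        also have "(\<Sum>j\<in>UNIV. \<bar>(x + h n *\<^sub>R axis i 1 - x) $ j\<bar>) = (\<Sum>j\<in>UNIV. if j = i then h n else 0)"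
          using h(1)[of n] by (intro sum.cong) (auto simp: axis_def)
        finally have "norm (D n x) \<le> B"
          unfolding D_def norm_scaleR using h(1)[of n] by (simp add: pos_divide_le_eq)
        then show ?thesis using True by simp
      next
        case False
        then have "G (x + h n *\<^sub>R axis i 1) = 0" "G x = 0"
          using h[of n] z1[of x "h n *\<^sub>R axis i 1"] z[of x] by (auto simp: norm_axis_1)
        then show ?thesis using False by (simp add: D_def)
      qed
    qed
  qed
  then show ?thesis unfolding D0 by (simp add: LIMSEQ_const_iff)
qed

text \<open>There is no normalizing factor: the powers of \<open>2 * pi\<close> enter through
  \<open>box_coeff\<close>.\<close>

definition ft :: "(real^'n::finite \<Rightarrow> complex) \<Rightarrow> real^'n \<Rightarrow> complex" where
  "ft H \<xi> = (\<integral>y. H y * cis (- (\<xi> \<bullet> y)) \<partial>lborel)"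

lemma continuous_on_cis [continuous_intros]:
  "continuous_on S f \<Longrightarrow> continuous_on S (\<lambda>y. cis (f y))"
  unfolding cis_conv_exp by (intro continuous_intros)

lemma norm_ft_le:
  fixes H :: "real^'n::finite \<Rightarrow> complex"
  assumes "smooth_on UNIV H" "\<And>x. x \<notin> cball 0 R \<Longrightarrow> H x = 0" "\<And>x. norm (H x) \<le> B"
  shows "norm (ft H \<xi>) \<le> B * measure lborel (cball (0 :: real^'n) R)"
  unfolding ft_def using assms
  by (intro norm_integral_compact_support_le continuous_intros smooth_on_continuous_on)
    (auto simp: norm_mult)

lemma ft_partial_deriv:
  fixes H :: "real^'n::finite \<Rightarrow> complex"
  assumes sm: "smooth_on UNIV H" and z: "\<And>x. x \<notin> cball 0 R \<Longrightarrow> H x = 0"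
  shows "ft (partial_deriv i H) \<xi> = \<i> * of_real (\<xi> $ i) * ft H \<xi>"
proof -
  \<comment> \<open>The exponential is written as a sum with one term, so that its smoothness and
    its derivative are already known. Integrating the derivative of the product then amounts to
    integration by parts.\<close>
  let ?e = "trig_sum {()} (\<lambda>_. 1) (\<lambda>_. - \<xi>)"
  have e: "?e y = cis (- (\<xi> \<bullet> y))" for y by (simp add: trig_sum_def)
  have e': "partial_deriv i ?e y = - (\<i> * of_real (\<xi> $ i)) * cis (- (\<xi> \<bullet> y))" for y
    by (simp add: partial_deriv_trig_sum) (simp add: trig_sum_def)
  have "(\<integral>y. partial_deriv i (\<lambda>y. H y * ?e y) y \<partial>lborel) = 0"
    by (rule integral_partial_deriv_eq_0[where R = R])
      (simp_all add: smooth_on_mult sm smooth_on_trig_sum z)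
  also have "(\<lambda>y. partial_deriv i (\<lambda>y. H y * ?e y) y)
      = (\<lambda>y. partial_deriv i H y * cis (- (\<xi> \<bullet> y)) - \<i> * of_real (\<xi> $ i) * (H y * cis (- (\<xi> \<bullet> y))))"
    unfolding fun_eq_iff partial_deriv_mult[OF smooth_on_UNIV_D(1)[OF sm] smooth_on_UNIV_D(1)[OF smooth_on_trig_sum]]
    by (simp add: e e' algebra_simps)
  also have "(\<integral>y. \<dots> y \<partial>lborel) = ft (partial_deriv i H) \<xi> - \<i> * of_real (\<xi> $ i) * ft H \<xi>"
  proof -
    have "integrable lborel (\<lambda>y. H y * cis (- (\<xi> \<bullet> y)))"
      by (rule integrable_compact_support[where R = R])
        (auto intro!: continuous_intros smooth_on_UNIV_D(2)[OF sm] simp: z)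
    moreover have "integrable lborel (\<lambda>y. partial_deriv i H y * cis (- (\<xi> \<bullet> y)))"
      by (rule integrable_compact_support[where R = R])
        (use partial_derivs_zero_outside[of R H _ "[i]", OF z] in
          \<open>auto intro!: continuous_intros smooth_on_UNIV_D(2)[OF smooth_on_UNIV_D(3)[OF sm]]\<close>)
    ultimately show ?thesis unfolding ft_def by simp
  qed
  finally show ?thesis by simp
qed

lemma ft_partial_derivs:
  fixes H :: "real^'n::finite \<Rightarrow> complex"
  assumes "smooth_on UNIV H" "\<And>x. x \<notin> cball 0 R \<Longrightarrow> H x = 0"
  shows "ft (partial_derivs is H) \<xi> = (\<Prod>i\<leftarrow>is. \<i> * of_real (\<xi> $ i)) * ft H \<xi>"
proof (induction "is")
  case (Cons i "is")
  have "ft (partial_deriv i (partial_derivs is H)) \<xi> = \<i> * of_real (\<xi> $ i) * ft (partial_derivs is H) \<xi>"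
    by (rule ft_partial_deriv[where R = R])
      (auto intro!: smooth_on_partial_derivs assms(1) partial_derivs_zero_outside[of R H] simp: assms(2))
  then show ?case by (simp add: Cons.IH mult.assoc)
qed simp

lemma norm_ft_mult_mi_power_le:
  fixes H :: "real^'n::finite \<Rightarrow> complex"
  assumes "smooth_on UNIV H" "\<And>x. x \<notin> cball 0 R \<Longrightarrow> H x = 0" "\<And>x. norm (partial_derivs (mi_list \<alpha>) H x) \<le> B"
  shows "norm (mi_power \<xi> \<alpha>) * norm (ft H \<xi>) \<le> B * measure lborel (cball (0 :: real^'n) R)"
proof -
  have "count_list (mi_list \<alpha>) i = \<alpha> i" for i
    unfolding mi_list_def using someI_ex[OF ex_mi_list[of \<alpha>]] by blast
  from prod_list_eq_mi_power[OF this, of \<xi>]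
  have "norm (ft (partial_derivs (mi_list \<alpha>) H) \<xi>) = norm (mi_power \<xi> \<alpha>) * norm (ft H \<xi>)"
    unfolding ft_partial_derivs[of H R "mi_list \<alpha>" \<xi>, OF assms(1,2), simplified] by (simp add: norm_mult norm_power)
  moreover have "norm (ft (partial_derivs (mi_list \<alpha>) H) \<xi>) \<le> B * measure lborel (cball (0 :: real^'n) R)"
    by (intro norm_ft_le smooth_on_partial_derivs assms partial_derivs_zero_outside[of R H])
  ultimately show ?thesis by simp
qed

text \<open>Up to a constant the product is bounded by that of the \<open>1 + |\<xi>_i|^s\<close>,
  which expands into one monomial for each set \<open>S\<close> of coordinates. The derivative of
  order \<open>s\<close> in each direction of \<open>S\<close> controls that monomial times the
  transform, and there are \<open>2 ^ CARD('n)\<close> sets.\<close>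

lemma ft_decay:
  fixes H :: "real^'n::finite \<Rightarrow> complex"
  assumes "smooth_on UNIV H" "\<And>x. x \<notin> cball 0 R \<Longrightarrow> H x = 0"
    and B: "\<And>S x. norm (partial_derivs (mi_list (\<lambda>i. if i \<in> S then s else 0)) H x) \<le> B"
  shows "(\<Prod>i\<in>UNIV. (2 + \<bar>\<xi> $ i\<bar>) ^ s) * norm (ft H \<xi>)
    \<le> (2 * 4 ^ s) ^ CARD('n) * (B * measure lborel (cball (0 :: real^'n) R))"
proof -
  let ?M = "B * measure lborel (cball (0 :: real^'n) R)"
  have "(2 + \<bar>t\<bar>) ^ s \<le> 4 ^ s * (1 + \<bar>t\<bar> ^ s)" for t :: real
  proof -
    have "(2 + \<bar>t\<bar>) ^ s \<le> (4 * max 1 \<bar>t\<bar>) ^ s" by (intro power_mono) auto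
    also have "\<dots> = 4 ^ s * max 1 \<bar>t\<bar> ^ s" by (simp add: power_mult_distrib)
    also have "max 1 \<bar>t\<bar> ^ s \<le> 1 + \<bar>t\<bar> ^ s" by (cases "\<bar>t\<bar> \<le> 1") (auto simp: max_def)
    finally show ?thesis by simp
  qed
  note le = this
  \<comment> \<open>The two summands are indexed by a Boolean, so that the product of sums becomes a
    sum over functions into the Booleans, that is, over sets of coordinates.\<close>
  have "(\<Prod>i\<in>UNIV. (2 + \<bar>\<xi> $ i\<bar>) ^ s) \<le> (\<Prod>i\<in>(UNIV::'n set). 4 ^ s * (\<Sum>b\<in>UNIV. if b then \<bar>\<xi> $ i\<bar> ^ s else 1))"
    by (intro prod_mono conjI) (use le in \<open>simp_all add: UNIV_bool\<close>)
  also have "\<dots> = (4 ^ s) ^ CARD('n) * (\<Sum>b\<in>UNIV. \<Prod>i\<in>(UNIV::'n set). if b i then \<bar>\<xi> $ i\<bar> ^ s else 1)"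
    by (simp add: prod.distrib prod_sum_PiE PiE_UNIV_domain)
  finally have "(\<Prod>i\<in>UNIV. (2 + \<bar>\<xi> $ i\<bar>) ^ s) * norm (ft H \<xi>)
      \<le> (4 ^ s) ^ CARD('n) * (\<Sum>b\<in>UNIV. (\<Prod>i\<in>(UNIV::'n set). if b i then \<bar>\<xi> $ i\<bar> ^ s else 1)) * norm (ft H \<xi>)"
    by (rule mult_right_mono) simp
  also have "\<dots> = (4 ^ s) ^ CARD('n) * (\<Sum>b\<in>UNIV. (\<Prod>i\<in>(UNIV::'n set). if b i then \<bar>\<xi> $ i\<bar> ^ s else 1) * norm (ft H \<xi>))"
    by (simp add: sum_distrib_right mult.assoc)
  also have "\<dots> \<le> (4 ^ s) ^ CARD('n) * (\<Sum>b\<in>(UNIV :: ('n \<Rightarrow> bool) set). ?M)"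
  proof (intro mult_left_mono sum_mono)
    fix b :: "'n \<Rightarrow> bool"
    let ?\<alpha> = "\<lambda>i. if i \<in> Collect b then s else 0"
    have "(\<Prod>i\<in>(UNIV::'n set). if b i then \<bar>\<xi> $ i\<bar> ^ s else 1) = norm (mi_power \<xi> ?\<alpha>)"
      unfolding mi_power_def prod_norm[symmetric] by (intro prod.cong) (auto simp: norm_power)
    then show "(\<Prod>i\<in>(UNIV::'n set). if b i then \<bar>\<xi> $ i\<bar> ^ s else 1) * norm (ft H \<xi>) \<le> ?M"
      using norm_ft_mult_mi_power_le[of H R ?\<alpha> B \<xi>, OF assms(1,2)] B[of "Collect b"] by simp
  qed simp
  also have "\<dots> = (2 * 4 ^ s) ^ CARD('n) * ?M"
    by (simp add: card_fun power_mult_distrib)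
  finally show ?thesis .
qed

section \<open>Approximation by trigonometric polynomials\<close>

text \<open>Euler's formula and the binomial theorem. With an even power all frequencies are even
  multiples of \<open>t\<close>, so at half an angle they become integer multiples of the full
  one.\<close>

lemma cos_power_even_eq_sum_cis:
  "complex_of_real ((2 * cos t) ^ (2 * N)) =
    (\<Sum>j\<in>{- int N..int N}. of_nat ((2 * N) choose nat (int N + j)) * cis (2 * of_int j * t))"
proof -
  have "complex_of_real (2 * cos t) = cis t + cis (- t)" by (simp add: complex_eq_iff)
  then have "complex_of_real ((2 * cos t) ^ (2 * N)) = (cis t + cis (- t)) ^ (2 * N)"
    by (simp only: of_real_power)
  also have "\<dots> = (\<Sum>i\<le>2 * N. of_nat ((2 * N) choose i) * cis t ^ i * cis (- t) ^ (2 * N - i))"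
    by (rule binomial_ring)
  also have "\<dots> = (\<Sum>j\<in>{- int N..int N}. of_nat ((2 * N) choose nat (int N + j)) * cis (2 * of_int j * t))"
  proof (rule sum.reindex_bij_witness[of _ "\<lambda>j. nat (int N + j)" "\<lambda>i. int i - int N"])
    fix i assume i: "i \<in> {..2 * N}"
    have "cis t ^ i * cis (- t) ^ (2 * N - i) = cis (2 * of_int (int i - int N) * t)"
      unfolding Complex.DeMoivre cis_mult using i by (simp add: of_nat_diff algebra_simps)
    then show "of_nat ((2 * N) choose nat (int N + (int i - int N))) * cis (2 * of_int (int i - int N) * t)
        = of_nat ((2 * N) choose i) * cis t ^ i * cis (- t) ^ (2 * N - i)"
      by (simp add: mult.assoc)
  qed auto
  finally show ?thesis .
qed

lemma has_integral_cos_period: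
  assumes "\<omega> > 0"
  shows "((\<lambda>s. cos (of_int j * (\<omega> * s))) has_integral (if j = 0 then 2 * pi / \<omega> else 0)) {- pi / \<omega>..pi / \<omega>}"
proof (cases "j = 0")
  case True
  have "((\<lambda>s. 1 :: real) has_integral (pi / \<omega> - (- pi / \<omega>))) {- pi / \<omega>..pi / \<omega>}"
    using has_integral_const_real[of "1::real" "- pi / \<omega>" "pi / \<omega>"] assms by (simp add: field_simps)
  then show ?thesis using True by (simp add: field_simps)
next
  case False
  have "((\<lambda>s. cos (of_int j * (\<omega> * s))) has_integral
      (sin (of_int j * (\<omega> * (pi / \<omega>))) / (of_int j * \<omega>) - sin (of_int j * (\<omega> * (- pi / \<omega>))) / (of_int j * \<omega>)))
      {- pi / \<omega>..pi / \<omega>}"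
  proof (rule fundamental_theorem_of_calculus)
    show "- pi / \<omega> \<le> pi / \<omega>" using assms by (simp add: field_simps)
    fix s
    show "((\<lambda>s. sin (of_int j * (\<omega> * s)) / (of_int j * \<omega>)) has_vector_derivative cos (of_int j * (\<omega> * s)))
        (at s within {- pi / \<omega>..pi / \<omega>})"
      unfolding has_real_derivative_iff_has_vector_derivative[symmetric]
      using False assms by (auto intro!: derivative_eq_intros)
  qed
  then show ?thesis using False assms by (simp add: sin_npi_int mult.commute)
qed

lemma has_integral_cos_power_even:
  assumes "\<omega> > 0"
  shows "((\<lambda>s. cos (\<omega> * s / 2) ^ (2 * N)) has_integral (2 * pi / \<omega> * (real ((2 * N) choose N) / 4 ^ N)))
    {- pi / \<omega>..pi / \<omega>}"
proof -
  have eq: "cos (\<omega> * s / 2) ^ (2 * N) =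
      (\<Sum>j\<in>{- int N..int N}. real ((2 * N) choose nat (int N + j)) / 4 ^ N * cos (of_int j * (\<omega> * s)))" for s
  proof -
    have "(2 * cos (\<omega> * s / 2)) ^ (2 * N) =
        Re (\<Sum>j\<in>{- int N..int N}. of_nat ((2 * N) choose nat (int N + j)) * cis (2 * of_int j * (\<omega> * s / 2)))"
      by (simp only: cos_power_even_eq_sum_cis[symmetric] Re_complex_of_real)
    also have "\<dots> = (\<Sum>j\<in>{- int N..int N}. real ((2 * N) choose nat (int N + j)) * cos (of_int j * (\<omega> * s)))"
      by (simp add: mult.assoc)
    finally have "4 ^ N * cos (\<omega> * s / 2) ^ (2 * N)
        = (\<Sum>j\<in>{- int N..int N}. real ((2 * N) choose nat (int N + j)) * cos (of_int j * (\<omega> * s)))"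
      by (simp add: power_mult_distrib power_mult)
    then have "cos (\<omega> * s / 2) ^ (2 * N)
        = (\<Sum>j\<in>{- int N..int N}. real ((2 * N) choose nat (int N + j)) * cos (of_int j * (\<omega> * s))) / 4 ^ N"
      by (simp add: field_simps)
    then show ?thesis by (simp add: sum_divide_distrib)
  qed
  have "((\<lambda>s. \<Sum>j\<in>{- int N..int N}. real ((2 * N) choose nat (int N + j)) / 4 ^ N * cos (of_int j * (\<omega> * s)))
      has_integral (\<Sum>j\<in>{- int N..int N}. real ((2 * N) choose nat (int N + j)) / 4 ^ N *
        (if j = 0 then 2 * pi / \<omega> else 0)))
      {- pi / \<omega>..pi / \<omega>}"
    by (intro has_integral_sum has_integral_mult_right has_integral_cos_period assms) auto
  also have "(\<Sum>j\<in>{- int N..int N}. real ((2 * N) choose nat (int N + j)) / 4 ^ N * (if j = 0 then 2 * pi / \<omega> else 0))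
      = (\<Sum>j\<in>{- int N..int N}. if j = 0 then real ((2 * N) choose N) / 4 ^ N * (2 * pi / \<omega>) else 0)"
    by (intro sum.cong) auto
  also have "\<dots> = 2 * pi / \<omega> * (real ((2 * N) choose N) / 4 ^ N)" by (simp add: mult_ac)
  finally show ?thesis unfolding eq .
qed

text \<open>Up to powers of 4 the central binomial coefficients give the integrals of the even
  powers of the cosine; their ratio decides how fast the kernel concentrates.\<close>

lemma central_binomial_Suc:
  "real (Suc N) * real ((2 * Suc N) choose Suc N) = 2 * real (2 * N + 1) * real ((2 * N) choose N)"
proof -
  have 1: "Suc N * ((2 * Suc N) choose Suc N) = (2 * Suc N) * ((2 * N + 1) choose N)"
    using Suc_times_binomial_eq[of "2 * N + 1" N] by (simp add: mult.commute)
  have "Suc N * ((2 * N + 1) choose Suc N) = (2 * N + 1) * ((2 * N) choose N)"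
    using Suc_times_binomial_eq[of "2 * N" N] by (simp add: mult.commute)
  moreover have "(2 * N + 1) choose Suc N = (2 * N + 1) choose N"
    using binomial_symmetric[of "Suc N" "2 * N + 1"] by simp
  ultimately have "Suc N * ((2 * N + 1) choose N) = (2 * N + 1) * ((2 * N) choose N)" by simp
  with 1 have "Suc N * ((2 * Suc N) choose Suc N) = 2 * ((2 * N + 1) * ((2 * N) choose N))" by simp
  then show ?thesis unfolding of_nat_mult[symmetric] of_nat_eq_iff
    by (metis (no_types, lifting) mult.assoc of_nat_eq_iff of_nat_mult of_nat_numeral)
qed

text \<open>The function \<open>sin t - t * cos t\<close> has derivative \<open>t * sin t\<close>,
  which is nonnegative between 0 and \<open>pi / 2\<close>. The inequality is made for second
  moments, where it trades a factor \<open>t^2\<close> for \<open>1 - cos^2\<close>.\<close>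

lemma abs_mult_cos_le_abs_sin:
  assumes "\<bar>t\<bar> \<le> pi / 2"
  shows "(t * cos t)\<^sup>2 \<le> (sin t)\<^sup>2"
proof -
  have *: "t * cos t \<le> sin t" if "0 \<le> t" "t \<le> pi / 2" for t
  proof -
    have "sin 0 - 0 * cos 0 \<le> sin t - t * cos t"
    proof (rule DERIV_nonneg_imp_nondecreasing[OF that(1)])
      fix x assume x: "0 \<le> x" "x \<le> t"
      have "((\<lambda>t. sin t - t * cos t) has_real_derivative x * sin x) (at x)"
        by (auto intro!: derivative_eq_intros)
      moreover have "0 \<le> x * sin x" using x that by (intro mult_nonneg_nonneg sin_ge_zero) auto
      ultimately show "\<exists>y. ((\<lambda>t. sin t - t * cos t) has_real_derivative y) (at x) \<and> 0 \<le> y" by blast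
    qed
    then show ?thesis by simp
  qed
  show ?thesis
  proof (cases "t \<ge> 0")
    case True
    then show ?thesis using *[of t] assms cos_ge_zero[of t] by (intro power_mono) auto
  next
    case False
    then have t: "0 \<le> - t" "- t \<le> pi / 2" using assms by auto
    have "(- t) * cos (- t) \<le> sin (- t)" by (rule *[OF t])
    moreover have "0 \<le> (- t) * cos (- t)"
      by (rule mult_nonneg_nonneg[OF t(1)]) (use t in \<open>auto intro!: cos_ge_zero simp del: cos_minus\<close>)
    ultimately have "((- t) * cos (- t))\<^sup>2 \<le> (sin (- t))\<^sup>2" by (rule power_mono)
    then show ?thesis by (simp add: power_mult_distrib)
  qed
qed

text \<open>The de la Vallee Poussin kernel of period \<open>2 * pi / \<omega>\<close>: a
  nonnegative trigonometric polynomial, normalized to integral 1 over a period. A bound on its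
  second moment is then enough to make it an approximate identity.\<close>

definition kernel :: "real \<Rightarrow> nat \<Rightarrow> real \<Rightarrow> real" where
  "kernel \<omega> N s = \<omega> / (2 * pi) * (4 ^ N / real ((2 * N) choose N)) * cos (\<omega> * s / 2) ^ (2 * N)"

definition kernel_coeff :: "nat \<Rightarrow> int \<Rightarrow> real" where
  "kernel_coeff N j = real ((2 * N) choose nat (int N + j)) / real ((2 * N) choose N)"

lemma kernel_coeff_bounds: "0 \<le> kernel_coeff N j" "kernel_coeff N j \<le> 1"
proof -
  have "real ((2 * N) choose N) > 0" by simp
  then show "0 \<le> kernel_coeff N j" "kernel_coeff N j \<le> 1"
    using binomial_maximum[of "2 * N" "nat (int N + j)"]
    unfolding kernel_coeff_def by (simp_all add: divide_le_eq_1)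
qed

lemma kernel_eq_sum:
  "complex_of_real (kernel \<omega> N s) =
    (\<Sum>j\<in>{- int N..int N}. of_real (\<omega> / (2 * pi) * kernel_coeff N j) * cis (of_int j * \<omega> * s))"
proof -
  have "complex_of_real (kernel \<omega> N s)
      = of_real (\<omega> / (2 * pi) / real ((2 * N) choose N)) * complex_of_real ((2 * cos (\<omega> * s / 2)) ^ (2 * N))"
    by (simp add: kernel_def power_mult_distrib power_mult)
  also have "\<dots> = (\<Sum>j\<in>{- int N..int N}. of_real (\<omega> / (2 * pi) * kernel_coeff N j) * cis (of_int j * \<omega> * s))"
    unfolding cos_power_even_eq_sum_cis sum_distrib_left
    by (intro sum.cong) (auto simp: kernel_coeff_def mult_ac)
  finally show ?thesis .
qed

lemma kernel_nonneg: "\<omega> > 0 \<Longrightarrow> kernel \<omega> N s \<ge> 0"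
  by (simp add: kernel_def power_mult)

lemma continuous_on_kernel [continuous_intros]: "continuous_on S (kernel \<omega> N)"
  unfolding kernel_def[abs_def] by (intro continuous_intros) auto

lemma has_integral_kernel:
  assumes "\<omega> > 0"
  shows "(kernel \<omega> N has_integral 1) {- pi / \<omega>..pi / \<omega>}"
proof -
  have "real ((2 * N) choose N) > 0" by simp
  then have "\<omega> / (2 * pi) * (4 ^ N / real ((2 * N) choose N)) * (2 * pi / \<omega> * (real ((2 * N) choose N) / 4 ^ N)) = 1"
    using assms by (simp del: of_nat_0_less_iff)
  with has_integral_mult_right[OF has_integral_cos_power_even[OF assms, of N],
      of "\<omega> / (2 * pi) * (4 ^ N / real ((2 * N) choose N))"]
  show ?thesis unfolding kernel_def[abs_def] by simp
qed

text \<open>One factor \<open>cos^2\<close> is spent to replace the weight \<open>s^2\<close> by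
  \<open>4 / \<omega>^2\<close> times \<open>1 - cos^2\<close>. The moment is thus at most a
  difference of two integrals of even powers of the cosine, both known exactly. The factor spent is
  the reason for the index \<open>Suc N\<close>.\<close>

lemma kernel_second_moment:
  assumes "\<omega> > 0"
  shows "integral {- pi / \<omega>..pi / \<omega>} (\<lambda>s. s\<^sup>2 * kernel \<omega> (Suc N) s) \<le> 4 / \<omega>\<^sup>2 / (2 * real N + 1)"
proof -
  let ?I = "{- pi / \<omega>..pi / \<omega>}"
  let ?B = "\<lambda>N. real ((2 * N) choose N)"
  define c where "c = \<omega> / (2 * pi) * (4 ^ Suc N / ?B (Suc N))"
  have Bpos: "?B N > 0" "?B (Suc N) > 0"
    by (auto intro!: zero_less_binomial simp del: binomial_Suc_Suc mult_Suc_right)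
  have c: "c \<ge> 0" using assms by (simp add: c_def)
  have le: "s\<^sup>2 * kernel \<omega> (Suc N) s
      \<le> 4 / \<omega>\<^sup>2 * (c * cos (\<omega> * s / 2) ^ (2 * N) - kernel \<omega> (Suc N) s)" if s: "s \<in> ?I" for s
  proof -
    define t where "t = \<omega> * s / 2"
    have "\<bar>t\<bar> \<le> pi / 2" using s assms by (auto simp: t_def abs_le_iff field_simps)
    then have "(t * cos t)\<^sup>2 \<le> (sin t)\<^sup>2" by (rule abs_mult_cos_le_abs_sin)
    then have "t\<^sup>2 * (cos t)\<^sup>2 * cos t ^ (2 * N) \<le> (1 - (cos t)\<^sup>2) * cos t ^ (2 * N)"
      by (intro mult_right_mono) (simp_all add: power_mult_distrib sin_squared_eq power_mult)
    then have "t\<^sup>2 * cos t ^ (2 * Suc N) \<le> cos t ^ (2 * N) - cos t ^ (2 * Suc N)"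
      by (simp add: power2_eq_square algebra_simps)
    then have "c * (4 / \<omega>\<^sup>2 * (t\<^sup>2 * cos t ^ (2 * Suc N)))
        \<le> c * (4 / \<omega>\<^sup>2 * (cos t ^ (2 * N) - cos t ^ (2 * Suc N)))"
      using c by (intro mult_left_mono) auto
    moreover have k: "kernel \<omega> (Suc N) s = c * cos t ^ (2 * Suc N)"
      by (simp only: kernel_def c_def t_def)
    moreover have "s\<^sup>2 * (c * cos t ^ (2 * Suc N)) = c * (4 / \<omega>\<^sup>2 * (t\<^sup>2 * cos t ^ (2 * Suc N)))"
      using assms by (simp add: power2_eq_square t_def)
    ultimately have "s\<^sup>2 * kernel \<omega> (Suc N) s \<le> c * (4 / \<omega>\<^sup>2 * (cos t ^ (2 * N) - cos t ^ (2 * Suc N)))"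
      by simp
    also have "\<dots> = 4 / \<omega>\<^sup>2 * (c * cos t ^ (2 * N) - kernel \<omega> (Suc N) s)"
      unfolding k by (simp only: right_diff_distrib mult_ac)
    finally show ?thesis by (simp only: t_def)
  qed
  have "((\<lambda>s. c * cos (\<omega> * s / 2) ^ (2 * N)) has_integral c * (2 * pi / \<omega> * (?B N / 4 ^ N))) ?I"
    by (intro has_integral_mult_right has_integral_cos_power_even assms)
  \<comment> \<open>Under the normalization of the higher power the lower one has mass
    \<open>(2N + 2) / (2N + 1)\<close>; the excess over 1 is the decay rate of the moment.\<close>
  moreover have "c * (2 * pi / \<omega> * (?B N / 4 ^ N)) - 1 = 1 / (2 * real N + 1)"
  proof -
    have "c * (2 * pi / \<omega> * (?B N / 4 ^ N)) = 4 * ?B N / ?B (Suc N)"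
      using assms by (simp add: c_def)
    also have "\<dots> = 2 * real (Suc N) / real (2 * N + 1)"
      using central_binomial_Suc[of N] Bpos by (simp add: frac_eq_eq del: of_nat_Suc binomial_Suc_Suc)
    finally show ?thesis by (simp add: field_simps)
  qed
  ultimately have eq: "c * (2 * pi / \<omega> * (?B N / 4 ^ N)) - 1 = 1 / (2 * real N + 1)"
    and int: "((\<lambda>s. c * cos (\<omega> * s / 2) ^ (2 * N)) has_integral c * (2 * pi / \<omega> * (?B N / 4 ^ N))) ?I"
    by auto
  have "((\<lambda>s. 4 / \<omega>\<^sup>2 * (c * cos (\<omega> * s / 2) ^ (2 * N) - kernel \<omega> (Suc N) s))
      has_integral 4 / \<omega>\<^sup>2 * (1 / (2 * real N + 1))) ?I"
    unfolding eq[symmetric] by (intro has_integral_mult_right has_integral_diff int has_integral_kernel assms)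
  moreover have "((\<lambda>s. s\<^sup>2 * kernel \<omega> (Suc N) s) has_integral
      integral ?I (\<lambda>s. s\<^sup>2 * kernel \<omega> (Suc N) s)) ?I"
    by (intro integrable_integral integrable_continuous_real continuous_intros)
  ultimately have "integral ?I (\<lambda>s. s\<^sup>2 * kernel \<omega> (Suc N) s) \<le> 4 / \<omega>\<^sup>2 * (1 / (2 * real N + 1))"
    by (meson has_integral_le le)
  then show ?thesis by simp
qed

lemma has_bochner_integral_Icc:
  fixes f :: "real \<Rightarrow> real"
  assumes "continuous_on {a..b} f"
  shows "has_bochner_integral lborel (\<lambda>s. indicator {a..b} s * f s) (integral {a..b} f)"
proof -
  have i: "set_integrable lborel {a..b} f"
    unfolding set_integrable_def by (rule borel_integrable_compact[OF compact_Icc assms])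
  from set_borel_integral_eq_integral(2)[OF this] i show ?thesis
    by (simp add: has_bochner_integral_iff set_integrable_def set_lebesgue_integral_def)
qed

text \<open>Tonelli's theorem for a product of functions of one coordinate each; nonnegativity
  permits the passage through integrals with values in \<open>ennreal\<close>.\<close>

lemma has_bochner_integral_prod_lborel:
  fixes g :: "'n::finite \<Rightarrow> real \<Rightarrow> real"
  assumes g: "\<And>i. has_bochner_integral lborel (g i) (c i)" and nn: "\<And>i s. g i s \<ge> 0"
  shows "has_bochner_integral lborel (\<lambda>z::real^'n. \<Prod>i\<in>UNIV. g i (z $ i)) (\<Prod>i\<in>UNIV. c i)"
proof (rule has_bochner_integral_nn_integral)
  have [measurable]: "g i \<in> borel_measurable borel" for i
    using g[of i] by (auto simp: has_bochner_integral_iff dest: borel_measurable_integrable)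
  have c: "c i \<ge> 0" for i
    using g[of i] nn Bochner_Integration.integral_nonneg[of lborel "g i"] by (simp add: has_bochner_integral_iff)
  show "(\<lambda>z::real^'n. \<Prod>i\<in>UNIV. g i (z $ i)) \<in> borel_measurable lborel" by measurable
  show "AE z in lborel. 0 \<le> (\<Prod>i\<in>UNIV. g i (z $ i))" by (simp add: nn prod_nonneg)
  show "0 \<le> (\<Prod>i\<in>UNIV. c i)" using c by (intro prod_nonneg) auto
  define e :: "'n \<Rightarrow> real^'n" where "e i = axis i 1" for i
  have e: "inj e" "Basis = range e"
    by (auto simp: e_def inj_on_def axis_eq_axis Basis_vec_def)
  have "(\<integral>\<^sup>+ z. ennreal (\<Prod>i\<in>UNIV. g i (z $ i)) \<partial>lborel)
      = (\<integral>\<^sup>+ z. (\<Prod>b\<in>Basis. ennreal (g (inv e b) ((z :: real^'n) \<bullet> b))) \<partial>lborel)"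
    using e(1) by (simp add: e(2) prod.reindex prod_ennreal nn e_def[symmetric]) (simp add: e_def inner_axis)
  also have "\<dots> = (\<Prod>b\<in>Basis. (\<integral>\<^sup>+ s. ennreal (g (inv e b) s) \<partial>lborel))"
    by (rule nn_integral_lborel_prod) auto
  also have "\<dots> = (\<Prod>i\<in>UNIV. (\<integral>\<^sup>+ s. ennreal (g i s) \<partial>lborel))"
    using e(1) by (simp add: e(2) prod.reindex)
  also have "\<dots> = (\<Prod>i\<in>UNIV. ennreal (c i))"
    using g nn by (intro prod.cong refl) (auto simp: has_bochner_integral_iff nn_integral_eq_integral)
  also have "\<dots> = ennreal (\<Prod>i\<in>UNIV. c i)" using c by (simp add: prod_ennreal)
  finally show "(\<integral>\<^sup>+ z. ennreal (\<Prod>i\<in>UNIV. g i (z $ i)) \<partial>lborel) = ennreal (\<Prod>i\<in>UNIV. c i)" .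
qed

lemma norm_cis_minus_one_le: "norm (cis t - 1) \<le> \<bar>t\<bar>"
proof (rule power2_le_imp_le)
  have "(norm (cis t - 1))\<^sup>2 = (cos t - 1)\<^sup>2 + (sin t)\<^sup>2" by (simp add: cmod_power2)
  also have "\<dots> = 2 - 2 * cos t"
    using sin_squared_eq[of t] by (simp add: power2_eq_square algebra_simps)
  also have "\<dots> = 4 * (sin (t / 2))\<^sup>2"
    using cos_double_sin[of "t / 2"] by simp
  also have "\<dots> \<le> 4 * (t / 2)\<^sup>2"
    using abs_sin_x_le_abs_x[of "t / 2"] by (simp only: abs_le_square_iff)
  finally show "(norm (cis t - 1))\<^sup>2 \<le> \<bar>t\<bar>\<^sup>2" by (simp add: power2_eq_square)
qed simp

section \<open>Shifted frequency lattices and convolution with the product kernel\<close>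

definition freq :: "real \<Rightarrow> real^'n \<Rightarrow> ('n \<Rightarrow> int) \<Rightarrow> real^'n::finite" where
  "freq \<omega> \<theta> k = (\<chi> i. \<omega> * of_int (k i) + \<theta> $ i)"

definition freq_box :: "nat \<Rightarrow> ('n::finite \<Rightarrow> int) set" where
  "freq_box N = PiE UNIV (\<lambda>_. {- int N..int N})"

definition box_coeff :: "real \<Rightarrow> nat \<Rightarrow> ('n::finite \<Rightarrow> int) \<Rightarrow> real" where
  "box_coeff \<omega> N k = (\<Prod>i\<in>UNIV. \<omega> / (2 * pi) * kernel_coeff N (k i))"

lemma finite_freq_box: "finite (freq_box N)"
  unfolding freq_box_def by (intro finite_PiE) auto

text \<open>Shifting the lattice by \<open>\<theta>\<close> modulates the product kernel by
  \<open>cis (\<theta> \<bullet> z)\<close>. This factor has modulus 1 and is close to 1 near the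
  origin, so the approximation property survives the shift.\<close>

lemma trig_sum_box_eq:
  fixes z :: "real^'n::finite"
  shows "trig_sum (freq_box N) (\<lambda>k. of_real (box_coeff \<omega> N k)) (freq \<omega> \<theta>) z
    = cis (\<theta> \<bullet> z) * of_real (\<Prod>i\<in>UNIV. kernel \<omega> N (z $ i))"
proof -
  have cis_sum: "cis (\<Sum>i\<in>A. f i) = (\<Prod>i\<in>A. cis (f i))" if "finite A" for A and f :: "'n \<Rightarrow> real"
    using that by (induction A) (auto simp: cis_mult[symmetric])
  have "complex_of_real (\<Prod>i\<in>UNIV. kernel \<omega> N (z $ i))
      = (\<Sum>k\<in>freq_box N. \<Prod>i\<in>UNIV. of_real (\<omega> / (2 * pi) * kernel_coeff N (k i)) * cis (of_int (k i) * \<omega> * z $ i))"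
    unfolding of_real_prod kernel_eq_sum freq_box_def by (rule prod_sum_PiE) auto
  also have "cis (\<theta> \<bullet> z) * \<dots> = (\<Sum>k\<in>freq_box N. of_real (box_coeff \<omega> N k) * cis (freq \<omega> \<theta> k \<bullet> z))"
    unfolding sum_distrib_left
  proof (rule sum.cong[OF refl])
    fix k :: "'n \<Rightarrow> int"
    have "freq \<omega> \<theta> k \<bullet> z = \<theta> \<bullet> z + (\<Sum>i\<in>UNIV. of_int (k i) * \<omega> * z $ i)"
      by (simp add: freq_def inner_vec_def algebra_simps sum.distrib)
    then have "cis (freq \<omega> \<theta> k \<bullet> z) = cis (\<theta> \<bullet> z) * (\<Prod>i\<in>UNIV. cis (of_int (k i) * \<omega> * z $ i))"
      by (simp add: cis_mult[symmetric] cis_sum)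
    moreover have "complex_of_real (box_coeff \<omega> N k) = (\<Prod>i\<in>UNIV. of_real (\<omega> / (2 * pi) * kernel_coeff N (k i)))"
      by (simp only: box_coeff_def of_real_prod)
    ultimately show "cis (\<theta> \<bullet> z) *
        (\<Prod>i\<in>UNIV. of_real (\<omega> / (2 * pi) * kernel_coeff N (k i)) * cis (of_int (k i) * \<omega> * z $ i))
        = of_real (box_coeff \<omega> N k) * cis (freq \<omega> \<theta> k \<bullet> z)"
      by (simp only: prod.distrib mult_ac)
  qed
  finally show ?thesis by (simp add: trig_sum_def)
qed

lemma trig_sum_ft_eq_integral:
  fixes H :: "real^'n::finite \<Rightarrow> complex"
  assumes sm: "smooth_on UNIV H" and z: "\<And>x. x \<notin> cball 0 R \<Longrightarrow> H x = 0" and K: "finite K"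
  shows "trig_sum K (\<lambda>k. c k * ft H (\<xi> k)) \<xi> x = (\<integral>z. H (x - z) * trig_sum K c \<xi> z \<partial>lborel)"
proof -
  have int: "integrable lborel (\<lambda>y. H y * cis (- (\<xi> \<bullet> y)))" for \<xi>
    by (rule integrable_compact_support[where R = R])
      (auto intro!: continuous_intros smooth_on_UNIV_D(2)[OF sm] simp: z)
  have "trig_sum K (\<lambda>k. c k * ft H (\<xi> k)) \<xi> x
      = (\<Sum>k\<in>K. \<integral>y. c k * cis (\<xi> k \<bullet> x) * (H y * cis (- (\<xi> k \<bullet> y))) \<partial>lborel)"
    by (simp add: trig_sum_def ft_def) (simp add: mult_ac)
  also have "\<dots> = (\<integral>y. (\<Sum>k\<in>K. c k * cis (\<xi> k \<bullet> x) * (H y * cis (- (\<xi> k \<bullet> y)))) \<partial>lborel)"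
    by (rule Bochner_Integration.integral_sum[symmetric]) (intro integrable_mult_right int)
  also have "\<dots> = (\<integral>y. H y * trig_sum K c \<xi> (x - y) \<partial>lborel)"
    by (intro Bochner_Integration.integral_cong refl)
      (simp add: trig_sum_def sum_distrib_left inner_diff_right cis_mult mult_ac flip: cis_mult[of "_ \<bullet> x" "- _"])
  also have "\<dots> = (\<integral>z. H (x - z) * trig_sum K c \<xi> (x - (x - z)) \<partial>lborel)"
    by (rule integral_lborel_reflect[symmetric])
      (intro borel_measurable_continuous_onI continuous_intros smooth_on_UNIV_D(2)[OF sm]
        continuous_on_compose2[OF smooth_on_UNIV_D(2)[OF smooth_on_trig_sum]], auto)
  finally show ?thesis by simp
qed

definition trig_approx :: "real \<Rightarrow> nat \<Rightarrow> real^'n \<Rightarrow> (real^'n \<Rightarrow> complex) \<Rightarrow> real^'n::finite \<Rightarrow> complex" where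
  "trig_approx \<omega> N \<theta> H = trig_sum (freq_box N)
    (\<lambda>k. of_real (box_coeff \<omega> N k) * ft H (freq \<omega> \<theta> k)) (freq \<omega> \<theta>)"

text \<open>Since \<open>H (x - v)\<close> vanishes for \<open>v\<close> outside one period cell,
  the periodic kernel acts like a probability density \<open>K\<close> on that cell. The error is
  the mean of a quantity bounded by \<open>2 * B\<close> times the sum of the \<open>|v_i|\<close>,
  one \<open>B\<close> coming from the increment of \<open>H\<close> and one from the
  modulation.\<close>

lemma norm_trig_approx_le:
  fixes H :: "real^'n::finite \<Rightarrow> complex"
  assumes sm: "smooth_on UNIV H" and z: "\<And>x. x \<notin> cball 0 R \<Longrightarrow> H x = 0"
    and B: "\<And>x. norm (H x) \<le> B" "\<And>i x. norm (partial_deriv i H x) \<le> B"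
    and \<omega>: "\<omega> > 0" and x: "norm x + R \<le> pi / \<omega>" and \<theta>: "\<And>i. \<bar>\<theta> $ i\<bar> \<le> 1" and \<delta>: "\<delta> > 0"
  shows "norm (trig_approx \<omega> (Suc N) \<theta> H x - H x)
    \<le> 2 * B * real CARD('n) * (\<delta> + 4 / \<omega>\<^sup>2 / (2 * real N + 1) / \<delta>)"
proof -
  define I where "I = {- pi / \<omega>..pi / \<omega>}"
  define M where "M = integral I (\<lambda>s. s\<^sup>2 * kernel \<omega> (Suc N) s)"
  define k where "k s = indicator I s * kernel \<omega> (Suc N) s" for s
  define K where "K v = (\<Prod>i\<in>UNIV. k (v $ i))" for v :: "real^'n"
  have k0: "k s \<ge> 0" for s using kernel_nonneg[OF \<omega>] by (simp add: k_def)
  have K0: "K v \<ge> 0" for v using k0 by (simp add: K_def prod_nonneg)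
  have kint: "has_bochner_integral lborel k 1"
    using has_bochner_integral_Icc[OF continuous_on_kernel, of "- pi / \<omega>" "pi / \<omega>" \<omega> "Suc N"]
      integral_unique[OF has_integral_kernel[OF \<omega>, of "Suc N"]]
    unfolding k_def[abs_def] I_def by simp
  have k2int: "has_bochner_integral lborel (\<lambda>s. s\<^sup>2 * k s) M"
  proof -
    have "has_bochner_integral lborel (\<lambda>s. indicator I s * (s\<^sup>2 * kernel \<omega> (Suc N) s)) M"
      unfolding I_def M_def by (intro has_bochner_integral_Icc continuous_intros)
    then show ?thesis by (simp add: k_def mult_ac)
  qed
  have M: "M \<le> 4 / \<omega>\<^sup>2 / (2 * real N + 1)"
    unfolding M_def I_def by (rule kernel_second_moment[OF \<omega>])
  have Kint: "has_bochner_integral lborel K 1"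
    using has_bochner_integral_prod_lborel[of "\<lambda>_::'n. k" "\<lambda>_. 1"] kint k0 by (simp add: K_def[abs_def])
  have K2int: "has_bochner_integral lborel (\<lambda>v. (v $ j)\<^sup>2 * K v) M" for j
  proof -
    let ?g = "\<lambda>i s. if i = j then s\<^sup>2 * k s else k s"
    have "has_bochner_integral lborel (\<lambda>v::real^'n. \<Prod>i\<in>UNIV. ?g i (v $ i)) (\<Prod>i\<in>(UNIV::'n set). if i = j then M else 1)"
      by (rule has_bochner_integral_prod_lborel) (use kint k2int k0 in auto)
    moreover have "(\<Prod>i\<in>UNIV. ?g i (v $ i)) = (v $ j)\<^sup>2 * K v" for v :: "real^'n"
    proof -
      have "(\<Prod>i\<in>UNIV. ?g i (v $ i)) = (\<Prod>i\<in>UNIV. (if i = j then (v $ i)\<^sup>2 else 1) * k (v $ i))"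
        by (intro prod.cong) auto
      then show ?thesis by (simp add: prod.distrib K_def)
    qed
    ultimately show ?thesis by simp
  qed
  have KI: "integrable lborel K" "(\<integral>v. K v \<partial>lborel) = 1"
    and K2I: "integrable lborel (\<lambda>v. (v $ j)\<^sup>2 * K v)" "(\<integral>v. (v $ j)\<^sup>2 * K v \<partial>lborel) = M" for j
    using Kint K2int[of j] by (auto simp: has_bochner_integral_iff)
  have B0: "B \<ge> 0" by (rule order_trans[OF norm_ge_zero B(1)])
  have [measurable]: "K \<in> borel_measurable borel" using KI(1) by (auto dest: borel_measurable_integrable)
  have cH: "continuous_on S (\<lambda>v. H (x - v))" for S
    by (rule continuous_on_compose2[OF smooth_on_UNIV_D(2)[OF sm]]) (auto intro!: continuous_intros)
  have [measurable]: "(\<lambda>v. H (x - v)) \<in> borel_measurable borel" "(\<lambda>v. cis (\<theta> \<bullet> v)) \<in> borel_measurable borel"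
    by (intro borel_measurable_continuous_onI cH continuous_intros)+
  have "trig_approx \<omega> (Suc N) \<theta> H x
      = (\<integral>v. H (x - v) * (cis (\<theta> \<bullet> v) * of_real (\<Prod>i\<in>UNIV. kernel \<omega> (Suc N) (v $ i))) \<partial>lborel)"
    unfolding trig_approx_def
    by (subst trig_sum_ft_eq_integral[OF sm z finite_freq_box]) (simp_all add: trig_sum_box_eq)
  also have "\<dots> = (\<integral>v. H (x - v) * cis (\<theta> \<bullet> v) * of_real (K v) \<partial>lborel)"
  proof (intro Bochner_Integration.integral_cong refl)
    fix v
    show "H (x - v) * (cis (\<theta> \<bullet> v) * of_real (\<Prod>i\<in>UNIV. kernel \<omega> (Suc N) (v $ i)))
        = H (x - v) * cis (\<theta> \<bullet> v) * of_real (K v)"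
    proof (cases "\<forall>i. v $ i \<in> I")
      case True
      then have "K v = (\<Prod>i\<in>UNIV. kernel \<omega> (Suc N) (v $ i))" by (simp add: K_def k_def)
      then show ?thesis by simp
    next
      \<comment> \<open>Outside the cell some coordinate of \<open>v\<close> exceeds
        \<open>pi / \<omega>\<close> in modulus, so \<open>x - v\<close> leaves the ball of radius
        \<open>R\<close> and both sides vanish.\<close>
      case False
      then obtain i where "v $ i < - pi / \<omega> \<or> pi / \<omega> < v $ i"
        unfolding I_def atLeastAtMost_iff not_all de_Morgan_conj not_le by blast
      then have "\<bar>v $ i\<bar> > pi / \<omega>" by auto
      then have "norm v > norm x + R" using component_le_norm_cart[of v i] x by linarith
      then have "norm (x - v) > R" using norm_triangle_ineq2[of v x] by (simp add: norm_minus_commute)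
      then show ?thesis using z by simp
    qed
  qed
  also have "\<dots> - H x = (\<integral>v. (H (x - v) * cis (\<theta> \<bullet> v) - H x) * of_real (K v) \<partial>lborel)"
  proof -
    have "integrable lborel (\<lambda>v. H (x - v) * cis (\<theta> \<bullet> v) * of_real (K v))"
    proof (rule Bochner_Integration.integrable_bound[of lborel "\<lambda>v. B * K v"])
      show "AE v in lborel. norm (H (x - v) * cis (\<theta> \<bullet> v) * complex_of_real (K v)) \<le> norm (B * K v)"
        using B(1) K0 B0 by (intro AE_I2) (simp add: norm_mult abs_mult mult_right_mono)
    qed (use KI in auto)
    moreover have "integrable lborel (\<lambda>v. H x * complex_of_real (K v))"
      using KI by (intro integrable_mult_right integrable_of_real)
    moreover have "(\<integral>v. H x * complex_of_real (K v) \<partial>lborel) = H x" using KI by simp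
    ultimately show ?thesis by (simp add: left_diff_distrib)
  qed
  also have "norm \<dots> \<le> (\<integral>v. 2 * B * (\<Sum>i\<in>UNIV. \<delta> * K v + (v $ i)\<^sup>2 * K v / \<delta>) \<partial>lborel)"
  proof (rule order_trans[OF integral_norm_bound integral_mono])
    have le: "norm (H (x - v) * cis (\<theta> \<bullet> v) - H x) \<le> 2 * B * (\<Sum>i\<in>UNIV. \<bar>v $ i\<bar>)" for v
    proof -
      have "\<bar>\<theta> \<bullet> v\<bar> \<le> (\<Sum>i\<in>UNIV. \<bar>\<theta> $ i * v $ i\<bar>)" by (simp add: inner_vec_def sum_abs)
      also have "\<dots> \<le> (\<Sum>i\<in>UNIV. \<bar>v $ i\<bar>)"
        using \<theta> by (intro sum_mono) (auto simp: abs_mult intro: mult_left_le_one_le)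
      finally have 1: "norm (cis (\<theta> \<bullet> v) - 1) \<le> (\<Sum>i\<in>UNIV. \<bar>v $ i\<bar>)"
        using norm_cis_minus_one_le order_trans by blast
      have "norm (H (x - v) - H x) \<le> B * (\<Sum>i\<in>UNIV. \<bar>(x - v - x) $ i\<bar>)"
        by (rule norm_diff_le_sum_partial[OF smooth_on_UNIV_D(1)[OF sm] B(2)])
      then have 2: "norm (H (x - v) - H x) \<le> B * (\<Sum>i\<in>UNIV. \<bar>v $ i\<bar>)" by simp
      have "H (x - v) * cis (\<theta> \<bullet> v) - H x = H (x - v) * (cis (\<theta> \<bullet> v) - 1) + (H (x - v) - H x)"
        by (simp add: algebra_simps)
      also have "norm \<dots> \<le> norm (H (x - v)) * norm (cis (\<theta> \<bullet> v) - 1) + norm (H (x - v) - H x)"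
        by (metis norm_mult norm_triangle_ineq)
      also have "\<dots> \<le> B * (\<Sum>i\<in>UNIV. \<bar>v $ i\<bar>) + B * (\<Sum>i\<in>UNIV. \<bar>v $ i\<bar>)"
        by (intro add_mono mult_mono B 1 2 B0) auto
      finally show ?thesis by simp
    qed
    \<comment> \<open>Only the mass and the second moments of \<open>K\<close> are known, so the
      first power is traded for a constant and a square, with \<open>\<delta>\<close> balancing the
      two.\<close>
    have abs_le: "\<bar>s\<bar> \<le> \<delta> + s\<^sup>2 / \<delta>" for s :: real
    proof -
      have "0 \<le> (\<bar>s\<bar> - \<delta>)\<^sup>2 + \<bar>s\<bar> * \<delta>" using \<delta> by simp
      then have "\<bar>s\<bar> * \<delta> \<le> \<delta> * \<delta> + s\<^sup>2" by (simp add: power2_eq_square algebra_simps)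
      then show ?thesis using \<delta> by (simp add: field_simps)
    qed
    show "norm ((H (x - v) * cis (\<theta> \<bullet> v) - H x) * complex_of_real (K v))
        \<le> 2 * B * (\<Sum>i\<in>UNIV. \<delta> * K v + (v $ i)\<^sup>2 * K v / \<delta>)" for v
    proof -
      have "norm ((H (x - v) * cis (\<theta> \<bullet> v) - H x) * complex_of_real (K v))
          \<le> 2 * B * (\<Sum>i\<in>UNIV. \<bar>v $ i\<bar>) * K v"
        using le[of v] K0[of v] by (simp add: norm_mult mult_right_mono)
      also have "\<dots> \<le> 2 * B * (\<Sum>i\<in>UNIV. \<delta> + (v $ i)\<^sup>2 / \<delta>) * K v"
        using B0 K0 by (intro mult_right_mono mult_left_mono sum_mono abs_le) auto
      also have "\<dots> = 2 * B * (\<Sum>i\<in>UNIV. \<delta> * K v + (v $ i)\<^sup>2 * K v / \<delta>)"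
        by (simp add: mult.assoc sum_distrib_right distrib_right)
      finally show "norm ((H (x - v) * cis (\<theta> \<bullet> v) - H x) * complex_of_real (K v))
          \<le> 2 * B * (\<Sum>i\<in>UNIV. \<delta> * K v + (v $ i)\<^sup>2 * K v / \<delta>)" .
    qed
    show "integrable lborel (\<lambda>v. 2 * B * (\<Sum>i\<in>UNIV. \<delta> * K v + (v $ i)\<^sup>2 * K v / \<delta>))"
      by (intro integrable_mult_right Bochner_Integration.integrable_sum Bochner_Integration.integrable_add
          integrable_divide KI K2I)
    show "integrable lborel (\<lambda>v. norm ((H (x - v) * cis (\<theta> \<bullet> v) - H x) * complex_of_real (K v)))"
    proof (rule integrable_norm, rule Bochner_Integration.integrable_bound[of lborel "\<lambda>v. 2 * B * K v"])
      show "AE v in lborel. norm ((H (x - v) * cis (\<theta> \<bullet> v) - H x) * complex_of_real (K v)) \<le> norm (2 * B * K v)"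
      proof (rule AE_I2)
        fix v
        have "norm (H (x - v) * cis (\<theta> \<bullet> v) - H x) \<le> norm (H (x - v) * cis (\<theta> \<bullet> v)) + norm (H x)"
          by (rule norm_triangle_ineq4)
        also have "\<dots> \<le> B + B" by (intro add_mono) (simp_all add: norm_mult B)
        finally show "norm ((H (x - v) * cis (\<theta> \<bullet> v) - H x) * complex_of_real (K v)) \<le> norm (2 * B * K v)"
          using K0[of v] B0 by (simp add: norm_mult mult_right_mono abs_mult)
      qed
    qed (use KI in auto)
  qed
  also have "\<dots> = 2 * B * (\<Sum>i\<in>(UNIV :: 'n set). \<delta> * 1 + M / \<delta>)"
    using KI K2I by (simp add: Bochner_Integration.integral_sum Bochner_Integration.integrable_add)
  also have "\<dots> \<le> 2 * B * (\<Sum>i\<in>(UNIV :: 'n set). \<delta> + 4 / \<omega>\<^sup>2 / (2 * real N + 1) / \<delta>)"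
    using B0 \<delta> M by (intro mult_left_mono sum_mono add_mono divide_right_mono) auto
  finally show ?thesis by (simp add: algebra_simps)
qed

section \<open>Small divisors\<close>

definition separated :: "real \<Rightarrow> real set \<Rightarrow> bool" where
  "separated \<sigma> T \<longleftrightarrow> (\<forall>s\<in>T. \<forall>t\<in>T. s \<noteq> t \<longrightarrow> \<sigma> \<le> \<bar>s - t\<bar>)"

text \<open>Dividing out one node \<open>t0\<close> leaves a quotient of lower degree that is at
  most \<open>2 * \<delta> / \<sigma>\<close> at the remaining nodes, because these are at distance
  at least \<open>\<sigma>\<close> from it. A coefficient of \<open>p\<close> is assembled from two
  coefficients of the quotient and one value of \<open>p\<close>, at a cost of 2 + 2 + 1; hence the
  factor 5 for each degree.\<close>

lemma norm_coeff_le_of_separated: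
  fixes p :: "complex poly"
  assumes "degree p \<le> M" "T \<subseteq> {0..1}" "card T = Suc M" "separated \<sigma> T" "0 < \<sigma>" "\<sigma> \<le> 1"
    and "\<And>t. t \<in> T \<Longrightarrow> norm (poly p (of_real t)) \<le> \<delta>"
  shows "norm (coeff p j) \<le> 5 ^ M * \<delta> / \<sigma> ^ M"
  using assms
proof (induction M arbitrary: p T \<delta> j)
  case 0
  then obtain t where t: "T = {t}" by (metis card_1_singletonE One_nat_def)
  obtain c where c: "p = [:c:]" using 0(1) degree_eq_zeroE by blast
  have "norm c \<le> \<delta>" using 0(7)[of t] t c by simp
  then show ?case using order_trans[OF norm_ge_zero, of c \<delta>] by (simp add: c coeff_pCons split: nat.split)
next
  case (Suc M)
  have "finite T" using Suc.prems(3) card_ge_0_finite[of T] by simp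
  have "T \<noteq> {}" using Suc.prems(3) by auto
  then obtain t0 where t0: "t0 \<in> T" by blast
  then have t01: "0 \<le> t0" "t0 \<le> 1" using Suc.prems(2) by auto
  define q where "q = synthetic_div p (of_real t0)"
  let ?X = "5 ^ M * (2 * \<delta> / \<sigma>) / \<sigma> ^ M"
  have p: "p = [:- of_real t0, 1:] * q + [:poly p (of_real t0):]"
    using synthetic_div_correct'[of "of_real t0" p] by (simp add: q_def)
  have \<delta>: "0 \<le> \<delta>" using Suc.prems(7)[OF t0] norm_ge_zero order_trans by blast
  have IH: "norm (coeff q j) \<le> ?X" for j
  proof (rule Suc.IH)
    show "degree q \<le> M" using Suc.prems(1) by (simp add: q_def degree_synthetic_div)
    show "T - {t0} \<subseteq> {0..1}" using Suc.prems(2) by auto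
    show "card (T - {t0}) = Suc M" using Suc.prems(3) t0 \<open>finite T\<close> by simp
    show "separated \<sigma> (T - {t0})" using Suc.prems(4) by (auto simp: separated_def)
    fix t assume t: "t \<in> T - {t0}"
    have sep: "\<sigma> \<le> \<bar>t - t0\<bar>" using Suc.prems(4) t t0 by (auto simp: separated_def)
    have "poly p (of_real t) = (of_real t - of_real t0) * poly q (of_real t) + poly p (of_real t0)"
      by (subst p) (simp add: algebra_simps)
    then have "of_real (t - t0) * poly q (of_real t) = poly p (of_real t) - poly p (of_real t0)"
      by (simp add: algebra_simps)
    then have "\<bar>t - t0\<bar> * norm (poly q (of_real t)) = norm (poly p (of_real t) - poly p (of_real t0))"
      by (metis norm_mult norm_of_real)
    also have "\<dots> \<le> \<delta> + \<delta>"
      using t t0 Suc.prems(7) by (intro order_trans[OF norm_triangle_ineq4] add_mono) auto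
    finally have "\<sigma> * norm (poly q (of_real t)) \<le> 2 * \<delta>"
      using mult_right_mono[OF sep norm_ge_zero[of "poly q (of_real t)"]] by linarith
    then show "norm (poly q (of_real t)) \<le> 2 * \<delta> / \<sigma>"
      using Suc.prems(5) by (simp add: field_simps)
  qed (use Suc.prems in auto)
  have X0: "0 \<le> ?X" using norm_ge_zero IH order_trans by blast
  have "coeff p j = - of_real t0 * coeff q j + (case j of 0 \<Rightarrow> 0 | Suc i \<Rightarrow> coeff q i)
      + (case j of 0 \<Rightarrow> poly p (of_real t0) | Suc i \<Rightarrow> 0)"
    by (subst p) (simp add: coeff_pCons split: nat.split)
  also have "norm \<dots> \<le> norm (- of_real t0 * coeff q j) + norm (case j of 0 \<Rightarrow> 0 | Suc i \<Rightarrow> coeff q i)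
      + norm (case j of 0 \<Rightarrow> poly p (of_real t0) | Suc i \<Rightarrow> 0)"
    by (rule norm_triangle_le[OF add_right_mono[OF norm_triangle_ineq]])
  also have "\<dots> \<le> ?X + ?X + \<delta>"
  proof (intro add_mono)
    have "norm (- of_real t0 * coeff q j) \<le> 1 * ?X"
      unfolding norm_mult using t01 IH[of j] by (intro mult_mono) auto
    then show "norm (- of_real t0 * coeff q j) \<le> ?X" by simp
    show "norm (case j of 0 \<Rightarrow> 0 | Suc i \<Rightarrow> coeff q i) \<le> ?X"
      using IH X0 by (cases j) auto
    show "norm (case j of 0 \<Rightarrow> poly p (of_real t0) | Suc i \<Rightarrow> 0) \<le> \<delta>"
      using Suc.prems(7)[OF t0] \<delta> by (cases j) auto
  qed
  also have "\<dots> \<le> 5 ^ Suc M * \<delta> / \<sigma> ^ Suc M"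
  proof -
    have "\<sigma> ^ Suc M \<le> 5 ^ M"
      using power_le_one[of \<sigma> "Suc M"] one_le_power[of "5::real" M] Suc.prems(5,6) by linarith
    from mult_left_mono[OF this \<delta>] have "\<delta> * \<sigma> ^ Suc M \<le> 5 ^ M * \<delta>" by (metis mult.commute)
    moreover have "5 ^ Suc M * \<delta> = 5 * (5 ^ M * \<delta>)" by simp
    ultimately have "4 * (5 ^ M * \<delta>) + \<delta> * \<sigma> ^ Suc M \<le> 5 ^ Suc M * \<delta>" by linarith
    then have "(4 * (5 ^ M * \<delta>) + \<delta> * \<sigma> ^ Suc M) / \<sigma> ^ Suc M \<le> 5 ^ Suc M * \<delta> / \<sigma> ^ Suc M"
      using Suc.prems(5) by (intro divide_right_mono) auto
    moreover have "(4 * (5 ^ M * \<delta>) + \<delta> * \<sigma> ^ Suc M) / \<sigma> ^ Suc M = ?X + ?X + \<delta>"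
      using Suc.prems(5) by (simp add: field_simps)
    ultimately show ?thesis by simp
  qed
  finally show ?case .
qed

text \<open>A separated subset of the sublevel set has at most \<open>M\<close> points, since
  \<open>M + 1\<close> of them would make every coefficient small. If it has the greatest possible
  number of points, every point of the sublevel set is within \<open>\<sigma>\<close> of it.\<close>

lemma sublevel_set_covered:
  fixes p :: "complex poly"
  assumes "degree p \<le> M" "0 < \<sigma>" "\<sigma> \<le> 1" "5 ^ M * \<delta> / \<sigma> ^ M < norm (coeff p j)"
  obtains A where "finite A" "card A \<le> M" 
    "{t\<in>{0..1}. norm (poly p (of_real t)) \<le> \<delta>} \<subseteq> (\<Union>a\<in>A. {a - \<sigma>..a + \<sigma>})"
proof -
  let ?S = "{t\<in>{0..1}. norm (poly p (of_real t)) \<le> \<delta>}"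
  let ?P = "\<lambda>A. finite A \<and> A \<subseteq> ?S \<and> separated \<sigma> A"
  have card: "card A < Suc M" if "?P A" for A
  proof (rule ccontr)
    assume "\<not> card A < Suc M"
    then obtain T where T: "T \<subseteq> A" "card T = Suc M"
      by (meson not_less obtain_subset_with_card_n)
    have "norm (coeff p j) \<le> 5 ^ M * \<delta> / \<sigma> ^ M"
      by (rule norm_coeff_le_of_separated[OF assms(1) _ T(2) _ assms(2,3)])
        (use T(1) that in \<open>auto simp: separated_def subset_iff\<close>)
    with assms(4) show False by simp
  qed
  have "?P {}" by (simp add: separated_def)
  moreover have "\<forall>A. ?P A \<longrightarrow> card A < Suc M" using card by blast
  ultimately have "\<exists>A. ?P A \<and> (\<forall>B. ?P B \<longrightarrow> card B \<le> card A)"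
    by (rule Lattices_Big.ex_has_greatest_nat[of ?P])
  then obtain A where A: "?P A" "\<And>B. ?P B \<Longrightarrow> card B \<le> card A" by blast
  have "t \<in> (\<Union>a\<in>A. {a - \<sigma>..a + \<sigma>})" if t: "t \<in> ?S" for t
  proof (rule ccontr)
    assume "t \<notin> (\<Union>a\<in>A. {a - \<sigma>..a + \<sigma>})"
    then have far: "\<sigma> < \<bar>a - t\<bar>" if "a \<in> A" for a using that by (force simp: abs_if)
    have "t \<notin> A" using far[of t] assms(2) by auto
    moreover have "?P (insert t A)"
      using A(1) t far by (auto simp: separated_def abs_minus_commute less_imp_le)
    ultimately show False using A(2)[of "insert t A"] A(1) by simp
  qed
  then show thesis using A card[OF A(1)] by (intro that[of A]) auto
qed

text \<open>The bad parameters for \<open>k\<close> lie in at most \<open>M\<close> intervals of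
  length \<open>2 * \<sigma> k\<close>. With total length below 1 these cannot exhaust the unit
  interval.\<close>

lemma ex_common_large_value:
  fixes p :: "'k \<Rightarrow> complex poly"
  assumes "finite K" "\<And>k. k \<in> K \<Longrightarrow> degree (p k) \<le> M"
    and \<sigma>: "\<And>k. k \<in> K \<Longrightarrow> 0 < \<sigma> k \<and> \<sigma> k \<le> 1"
    and c: "\<And>k. k \<in> K \<Longrightarrow> \<exists>j. 5 ^ M * \<delta> k / \<sigma> k ^ M < norm (coeff (p k) j)"
    and sum: "(\<Sum>k\<in>K. 2 * real M * \<sigma> k) < 1"
  obtains t where "t \<in> {0..1}" "\<And>k. k \<in> K \<Longrightarrow> \<delta> k < norm (poly (p k) (of_real t))"
proof -
  have "\<exists>A. finite A \<and> card A \<le> M \<and> {t\<in>{0..1}. norm (poly (p k) (of_real t)) \<le> \<delta> k} \<subseteq> (\<Union>a\<in>A. {a - \<sigma> k..a + \<sigma> k})"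
    if "k \<in> K" for k
  proof -
    note k = that
    from c[OF k] obtain j where j: "5 ^ M * \<delta> k / \<sigma> k ^ M < norm (coeff (p k) j)" by blast
    obtain A where "finite A" "card A \<le> M"
      "{t\<in>{0..1}. norm (poly (p k) (of_real t)) \<le> \<delta> k} \<subseteq> (\<Union>a\<in>A. {a - \<sigma> k..a + \<sigma> k})"
      by (rule sublevel_set_covered[OF assms(2)[OF k] _ _ j]) (use \<sigma>[OF k] in auto)
    then show ?thesis by blast
  qed
  then have "\<forall>k\<in>K. \<exists>A. finite A \<and> card A \<le> M \<and>
      {t\<in>{0..1}. norm (poly (p k) (of_real t)) \<le> \<delta> k} \<subseteq> (\<Union>a\<in>A. {a - \<sigma> k..a + \<sigma> k})" by blast
  from bchoice[OF this] obtain A where A: "\<And>k. k \<in> K \<Longrightarrow> finite (A k) \<and> card (A k) \<le> M \<and>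
      {t\<in>{0..1}. norm (poly (p k) (of_real t)) \<le> \<delta> k} \<subseteq> (\<Union>a\<in>A k. {a - \<sigma> k..a + \<sigma> k})" by blast
  let ?U = "\<Union>k\<in>K. \<Union>a\<in>A k. {a - \<sigma> k..a + \<sigma> k}"
  have "measure lborel ?U \<le> (\<Sum>k\<in>K. measure lborel (\<Union>a\<in>A k. {a - \<sigma> k..a + \<sigma> k}))"
    by (rule measure_UNION_le) (use A assms in auto)
  also have "\<dots> \<le> (\<Sum>k\<in>K. 2 * real M * \<sigma> k)"
  proof (rule sum_mono)
    fix k assume k: "k \<in> K"
    have "measure lborel (\<Union>a\<in>A k. {a - \<sigma> k..a + \<sigma> k}) \<le> (\<Sum>a\<in>A k. measure lborel {a - \<sigma> k..a + \<sigma> k})"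
      by (rule measure_UNION_le) (use A k in auto)
    also have "\<dots> = real (card (A k)) * (2 * \<sigma> k)" using \<sigma>[OF k] by simp
    also have "\<dots> \<le> real M * (2 * \<sigma> k)" using A[OF k] \<sigma>[OF k] by (intro mult_right_mono) auto
    finally show "measure lborel (\<Union>a\<in>A k. {a - \<sigma> k..a + \<sigma> k}) \<le> 2 * real M * \<sigma> k" by simp
  qed
  also note sum
  finally have U: "measure lborel ?U < 1" .
  have "\<not> {0..1} \<subseteq> ?U"
  proof
    assume "{0..1} \<subseteq> ?U"
    then have "measure lborel {0..1::real} \<le> measure lborel ?U"
    proof (rule measure_mono_fmeasurable)
      have "compact ?U" using A assms(1) by (intro compact_UN) auto
      then show "?U \<in> fmeasurable lborel" by (rule fmeasurable_compact)
    qed simp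
    with U show False by simp
  qed
  then obtain t where t: "t \<in> {0..1}" "t \<notin> ?U" by blast
  have "\<delta> k < norm (poly (p k) (of_real t))" if "k \<in> K" for k
    using A[OF that] t that by (force simp: not_less)
  with t that show thesis by blast
qed

section \<open>Translation of symbols and the size of their coefficients\<close>

lemma mi_le_order: "\<alpha> i \<le> mi_order (\<alpha> :: 'n::finite \<Rightarrow> nat)"
  unfolding mi_order_def by (rule member_le_sum) auto

abbreviation coeff_norm :: "nat \<Rightarrow> (('n::finite \<Rightarrow> nat) \<Rightarrow> complex) \<Rightarrow> real" where
  "coeff_norm m a \<equiv> \<Sum>\<alpha>\<in>mi_upto m. norm (a \<alpha>)"

text \<open>The number \<open>\<partial>^\<beta> P(\<xi>) / \<beta>!\<close>, given by binomials.
  The truncated subtraction in the exponent is harmless, as the binomial is 0 when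
  \<open>\<beta> i\<close> exceeds \<open>\<alpha> i\<close>.\<close>

definition taylor_coeff :: "nat \<Rightarrow> (('n \<Rightarrow> nat) \<Rightarrow> complex) \<Rightarrow> real^'n::finite \<Rightarrow> ('n \<Rightarrow> nat) \<Rightarrow> complex" where
  "taylor_coeff m a \<xi> \<beta> = (\<Sum>\<alpha>\<in>mi_upto m. a \<alpha> * (\<Prod>i\<in>UNIV. of_nat (\<alpha> i choose \<beta> i) * of_real (\<xi> $ i) ^ (\<alpha> i - \<beta> i)))"

lemma symbol_add:
  fixes \<xi> \<eta> :: "real^'n::finite"
  shows "symbol m a (\<xi> + \<eta>) = symbol m (taylor_coeff m a \<xi>) \<eta>"
proof -
  let ?c = "\<lambda>\<alpha> \<beta>. \<Prod>i\<in>UNIV. complex_of_nat (\<alpha> i choose \<beta> i) * of_real (\<xi> $ i) ^ (\<alpha> i - \<beta> i)"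
  have "mi_power (\<xi> + \<eta>) \<alpha> = (\<Sum>\<beta>\<in>mi_upto m. ?c \<alpha> \<beta> * mi_power \<eta> \<beta>)" if \<alpha>: "\<alpha> \<in> mi_upto m" for \<alpha>
  proof -
    have "mi_power (\<xi> + \<eta>) \<alpha> =
        (\<Prod>i\<in>UNIV. \<Sum>j\<le>\<alpha> i. of_nat (\<alpha> i choose j) * of_real (\<xi> $ i) ^ (\<alpha> i - j) * of_real (\<eta> $ i) ^ j)"
      unfolding mi_power_def vector_add_component of_real_add add.commute[of "complex_of_real (\<xi> $ _)"] binomial_ring
      by (simp add: mult_ac)
    also have "\<dots> = (\<Sum>\<beta>\<in>PiE UNIV (\<lambda>i. {..\<alpha> i}). ?c \<alpha> \<beta> * mi_power \<eta> \<beta>)"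
      by (simp add: prod_sum_PiE mi_power_def prod.distrib)
    also have "\<dots> = (\<Sum>\<beta>\<in>mi_upto m. ?c \<alpha> \<beta> * mi_power \<eta> \<beta>)"
    proof (rule sum.mono_neutral_left[OF finite_mi_upto])
      show "PiE UNIV (\<lambda>i. {..\<alpha> i}) \<subseteq> mi_upto m"
      proof
        fix \<beta> assume "\<beta> \<in> PiE UNIV (\<lambda>i. {..\<alpha> i})"
        then have "mi_order \<beta> \<le> mi_order \<alpha>" unfolding mi_order_def by (intro sum_mono) auto
        then show "\<beta> \<in> mi_upto m" using \<alpha> by (simp add: mi_upto_def)
      qed
      show "\<forall>\<beta>\<in>mi_upto m - PiE UNIV (\<lambda>i. {..\<alpha> i}). ?c \<alpha> \<beta> * mi_power \<eta> \<beta> = 0"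
      proof
        fix \<beta> assume "\<beta> \<in> mi_upto m - PiE UNIV (\<lambda>i. {..\<alpha> i})"
        then have "\<exists>i. \<not> \<beta> i \<le> \<alpha> i" by (auto simp: PiE_UNIV_domain)
        then obtain i where "\<alpha> i < \<beta> i" by (auto simp: not_le)
        then have "?c \<alpha> \<beta> = 0" by (intro prod_zero bexI[of _ i]) (auto simp: binomial_eq_0)
        then show "?c \<alpha> \<beta> * mi_power \<eta> \<beta> = 0" by simp
      qed
    qed
    finally show ?thesis .
  qed
  then have "symbol m a (\<xi> + \<eta>) = (\<Sum>\<alpha>\<in>mi_upto m. \<Sum>\<beta>\<in>mi_upto m. a \<alpha> * (?c \<alpha> \<beta> * mi_power \<eta> \<beta>))"
    unfolding symbol_def by (simp add: sum_distrib_left)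
  also have "\<dots> = symbol m (taylor_coeff m a \<xi>) \<eta>"
    by (subst sum.swap) (simp add: symbol_def taylor_coeff_def sum_distrib_right mult.assoc)
  finally show ?thesis .
qed

lemma norm_taylor_coeff_le:
  fixes \<xi> :: "real^'n::finite"
  assumes X: "1 \<le> X" "\<And>i. \<bar>\<xi> $ i\<bar> \<le> X"
  shows "norm (taylor_coeff m a \<xi> \<beta>) \<le> (2 * X) ^ m * coeff_norm m a"
proof -
  have "norm (taylor_coeff m a \<xi> \<beta>) \<le> (\<Sum>\<alpha>\<in>mi_upto m. norm (a \<alpha>) * (2 * X) ^ m)"
    unfolding taylor_coeff_def
  proof (rule sum_norm_le)
    fix \<alpha> :: "'n \<Rightarrow> nat" assume \<alpha>: "\<alpha> \<in> mi_upto m"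
    have "norm (\<Prod>i\<in>UNIV. complex_of_nat (\<alpha> i choose \<beta> i) * of_real (\<xi> $ i) ^ (\<alpha> i - \<beta> i)) \<le> (\<Prod>i\<in>UNIV. (2 * X) ^ \<alpha> i)"
      unfolding prod_norm[symmetric]
    proof (intro prod_mono conjI)
      fix i
      have "real (\<alpha> i choose \<beta> i) \<le> 2 ^ \<alpha> i"
        using binomial_le_pow2[of "\<alpha> i" "\<beta> i"] by (metis of_nat_le_iff of_nat_numeral of_nat_power)
      moreover have "\<bar>\<xi> $ i\<bar> ^ (\<alpha> i - \<beta> i) \<le> X ^ (\<alpha> i - \<beta> i)" using X by (intro power_mono) auto
      moreover have "X ^ (\<alpha> i - \<beta> i) \<le> X ^ \<alpha> i" using X by (intro power_increasing) auto
      ultimately have "real (\<alpha> i choose \<beta> i) * \<bar>\<xi> $ i\<bar> ^ (\<alpha> i - \<beta> i) \<le> 2 ^ \<alpha> i * X ^ \<alpha> i"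
        by (intro mult_mono) auto
      then show "norm (complex_of_nat (\<alpha> i choose \<beta> i) * of_real (\<xi> $ i) ^ (\<alpha> i - \<beta> i)) \<le> (2 * X) ^ \<alpha> i"
        by (simp add: norm_mult norm_power power_mult_distrib)
    qed simp
    also have "\<dots> = (2 * X) ^ mi_order \<alpha>" by (simp add: mi_order_def power_sum)
    also have "\<dots> \<le> (2 * X) ^ m" using \<alpha> X by (intro power_increasing) (auto simp: mi_upto_def)
    finally show "norm (a \<alpha> * (\<Prod>i\<in>UNIV. complex_of_nat (\<alpha> i choose \<beta> i) * of_real (\<xi> $ i) ^ (\<alpha> i - \<beta> i)))
        \<le> norm (a \<alpha>) * (2 * X) ^ m"
      unfolding norm_mult by (intro mult_left_mono) auto
  qed
  then show ?thesis by (simp add: sum_distrib_right mult.commute)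
qed

text \<open>
  Kronecker's substitution \<open>\<xi>\<^sub>i = t\<^bsup>d i\<^esup>\<close>, with powers of \<open>m + 1\<close> as \<open>d i\<close>, turns a polynomial of order
  at most \<open>m\<close> into one in a single variable with the same coefficients.
\<close>

lemma ex_kronecker_weights:
  "\<exists>d :: 'n::finite \<Rightarrow> nat. inj_on (\<lambda>\<beta>. \<Sum>i\<in>UNIV. \<beta> i * d i) (mi_upto m)"
proof -
  have "\<exists>d :: 'n \<Rightarrow> nat. \<forall>\<beta> \<gamma>. (\<forall>i. \<beta> i \<le> m \<and> \<gamma> i \<le> m) \<longrightarrow>
      (\<Sum>i\<in>I. \<beta> i * d i) = (\<Sum>i\<in>I. \<gamma> i * d i) \<longrightarrow> (\<forall>i\<in>I. \<beta> i = \<gamma> i)" if "finite I" for I :: "'n set"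
    using that
  proof (induction I)
    case (insert x I)
    then obtain d :: "'n \<Rightarrow> nat" where d: "\<And>\<beta> \<gamma>. (\<forall>i. \<beta> i \<le> m \<and> \<gamma> i \<le> m) \<Longrightarrow>
      (\<Sum>i\<in>I. \<beta> i * d i) = (\<Sum>i\<in>I. \<gamma> i * d i) \<Longrightarrow> \<forall>i\<in>I. \<beta> i = \<gamma> i" by blast
    define e where "e i = (if i = x then 1 else Suc m * d i)" for i
    have sum: "(\<Sum>i\<in>insert x I. \<beta> i * e i) = \<beta> x + Suc m * (\<Sum>i\<in>I. \<beta> i * d i)" for \<beta> :: "'n \<Rightarrow> nat"
    proof -
      have "(\<Sum>i\<in>I. \<beta> i * e i) = (\<Sum>i\<in>I. Suc m * (\<beta> i * d i))"
        using insert.hyps(2) by (intro sum.cong) (auto simp: e_def algebra_simps)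
      then show ?thesis using insert.hyps by (simp add: e_def sum_distrib_left)
    qed
    show ?case
    proof (intro exI[of _ e] allI impI)
      fix \<beta> \<gamma> :: "'n \<Rightarrow> nat" assume le: "\<forall>i. \<beta> i \<le> m \<and> \<gamma> i \<le> m"
        and eq: "(\<Sum>i\<in>insert x I. \<beta> i * e i) = (\<Sum>i\<in>insert x I. \<gamma> i * e i)"
      have eq': "\<beta> x + Suc m * (\<Sum>i\<in>I. \<beta> i * d i) = \<gamma> x + Suc m * (\<Sum>i\<in>I. \<gamma> i * d i)"
        using eq unfolding sum .
      have lt: "\<beta> x < Suc m" "\<gamma> x < Suc m" using le by (auto simp: less_Suc_eq_le)
      \<comment> \<open>Reduction modulo \<open>m + 1\<close> reads off the digit belonging to
        \<open>x\<close>, whose weight is 1.\<close>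
      have "\<beta> x = \<gamma> x" using arg_cong[OF eq', of "\<lambda>n. n mod Suc m"] lt by (simp del: mult_Suc)
      moreover from this have "(\<Sum>i\<in>I. \<beta> i * d i) = (\<Sum>i\<in>I. \<gamma> i * d i)"
        using eq' by (simp del: mult_Suc)
      ultimately show "\<forall>i\<in>insert x I. \<beta> i = \<gamma> i" using d[OF le] by blast
    qed
  qed simp
  from this[OF finite, of UNIV] obtain d :: "'n \<Rightarrow> nat" where
    d: "\<And>\<beta> \<gamma>. (\<forall>i. \<beta> i \<le> m \<and> \<gamma> i \<le> m) \<Longrightarrow>
      (\<Sum>i\<in>UNIV. \<beta> i * d i) = (\<Sum>i\<in>UNIV. \<gamma> i * d i) \<Longrightarrow> \<forall>i. \<beta> i = \<gamma> i" by auto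
  have "inj_on (\<lambda>\<beta>. \<Sum>i\<in>UNIV. \<beta> i * d i) (mi_upto m)"
  proof (rule inj_onI)
    fix \<beta> \<gamma> assume "\<beta> \<in> mi_upto m" "\<gamma> \<in> mi_upto m"
      and eq: "(\<Sum>i\<in>UNIV. \<beta> i * d i) = (\<Sum>i\<in>UNIV. \<gamma> i * d i)"
    then have "\<forall>i. \<beta> i \<le> m \<and> \<gamma> i \<le> m" using mi_le_order order_trans unfolding mi_upto_def by blast
    from d[OF this eq] show "\<beta> = \<gamma>" by auto
  qed
  then show ?thesis by blast
qed

definition kron :: "('n \<Rightarrow> nat) \<Rightarrow> nat \<Rightarrow> (('n::finite \<Rightarrow> nat) \<Rightarrow> complex) \<Rightarrow> complex poly" where
  "kron d m c = (\<Sum>\<beta>\<in>mi_upto m. monom (c \<beta>) (\<Sum>i\<in>UNIV. \<beta> i * d i))"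

lemma poly_kron: "poly (kron d m c) (of_real t) = symbol m c (\<chi> i. t ^ d i)"
  by (simp add: kron_def symbol_def poly_sum poly_monom mi_power_def power_sum power_mult mult.commute[of _ "d _"])

lemma coeff_kron:
  assumes "inj_on (\<lambda>\<beta>. \<Sum>i\<in>UNIV. \<beta> i * d i) (mi_upto m)" "\<beta> \<in> mi_upto m"
  shows "coeff (kron d m c) (\<Sum>i\<in>UNIV. \<beta> i * d i) = c \<beta>"
proof -
  have "coeff (kron d m c) (\<Sum>i\<in>UNIV. \<beta> i * d i) = (\<Sum>\<gamma>\<in>mi_upto m. if \<gamma> = \<beta> then c \<gamma> else 0)"
    unfolding kron_def coeff_sum coeff_monom using assms by (intro sum.cong) (auto dest: inj_onD)
  then show ?thesis using assms(2) by (simp add: finite_mi_upto)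
qed

lemma degree_kron: "degree (kron d m c) \<le> m * (\<Sum>i\<in>UNIV. d i)"
  unfolding kron_def
proof (rule degree_sum_le[OF finite_mi_upto])
  fix \<beta> :: "'a \<Rightarrow> nat" assume "\<beta> \<in> mi_upto m"
  then have "\<beta> i \<le> m" for i using mi_le_order[of \<beta> i] by (simp add: mi_upto_def)
  then have "(\<Sum>i\<in>UNIV. \<beta> i * d i) \<le> m * (\<Sum>i\<in>UNIV. d i)"
    unfolding sum_distrib_left by (intro sum_mono) auto
  with degree_monom_le show "degree (monom (c \<beta>) (\<Sum>i\<in>UNIV. \<beta> i * d i)) \<le> m * (\<Sum>i\<in>UNIV. d i)"
    using order_trans by blast
qed

text \<open>After Kronecker's substitution the two polynomials in one variable agree at all real
  points, hence coincide, and the substitution has merged no coefficients.\<close>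

lemma symbol_coeff_unique:
  fixes a b :: "('n::finite \<Rightarrow> nat) \<Rightarrow> complex"
  assumes "\<And>\<xi>. symbol m a \<xi> = symbol m b \<xi>" "\<alpha> \<in> mi_upto m"
  shows "a \<alpha> = b \<alpha>"
proof -
  obtain d :: "'n \<Rightarrow> nat" where d: "inj_on (\<lambda>\<beta>. \<Sum>i\<in>UNIV. \<beta> i * d i) (mi_upto m)"
    using ex_kronecker_weights by blast
  let ?p = "kron d m a - kron d m b"
  have "range complex_of_real \<subseteq> {z. poly ?p z = 0}" by (auto simp: poly_kron assms(1))
  moreover have "infinite (range complex_of_real)"
    using finite_imageD[of complex_of_real UNIV] infinite_UNIV_char_0 inj_of_real by blast
  ultimately have "?p = 0" using poly_roots_finite finite_subset by blast
  then show ?thesis using coeff_kron[OF d assms(2)] by (metis eq_iff_diff_eq_0)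
qed

text \<open>Translating back by \<open>- \<xi>\<close> recovers the original coefficients, so the
  upper bound for Taylor coefficients also yields a lower one.\<close>

lemma sum_coeff_le_taylor:
  fixes \<xi> :: "real^'n::finite"
  assumes X: "1 \<le> X" "\<And>i. \<bar>\<xi> $ i\<bar> \<le> X"
  shows "coeff_norm m a \<le> real (card (mi_upto m :: ('n \<Rightarrow> nat) set)) *
    ((2 * X) ^ m * coeff_norm m (taylor_coeff m a \<xi>))"
proof -
  have "a \<alpha> = taylor_coeff m (taylor_coeff m a \<xi>) (- \<xi>) \<alpha>" if "\<alpha> \<in> mi_upto m" for \<alpha>
  proof (rule symbol_coeff_unique[OF _ that])
    fix \<eta>
    show "symbol m a \<eta> = symbol m (taylor_coeff m (taylor_coeff m a \<xi>) (- \<xi>)) \<eta>"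
      by (simp flip: symbol_add)
  qed
  then have "norm (a \<alpha>) \<le> (2 * X) ^ m * coeff_norm m (taylor_coeff m a \<xi>)"
    if "\<alpha> \<in> mi_upto m" for \<alpha>
    using norm_taylor_coeff_le[of X "- \<xi>" m "taylor_coeff m a \<xi>" \<alpha>] X that by simp
  then show ?thesis using sum_bounded_above[of "mi_upto m" "\<lambda>\<alpha>. norm (a \<alpha>)"] by simp
qed

lemma mi_upto_nonempty: "card (mi_upto m :: ('n::finite \<Rightarrow> nat) set) > 0"
  using finite_mi_upto[of m] by (auto simp: card_gt_0_iff mi_upto_def mi_order_def intro: exI[of _ "\<lambda>_. 0"])

text \<open>One factor \<open>card (mi_upto m)\<close> comes from summing the bound over all
  coefficients, the other from replacing the sum of the Taylor coefficients by the largest of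
  them.\<close>

lemma ex_large_taylor_coeff:
  fixes \<xi> :: "real^'n::finite"
  assumes X: "1 \<le> X" "\<And>i. \<bar>\<xi> $ i\<bar> \<le> X"
  obtains \<beta> where "\<beta> \<in> mi_upto m" "coeff_norm m a \<le>
    (real (card (mi_upto m :: ('n \<Rightarrow> nat) set)))\<^sup>2 * (2 * X) ^ m * norm (taylor_coeff m a \<xi> \<beta>)"
proof -
  let ?n = "\<lambda>\<beta>. norm (taylor_coeff m a \<xi> \<beta>)" and ?S = "mi_upto m :: ('n \<Rightarrow> nat) set"
  have "?S \<noteq> {}" using mi_upto_nonempty[of m, where 'n = 'n] by force
  then have "Max (?n ` ?S) \<in> ?n ` ?S" by (intro Max_in) (auto simp: finite_mi_upto)
  then obtain \<beta> where \<beta>': "\<beta> \<in> ?S" "Max (?n ` ?S) = ?n \<beta>" by auto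
  then have \<beta>: "\<beta> \<in> ?S" "\<And>\<gamma>. \<gamma> \<in> ?S \<Longrightarrow> ?n \<gamma> \<le> ?n \<beta>"
    by (auto simp: finite_mi_upto simp flip: \<beta>'(2))
  have "(\<Sum>\<beta>\<in>?S. ?n \<beta>) \<le> real (card ?S) * ?n \<beta>" using \<beta>(2) by (rule sum_bounded_above)
  then have "real (card ?S) * ((2 * X) ^ m * (\<Sum>\<beta>\<in>?S. ?n \<beta>))
      \<le> real (card ?S) * ((2 * X) ^ m * (real (card ?S) * ?n \<beta>))"
    using X by (intro mult_left_mono) auto
  with sum_coeff_le_taylor[OF X, where m = m and a = a] \<beta>(1) show thesis
    by (intro that[of \<beta>]) (auto simp: power2_eq_square mult_ac)
qed

text \<open>A product, so that the sum of its inverse squares over a box factorizes and is bounded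
  independently of the box.\<close>

definition freq_weight :: "('n::finite \<Rightarrow> int) \<Rightarrow> real" where
  "freq_weight k = (\<Prod>i\<in>UNIV. 1 + of_int \<bar>k i\<bar>)"

lemma freq_weight_ge: "1 + of_int \<bar>k i\<bar> \<le> freq_weight k" "1 \<le> freq_weight k"
proof -
  have *: "1 \<le> (\<Prod>i\<in>A. 1 + of_int \<bar>k i\<bar> :: real)" for A by (rule prod_ge_1) simp
  from *[of UNIV] show "1 \<le> freq_weight k" by (simp add: freq_weight_def)
  have "freq_weight k = (1 + of_int \<bar>k i\<bar>) * (\<Prod>i\<in>UNIV - {i}. 1 + of_int \<bar>k i\<bar>)"
    unfolding freq_weight_def by (rule prod.remove) auto
  with *[of "UNIV - {i}"] mult_left_mono[OF *[of "UNIV - {i}"], of "1 + of_int \<bar>k i\<bar>"]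
  show "1 + of_int \<bar>k i\<bar> \<le> freq_weight k" by simp
qed

text \<open>The correction term makes the induction telescope:
  \<open>1 / (N + 2)^2 \<le> 1 / (N + 1) - 1 / (N + 2)\<close>, and each step adds two such terms.
  Equality holds for \<open>N = 0\<close>.\<close>

lemma sum_inverse_square_le: "(\<Sum>j\<in>{- int N..int N}. 1 / (1 + real_of_int \<bar>j\<bar>)\<^sup>2) \<le> 3 - 2 / (real N + 1)"
proof (induction N)
  case (Suc N)
  have "{- int (Suc N)..int (Suc N)} = insert (int (Suc N)) (insert (- int (Suc N)) {- int N..int N})" by auto
  then have "(\<Sum>j\<in>{- int (Suc N)..int (Suc N)}. 1 / (1 + real_of_int \<bar>j\<bar>)\<^sup>2)
      = 2 / (real N + 2)\<^sup>2 + (\<Sum>j\<in>{- int N..int N}. 1 / (1 + real_of_int \<bar>j\<bar>)\<^sup>2)"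
    by (simp add: add.commute)
  also have "\<dots> \<le> 2 / ((real N + 1) * (real N + 2)) + (3 - 2 / (real N + 1))"
    by (intro add_mono Suc.IH divide_left_mono) (auto simp: power2_eq_square)
  also have "\<dots> = 3 - 2 / (real (Suc N) + 1)" by (simp add: divide_simps) (simp add: algebra_simps)
  finally show ?case .
qed simp

lemma sum_freq_weight_le: "(\<Sum>k\<in>(freq_box N :: ('n::finite \<Rightarrow> int) set). 1 / (freq_weight k)\<^sup>2) \<le> 3 ^ CARD('n)"
proof -
  have "(\<Sum>k\<in>(freq_box N :: ('n \<Rightarrow> int) set). 1 / (freq_weight k)\<^sup>2)
      = (\<Prod>i\<in>(UNIV :: 'n set). \<Sum>j\<in>{- int N..int N}. 1 / (1 + real_of_int \<bar>j\<bar>)\<^sup>2)"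
    by (subst prod_sum_PiE) (auto simp: freq_box_def freq_weight_def prod_dividef prod_power_distrib)
  also have "\<dots> = (\<Sum>j\<in>{- int N..int N}. 1 / (1 + real_of_int \<bar>j\<bar>)\<^sup>2) ^ CARD('n)" by simp
  also have "\<dots> \<le> 3 ^ CARD('n)"
  proof (rule power_mono)
    have "0 \<le> 2 / (real N + 1)" by simp
    with sum_inverse_square_le[of N] show "(\<Sum>j\<in>{- int N..int N}. 1 / (1 + real_of_int \<bar>j\<bar>)\<^sup>2) \<le> 3" by linarith
  qed (simp add: sum_nonneg)
  finally show ?thesis .
qed

text \<open>\<open>C\<close> and \<open>q\<close> are fixed before the number of frequencies. With
  \<open>\<theta>_i = t^(d i)\<close> the symbol near each lattice point becomes a polynomial in
  \<open>t\<close> that has a coefficient comparable to \<open>coeff_norm m a\<close> up to a power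
  of the weight, and the exceptional length granted to \<open>k\<close> is proportional to the
  inverse square of its weight.\<close>

lemma small_divisors:
  "\<exists>C>0. \<exists>q. \<forall>(a :: ('n::finite \<Rightarrow> nat) \<Rightarrow> complex) N \<omega>. 0 < \<omega> \<and> \<omega> \<le> 1 \<and> 0 < coeff_norm m a \<longrightarrow>
    (\<exists>\<theta> :: real^'n. (\<forall>i. \<bar>\<theta> $ i\<bar> \<le> 1) \<and> (\<forall>k\<in>freq_box N.
      C * coeff_norm m a / freq_weight k ^ q < norm (symbol m a (freq \<omega> \<theta> k))))"
proof -
  obtain d :: "'n \<Rightarrow> nat" where d: "inj_on (\<lambda>\<beta>. \<Sum>i\<in>UNIV. \<beta> i * d i) (mi_upto m)"
    using ex_kronecker_weights by blast
  define M where "M = m * (\<Sum>i\<in>UNIV. d i)"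
  \<comment> \<open>The total exceptional length is at most
    \<open>2 * M * \<eta> * 3 ^ CARD('n)\<close>, which equals \<open>M / (2 * (M + 1))\<close> and
    so stays below 1.\<close>
  define \<eta> :: real where "\<eta> = 1 / (4 * (real M + 1) * 3 ^ CARD('n))"
  define C1 where "C1 = (real (card (mi_upto m :: ('n \<Rightarrow> nat) set)))\<^sup>2"
  \<comment> \<open>Obtained by solving the requirement on
    \<open>5 ^ M * \<delta> k / \<sigma> k ^ M\<close> for \<open>\<delta> k\<close>; the 2 in the
    denominator makes the inequality strict.\<close>
  define C where "C = \<eta> ^ M / (2 * 5 ^ M * C1 * 2 ^ m)"
  have \<eta>: "0 < \<eta>" "\<eta> \<le> 1"
  proof -
    show "0 < \<eta>" by (simp add: \<eta>_def)
    have "1 * 1 * 1 \<le> 4 * (real M + 1) * 3 ^ CARD('n)" by (intro mult_mono) auto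
    then show "\<eta> \<le> 1" by (simp add: \<eta>_def)
  qed
  have C1: "C1 > 0" using mi_upto_nonempty[of m, where 'n = 'n] by (simp add: C1_def)
  have C: "C > 0" using \<eta> C1 by (simp add: C_def)
  show ?thesis
  \<comment> \<open>Translating the symbol to the lattice point costs \<open>m\<close> powers of the
    weight, and \<open>\<sigma> k ^ M\<close> costs \<open>2 * M\<close>.\<close>
  proof (intro exI[of _ C] conjI C exI[of _ "m + 2 * M"] allI impI)
    fix a :: "('n \<Rightarrow> nat) \<Rightarrow> complex" and N and \<omega> :: real
    define A where "A = coeff_norm m a"
    assume "0 < \<omega> \<and> \<omega> \<le> 1 \<and> 0 < coeff_norm m a"
    then have \<omega>: "0 < \<omega>" "\<omega> \<le> 1" and A: "A > 0" by (auto simp: A_def)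
    define \<xi> where "\<xi> k = (\<chi> i. \<omega> * of_int (k i))" for k :: "'n \<Rightarrow> int"
    define p where "p k = kron d m (taylor_coeff m a (\<xi> k))" for k
    define \<sigma> where "\<sigma> k = \<eta> / (freq_weight k)\<^sup>2" for k :: "'n \<Rightarrow> int"
    define \<delta> where "\<delta> k = C * A / freq_weight k ^ (m + 2 * M)" for k :: "'n \<Rightarrow> int"
    have w: "freq_weight k \<ge> 1" for k :: "'n \<Rightarrow> int" by (rule freq_weight_ge)
    have w0: "freq_weight k > 0" for k :: "'n \<Rightarrow> int" using w[of k] by linarith
    obtain t where t: "t \<in> {0..1}" "\<And>k. k \<in> freq_box N \<Longrightarrow> \<delta> k < norm (poly (p k) (of_real t))"
    proof (rule ex_common_large_value[of "freq_box N" p M \<sigma> \<delta>])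
      show "finite (freq_box N :: ('n \<Rightarrow> int) set)" by (rule finite_freq_box)
      show "degree (p k) \<le> M" for k unfolding p_def M_def by (rule degree_kron)
      show "0 < \<sigma> k \<and> \<sigma> k \<le> 1" for k
      proof
        show "0 < \<sigma> k" using \<eta>(1) w0[of k] by (simp add: \<sigma>_def)
        have "\<eta> \<le> (freq_weight k)\<^sup>2" using \<eta>(2) one_le_power[OF w[of k], of 2] by linarith
        then show "\<sigma> k \<le> 1" using w0[of k] by (simp add: \<sigma>_def divide_le_eq_1)
      qed
      show "\<exists>j. 5 ^ M * \<delta> k / \<sigma> k ^ M < norm (coeff (p k) j)" for k
      proof -
        have "\<bar>\<xi> k $ i\<bar> \<le> freq_weight k" for i
        proof -
          have "\<bar>\<xi> k $ i\<bar> \<le> 1 * \<bar>of_int (k i)\<bar>"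
            unfolding \<xi>_def using \<omega> by (simp add: abs_mult mult_left_le_one_le)
          also have "\<dots> \<le> freq_weight k" using freq_weight_ge(1)[of k i] by simp
          finally show ?thesis .
        qed
        from ex_large_taylor_coeff[OF w this, where m = m and a = a] obtain \<beta> where \<beta>: "\<beta> \<in> mi_upto m"
          "A \<le> C1 * (2 * freq_weight k) ^ m * norm (taylor_coeff m a (\<xi> k) \<beta>)"
          unfolding A_def C1_def by blast
        let ?w = "freq_weight k"
        have "5 ^ M * \<delta> k / \<sigma> k ^ M = A / (2 * (C1 * (2 * ?w) ^ m))"
          using \<eta> C1 w0[of k]
          by (simp add: \<delta>_def \<sigma>_def C_def power_divide power_mult[symmetric] power_add power_mult_distrib divide_simps)
        also have "\<dots> < A / (C1 * (2 * ?w) ^ m)"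
          using A C1 w0[of k] by (intro divide_strict_left_mono) auto
        also have "\<dots> \<le> norm (taylor_coeff m a (\<xi> k) \<beta>)"
          using \<beta>(2) C1 w0[of k] by (simp add: pos_divide_le_eq mult.commute)
        also have "taylor_coeff m a (\<xi> k) \<beta> = coeff (p k) (\<Sum>i\<in>UNIV. \<beta> i * d i)"
          unfolding p_def by (rule coeff_kron[OF d \<beta>(1), symmetric])
        finally show ?thesis by blast
      qed
      have "(\<Sum>k\<in>freq_box N. 2 * real M * \<sigma> k)
          = 2 * real M * \<eta> * (\<Sum>k\<in>(freq_box N :: ('n \<Rightarrow> int) set). 1 / (freq_weight k)\<^sup>2)"
        by (simp add: \<sigma>_def sum_distrib_left)
      also have "\<dots> \<le> 2 * real M * \<eta> * 3 ^ CARD('n)"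
        using \<eta> by (intro mult_left_mono sum_freq_weight_le) auto
      also have "\<dots> = 2 * real M / (4 * (real M + 1))" by (simp add: \<eta>_def)
      also have "\<dots> < 1" by (simp add: divide_less_eq)
      finally show "(\<Sum>k\<in>freq_box N. 2 * real M * \<sigma> k) < 1" .
    qed blast
    show "\<exists>\<theta> :: real^'n. (\<forall>i. \<bar>\<theta> $ i\<bar> \<le> 1) \<and> (\<forall>k\<in>freq_box N.
      C * coeff_norm m a / freq_weight k ^ (m + 2 * M) < norm (symbol m a (freq \<omega> \<theta> k)))"
    proof (intro exI[of _ "\<chi> i. t ^ d i"] conjI allI ballI)
      show "\<bar>(\<chi> i. t ^ d i) $ i\<bar> \<le> 1" for i using t(1) by (simp add: power_le_one power_abs)
      fix k :: "'n \<Rightarrow> int" assume k: "k \<in> freq_box N"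
      have "poly (p k) (of_real t) = symbol m a (freq \<omega> (\<chi> i. t ^ d i) k)"
        unfolding p_def poly_kron symbol_add[symmetric]
        by (rule arg_cong[of _ _ "symbol m a"]) (simp add: vec_eq_iff \<xi>_def freq_def)
      with t(2)[OF k] show "C * coeff_norm m a / freq_weight k ^ (m + 2 * M)
          < norm (symbol m a (freq \<omega> (\<chi> i. t ^ d i) k))"
        by (simp add: \<delta>_def A_def)
    qed
  qed
qed

text \<open>This direction turns a lower bound for the weight at one point into a lower bound for
  the coefficients; the constant may depend on the point.\<close>

lemma weight2_le_sum_coeff:
  "\<exists>C>0. \<forall>a. weight2 m a \<xi> \<le> C * (coeff_norm m a)\<^sup>2"
proof -
  let ?b = "\<lambda>\<alpha> \<beta>. norm (mi_deriv \<beta> (\<lambda>\<xi>. mi_power \<xi> \<alpha>) \<xi>)"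
  let ?C = "\<lambda>\<beta>. \<Sum>\<alpha>\<in>mi_upto m. ?b \<alpha> \<beta>"
  have "weight2 m a \<xi> \<le> ((\<Sum>\<beta>\<in>mi_upto m. (?C \<beta>)\<^sup>2) + 1) * (coeff_norm m a)\<^sup>2" for a
  proof -
    let ?A = "coeff_norm m a"
    have "norm (mi_deriv \<beta> (symbol m a) \<xi>) \<le> ?C \<beta> * ?A" for \<beta>
    proof -
      have "norm (mi_deriv \<beta> (symbol m a) \<xi>) \<le> (\<Sum>\<alpha>\<in>mi_upto m. ?A * ?b \<alpha> \<beta>)"
        unfolding mi_deriv_symbol
        by (intro sum_norm_le) (auto simp: norm_mult finite_mi_upto intro!: mult_right_mono member_le_sum)
      then show ?thesis by (simp add: sum_distrib_left[symmetric] mult.commute)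
    qed
    then have "weight2 m a \<xi> \<le> (\<Sum>\<beta>\<in>mi_upto m. (?C \<beta> * ?A)\<^sup>2)"
      unfolding weight2_def by (intro sum_mono power_mono) auto
    also have "\<dots> = (\<Sum>\<beta>\<in>mi_upto m. (?C \<beta>)\<^sup>2) * ?A\<^sup>2"
      by (simp only: power_mult_distrib sum_distrib_right[symmetric])
    also have "\<dots> \<le> ((\<Sum>\<beta>\<in>mi_upto m. (?C \<beta>)\<^sup>2) + 1) * ?A\<^sup>2" by (intro mult_right_mono) auto
    finally show ?thesis .
  qed
  moreover have "(\<Sum>\<beta>\<in>mi_upto m. (?C \<beta>)\<^sup>2) + 1 > 0" by (intro add_nonneg_pos sum_nonneg) auto
  ultimately show ?thesis by blast
qed

section \<open>Solving the equation\<close>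

lemma pdo_trig_sum: "pdo m a (trig_sum K c \<xi>) = trig_sum K (\<lambda>k. c k * symbol m a (\<xi> k)) \<xi>"
proof
  fix x
  have "pdo m a (trig_sum K c \<xi>) x = (\<Sum>\<alpha>\<in>mi_upto m. \<Sum>k\<in>K. a \<alpha> * (c k * mi_power (\<xi> k) \<alpha> * cis (\<xi> k \<bullet> x)))"
    by (simp add: pdo_def mi_D_trig_sum trig_sum_def sum_distrib_left)
  also have "\<dots> = trig_sum K (\<lambda>k. c k * symbol m a (\<xi> k)) \<xi> x"
    by (subst sum.swap) (simp add: trig_sum_def symbol_def sum_distrib_left sum_distrib_right mult_ac)
  finally show "pdo m a (trig_sum K c \<xi>) x = trig_sum K (\<lambda>k. c k * symbol m a (\<xi> k)) \<xi> x" .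
qed

lemma box_coeff_bounds:
  assumes "0 < \<omega>" "\<omega> \<le> 1"
  shows "0 \<le> box_coeff \<omega> N k" "box_coeff \<omega> N k \<le> 1"
proof -
  have "0 \<le> \<omega> / (2 * pi) * kernel_coeff N j \<and> \<omega> / (2 * pi) * kernel_coeff N j \<le> 1" for j
  proof
    show "0 \<le> \<omega> / (2 * pi) * kernel_coeff N j"
      using assms by (intro mult_nonneg_nonneg kernel_coeff_bounds) auto
    have "\<omega> / (2 * pi) \<le> 1" using assms pi_ge_two by (simp add: divide_le_eq)
    then have "\<omega> / (2 * pi) * kernel_coeff N j \<le> 1 * 1"
      using assms by (intro mult_mono kernel_coeff_bounds) auto
    then show "\<omega> / (2 * pi) * kernel_coeff N j \<le> 1" by simp
  qed
  then show "0 \<le> box_coeff \<omega> N k" "box_coeff \<omega> N k \<le> 1"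
    unfolding box_coeff_def by (auto intro!: prod_nonneg prod_le_1)
qed

lemma abs_freq_le:
  assumes "0 < \<omega>" "\<omega> \<le> 1" "\<bar>\<theta> $ i\<bar> \<le> 1"
  shows "\<bar>freq \<omega> \<theta> k $ i\<bar> \<le> freq_weight k"
proof -
  have "\<bar>freq \<omega> \<theta> k $ i\<bar> \<le> \<bar>\<omega> * of_int (k i)\<bar> + \<bar>\<theta> $ i\<bar>"
    unfolding freq_def by (simp add: abs_triangle_ineq)
  also have "\<bar>\<omega> * of_int (k i)\<bar> \<le> \<bar>of_int (k i)\<bar>"
    using assms by (simp add: abs_mult mult_left_le_one_le)
  finally show ?thesis using assms(3) freq_weight_ge(1)[of k i] by simp
qed

text \<open>Frequencies are spaced by \<open>\<omega>\<close>, so decay of a Fourier transform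
  becomes decay in \<open>k\<close> only at the cost of powers of \<open>\<omega>\<close>, a
  moderate loss for \<open>\<omega> = \<epsilon>\<close>. The 2 on the right leaves 1 for the unit
  in the weight and 1 for the shift.\<close>

lemma freq_weight_le:
  fixes \<theta> :: "real^'n::finite"
  assumes "0 < \<omega>" "\<omega> \<le> 1" "\<And>i. \<bar>\<theta> $ i\<bar> \<le> 1"
  shows "\<omega> ^ CARD('n) * freq_weight k \<le> (\<Prod>i\<in>UNIV. 2 + \<bar>freq \<omega> \<theta> k $ i\<bar>)"
proof -
  have "\<omega> ^ CARD('n) * freq_weight k = (\<Prod>i\<in>(UNIV::'n set). \<omega> * (1 + of_int \<bar>k i\<bar>))"
    by (simp add: freq_weight_def prod.distrib)
  also have "\<dots> \<le> (\<Prod>i\<in>UNIV. 2 + \<bar>freq \<omega> \<theta> k $ i\<bar>)"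
  proof (intro prod_mono conjI)
    fix i
    have "\<bar>\<omega> * of_int (k i)\<bar> \<le> \<bar>freq \<omega> \<theta> k $ i\<bar> + \<bar>\<theta> $ i\<bar>"
      unfolding freq_def by simp
    then show "\<omega> * (1 + of_int \<bar>k i\<bar>) \<le> 2 + \<bar>freq \<omega> \<theta> k $ i\<bar>"
      using assms(1,2) assms(3)[of i] by (simp add: abs_mult algebra_simps)
  qed (use assms in auto)
  finally show ?thesis .
qed

text \<open>The first clause bounds the derivatives of \<open>u\<close> at the cost of powers of
  \<open>1 / \<omega>\<close> and one factor \<open>1 / coeff_norm m a\<close>; the tolerance
  \<open>\<delta>\<close> is absent from it. The second says that \<open>u\<close> solves the
  equation up to a multiple of \<open>\<delta>\<close> wherever one period cell suffices. The free
  \<open>B\<close> lets moderate bounds be inserted later.\<close>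

definition approx_solution ::
  "(nat \<Rightarrow> real) \<Rightarrow> nat \<Rightarrow> real \<Rightarrow> nat \<Rightarrow> (('n::finite \<Rightarrow> nat) \<Rightarrow> complex) \<Rightarrow> real \<Rightarrow> real \<Rightarrow>
    (real^'n \<Rightarrow> complex) \<Rightarrow> (real^'n \<Rightarrow> complex) \<Rightarrow> bool" where
  "approx_solution C q R m a \<omega> \<delta> H u \<longleftrightarrow>
    (\<forall>is B. (\<forall>S y. norm (partial_derivs (mi_list (\<lambda>i. if i \<in> S then q + length is else 0)) H y) \<le> B) \<longrightarrow>
      (\<forall>x. norm (partial_derivs is u x)
        \<le> C (length is) * B / (coeff_norm m a * \<omega> ^ (CARD('n) * (q + length is))))) \<and>
    (\<forall>is B x. (\<forall>y. norm (partial_derivs is H y) \<le> B) \<longrightarrow> (\<forall>i y. norm (partial_derivs (i # is) H y) \<le> B) \<longrightarrow>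
      norm x + R \<le> pi / \<omega> \<longrightarrow>
      norm (partial_derivs is (pdo m a u) x - partial_derivs is H x) \<le> 4 * real CARD('n) * B * \<delta>)"

text \<open>\<open>C\<close> and \<open>q\<close> come before \<open>\<omega>\<close>,
  \<open>\<delta>\<close> and \<open>H\<close>: the accuracy decides how many frequencies are used,
  but does not enter the bounds on \<open>u\<close>.\<close>

lemma ex_approx_solution:
  "\<exists>C q. \<forall>(a :: ('n::finite \<Rightarrow> nat) \<Rightarrow> complex) \<omega> \<delta> H.
    0 < \<omega> \<and> \<omega> \<le> 1 \<and> 0 < \<delta> \<and> 0 < coeff_norm m a \<and>
    smooth_on UNIV H \<and> (\<forall>x. x \<notin> cball 0 R \<longrightarrow> H x = 0) \<longrightarrow>
    (\<exists>u. smooth_on UNIV u \<and> approx_solution C q R m a \<omega> \<delta> H u)"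
proof -
  obtain C0 :: real and q where C0: "C0 > 0" and sd: "\<And>(a :: ('n::finite \<Rightarrow> nat) \<Rightarrow> complex) N \<omega>.
    0 < \<omega> \<Longrightarrow> \<omega> \<le> 1 \<Longrightarrow> 0 < coeff_norm m a \<Longrightarrow>
    \<exists>\<theta> :: real^'n. (\<forall>i. \<bar>\<theta> $ i\<bar> \<le> 1) \<and> (\<forall>k\<in>freq_box N.
      C0 * coeff_norm m a / freq_weight k ^ q < norm (symbol m a (freq \<omega> \<theta> k)))"
    using small_divisors[of m, where 'n = 'n] by blast
  let ?n = "CARD('n)"
  define V where "V = measure lborel (cball (0 :: real^'n) R)"
  define D where "D s = (2 * 4 ^ s) ^ ?n * V" for s :: nat
  define C where "C l = 3 ^ ?n * D (q + 2 + l) / C0" for l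
  have D0: "D s \<ge> 0" for s by (simp add: D_def V_def)
  show ?thesis
  proof (intro exI[of _ C] exI[of _ "q + 2"] allI impI)
    fix a :: "('n \<Rightarrow> nat) \<Rightarrow> complex" and \<omega> \<delta> :: real and H :: "real^'n \<Rightarrow> complex"
    define A where "A = coeff_norm m a"
    assume "0 < \<omega> \<and> \<omega> \<le> 1 \<and> 0 < \<delta> \<and> 0 < coeff_norm m a \<and>
      smooth_on UNIV H \<and> (\<forall>x. x \<notin> cball 0 R \<longrightarrow> H x = 0)"
    then have \<omega>: "0 < \<omega>" "\<omega> \<le> 1" and \<delta>: "0 < \<delta>" and A: "A > 0"
      and H: "smooth_on UNIV H" "\<And>x. x \<notin> cball 0 R \<Longrightarrow> H x = 0"
      by (auto simp: A_def)
    \<comment> \<open>So large that the second moment of the kernel is at most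
      \<open>\<delta>^2\<close>; both terms of the approximation error are then at most
      \<open>\<delta>\<close>.\<close>
    obtain N where N: "4 / \<omega>\<^sup>2 / (\<delta> * \<delta>) < real N" using reals_Archimedean2 by blast
    have N': "4 / \<omega>\<^sup>2 / (2 * real N + 1) / \<delta> \<le> \<delta>"
    proof -
      have "4 / \<omega>\<^sup>2 / (\<delta> * \<delta>) \<le> 2 * real N + 1" using N by linarith
      then have "4 / \<omega>\<^sup>2 \<le> (2 * real N + 1) * (\<delta> * \<delta>)" using \<delta> by (subst (asm) pos_divide_le_eq) auto
      then have "4 / \<omega>\<^sup>2 / (2 * real N + 1) \<le> \<delta> * \<delta>" by (subst pos_divide_le_eq) (auto simp: mult.commute)
      then show ?thesis using \<delta> by (subst pos_divide_le_eq) auto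
    qed
    let ?K = "freq_box (Suc N) :: ('n \<Rightarrow> int) set"
    from sd[OF \<omega>, of a "Suc N"] A obtain \<theta> :: "real^'n" where \<theta>: "\<And>i. \<bar>\<theta> $ i\<bar> \<le> 1"
      and lower: "\<And>k. k \<in> ?K \<Longrightarrow> C0 * A / freq_weight k ^ q < norm (symbol m a (freq \<omega> \<theta> k))"
      unfolding A_def by blast
    let ?\<xi> = "freq \<omega> \<theta>"
    let ?c = "\<lambda>k. of_real (box_coeff \<omega> (Suc N) k) * ft H (?\<xi> k)"
    define u where "u = trig_sum ?K (\<lambda>k. ?c k / symbol m a (?\<xi> k)) ?\<xi>"
    have w: "freq_weight k \<ge> 1" for k :: "'n \<Rightarrow> int" by (rule freq_weight_ge)
    have w0: "freq_weight k > 0" for k :: "'n \<Rightarrow> int" using w[of k] by linarith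
    have low: "0 < C0 * A / freq_weight k ^ q" for k :: "'n \<Rightarrow> int"
      using C0 A w0[of k] by simp
    have "symbol m a (?\<xi> k) \<noteq> 0" if "k \<in> ?K" for k
      using lower[OF that] low[of k] by auto
    then have pu: "pdo m a u = trig_sum ?K ?c ?\<xi>"
      by (simp add: u_def pdo_trig_sum trig_sum_def fun_eq_iff)
    have bound: "norm (partial_derivs is u x) \<le> C (length is) * B / (A * \<omega> ^ (?n * (q + 2 + length is)))"
      if B: "\<And>S y. norm (partial_derivs (mi_list (\<lambda>i. if i \<in> S then q + 2 + length is else 0)) H y) \<le> B" for "is" B x
    proof -
      \<comment> \<open>The decay asked of the Fourier transform: \<open>q\<close> powers of the
        weight for the small divisor, \<open>length is\<close> for the derivatives of
        \<open>u\<close>, and 2 for summability over the box.\<close>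
      define s where "s = q + 2 + length is"
      have B0: "B \<ge> 0" using B[of "{}" 0] norm_ge_zero order_trans by blast
      have term_le: "norm (?c k / symbol m a (?\<xi> k) * (\<Prod>i\<leftarrow>is. \<i> * of_real (?\<xi> k $ i)))
          \<le> D s * B / (C0 * A * \<omega> ^ (?n * s)) * (1 / (freq_weight k)\<^sup>2)" if k: "k \<in> ?K" for k
      proof -
        let ?w = "freq_weight k"
        have 1: "norm (of_real (box_coeff \<omega> (Suc N) k) :: complex) \<le> 1"
          using box_coeff_bounds[OF \<omega>, of "Suc N" k] by simp
        have "(\<omega> ^ ?n * ?w) ^ s \<le> (\<Prod>i\<in>UNIV. 2 + \<bar>?\<xi> k $ i\<bar>) ^ s"
          using \<omega> w0[of k] by (intro power_mono freq_weight_le \<theta>) auto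
        then have "(\<omega> ^ ?n * ?w) ^ s * norm (ft H (?\<xi> k)) \<le> (\<Prod>i\<in>UNIV. (2 + \<bar>?\<xi> k $ i\<bar>) ^ s) * norm (ft H (?\<xi> k))"
          by (intro mult_right_mono) (simp_all add: prod_power_distrib)
        also have "\<dots> \<le> (2 * 4 ^ s) ^ ?n * (B * V)"
          unfolding V_def by (rule ft_decay) (use H B[folded s_def] in auto)
        also have "\<dots> = D s * B" by (simp add: D_def mult_ac)
        finally have "norm (ft H (?\<xi> k)) \<le> D s * B / (\<omega> ^ ?n * ?w) ^ s"
          using \<omega> w0[of k] by (simp add: pos_le_divide_eq mult.commute)
        then have 2: "norm (ft H (?\<xi> k)) \<le> D s * B / (\<omega> ^ (?n * s) * ?w ^ s)"
          by (simp add: power_mult_distrib power_mult)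
        have "inverse (norm (symbol m a (?\<xi> k))) \<le> inverse (C0 * A / ?w ^ q)"
          using lower[OF k] low[of k] by (intro le_imp_inverse_le) auto
        then have 3: "inverse (norm (symbol m a (?\<xi> k))) \<le> ?w ^ q / (C0 * A)" by simp
        have 4: "norm (\<Prod>i\<leftarrow>is. \<i> * of_real (?\<xi> k $ i)) \<le> ?w ^ length is"
        proof (induction "is")
          case (Cons i "is")
          have "\<bar>?\<xi> k $ i\<bar> * norm (\<Prod>i\<leftarrow>is. \<i> * of_real (?\<xi> k $ i)) \<le> ?w * ?w ^ length is"
            using w0[of k] by (intro mult_mono Cons.IH abs_freq_le \<omega> \<theta>) auto
          then show ?case by (simp add: norm_mult)
        qed simp
        have "norm (?c k / symbol m a (?\<xi> k) * (\<Prod>i\<leftarrow>is. \<i> * of_real (?\<xi> k $ i)))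
            = norm (of_real (box_coeff \<omega> (Suc N) k) :: complex) * norm (ft H (?\<xi> k)) *
              inverse (norm (symbol m a (?\<xi> k))) * norm (\<Prod>i\<leftarrow>is. \<i> * of_real (?\<xi> k $ i))"
          by (simp only: norm_mult norm_divide divide_inverse norm_inverse)
        also have "\<dots> \<le> 1 * (D s * B / (\<omega> ^ (?n * s) * ?w ^ s)) * (?w ^ q / (C0 * A)) * ?w ^ length is"
          using D0 B0 \<omega> w0[of k] C0 A by (intro mult_mono 1 2 3 4) auto
        also have "\<dots> = D s * B / (C0 * A * \<omega> ^ (?n * s)) * (1 / ?w\<^sup>2)"
        proof -
          have "?w ^ s = ?w ^ q * ?w ^ length is * ?w\<^sup>2" by (simp add: s_def power_add power2_eq_square)
          then show ?thesis using w0[of k] by (simp add: divide_simps)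
        qed
        finally show ?thesis .
      qed
      have "norm (partial_derivs is u x) \<le> (\<Sum>k\<in>?K. D s * B / (C0 * A * \<omega> ^ (?n * s)) * (1 / (freq_weight k)\<^sup>2))"
        unfolding u_def partial_derivs_trig_sum trig_sum_def
        by (rule sum_norm_le) (unfold norm_mult[of _ "cis _"] norm_cis mult_1_right, rule term_le)
      also have "\<dots> \<le> D s * B / (C0 * A * \<omega> ^ (?n * s)) * 3 ^ ?n"
        unfolding sum_distrib_left[symmetric]
        using D0 B0 \<omega> C0 A by (intro mult_left_mono sum_freq_weight_le) auto
      also have "\<dots> = C (length is) * B / (A * \<omega> ^ (?n * (q + 2 + length is)))"
        by (simp add: C_def s_def mult_ac)
      finally show ?thesis .
    qed
    have approx: "norm (partial_derivs is (pdo m a u) x - partial_derivs is H x) \<le> 4 * real ?n * B * \<delta>"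
      if B: "\<And>y. norm (partial_derivs is H y) \<le> B" "\<And>i y. norm (partial_derivs (i # is) H y) \<le> B"
        and x: "norm x + R \<le> pi / \<omega>" for "is" B x
    proof -
      have B0: "B \<ge> 0" using B(1) norm_ge_zero order_trans by blast
      have ft: "ft (partial_derivs is H) \<xi> = (\<Prod>i\<leftarrow>is. \<i> * of_real (\<xi> $ i)) * ft H \<xi>" for \<xi>
        by (rule ft_partial_derivs) (use H in auto)
      \<comment> \<open>Approximation commutes with derivatives, since \<open>ft\<close> turns them
        into the very factors that differentiating the sum produces.\<close>
      have "partial_derivs is (pdo m a u)
          = trig_approx \<omega> (Suc N) \<theta> (partial_derivs is H)"
        unfolding pu partial_derivs_trig_sum trig_approx_def ft by (simp add: mult_ac)
      moreover have "norm (trig_approx \<omega> (Suc N) \<theta> (partial_derivs is H) x - partial_derivs is H x)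
          \<le> 2 * B * real ?n * (\<delta> + 4 / \<omega>\<^sup>2 / (2 * real N + 1) / \<delta>)"
        by (rule norm_trig_approx_le[where R = R])
          (use B x \<omega> \<delta> \<theta> in \<open>auto intro!: smooth_on_partial_derivs H(1) partial_derivs_zero_outside[of R H] simp: H(2)\<close>)
      moreover have "\<dots> \<le> 2 * B * real ?n * (\<delta> + \<delta>)"
        using N' B0 by (intro mult_left_mono add_left_mono) auto
      ultimately show ?thesis by (simp add: algebra_simps)
    qed
    have "smooth_on UNIV u" unfolding u_def by (rule smooth_on_trig_sum)
    moreover have "approx_solution C (q + 2) R m a \<omega> \<delta> H u"
      unfolding approx_solution_def using bound approx unfolding A_def by blast
    ultimately show "\<exists>u. smooth_on UNIV u \<and> approx_solution C (q + 2) R m a \<omega> \<delta> H u" by blast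
  qed
qed

text \<open>The inverse of the weight is moderate, so the weight is at least a constant times a
  power of \<epsilon>. Being at most quadratic in the sum of the coefficients, it bounds that sum
  from below.\<close>

lemma invertible_weight_imp_sum_coeff_ge:
  fixes a :: "('n::finite \<Rightarrow> nat) \<Rightarrow> gcomplex"
  assumes "gweight2 m a \<xi> dvd 1"
  shows "\<exists>p. \<forall>\<^sub>F \<epsilon> in at_right 0. \<epsilon> powr p \<le> (\<Sum>\<alpha>\<in>mi_upto m. norm (rep_gcomplex (a \<alpha>) \<epsilon>))"
proof -
  let ?A = "\<lambda>\<epsilon>. \<Sum>\<alpha>\<in>mi_upto m. norm (rep_gcomplex (a \<alpha>) \<epsilon>)"
  let ?W = "\<lambda>\<epsilon>. complex_of_real (weight2 m (\<lambda>\<alpha>. rep_gcomplex (a \<alpha>) \<epsilon>) \<xi>)"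
  from assms obtain b where b: "1 = gweight2 m a \<xi> * b" by (auto elim: dvdE)
  let ?b = "rep_gcomplex b"
  have W: "gc_rel ?W ?W" by (intro gc_rel_weight2 gc_rel_rep)
  have "abs_gcomplex (\<lambda>_. 1) = abs_gcomplex (\<lambda>\<epsilon>. ?W \<epsilon> * ?b \<epsilon>)"
    using b times_gcomplex.abs_eq[OF W gc_rel_rep[of b]]
    by (simp add: gweight2_def abs_rep_gcomplex one_gcomplex_def)
  then have "gc_rel (\<lambda>_. 1) (\<lambda>\<epsilon>. ?W \<epsilon> * ?b \<epsilon>)"
    using Quotient3_rel[OF Quotient3_gcomplex, of "\<lambda>_. 1" "\<lambda>\<epsilon>. ?W \<epsilon> * ?b \<epsilon>"]
      gc_rel_refl[OF moderate_const[of 1]] gc_rel_mult[OF W gc_rel_rep[of b]] by simp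
  then have "negligible_net (\<lambda>\<epsilon>. 1 - ?W \<epsilon> * ?b \<epsilon>)" by (simp add: gc_rel_def)
  then have "(\<lambda>\<epsilon>. 1 - ?W \<epsilon> * ?b \<epsilon>) \<in> O[at_right 0](\<lambda>\<epsilon>. of_real (\<epsilon> powr 1))"
    unfolding negligible_net_def by (meson zero_le_one)
  then obtain C where C: "\<forall>\<^sub>F \<epsilon> in at_right 0. norm (1 - ?W \<epsilon> * ?b \<epsilon>) \<le> C * norm (of_real (\<epsilon> powr 1) :: complex)"
    by (auto elim: landau_o.bigE)
  obtain s where s: "\<forall>\<^sub>F \<epsilon> in at_right 0. norm (?b \<epsilon>) \<le> \<epsilon> powr (- s)"
    using moderate_imp_norm_le_powr[OF moderate_rep[of b]] by blast
  obtain E where E: "E > 0" "\<And>c. weight2 m c \<xi> \<le> E * (coeff_norm m c)\<^sup>2"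
    using weight2_le_sum_coeff by blast
  \<comment> \<open>Here \<open>s\<close> is the exponent of the inverse, the extra 1 absorbs the
    constant \<open>2 * E\<close>, and the half undoes the square of \<open>?A\<close>.\<close>
  have "\<forall>\<^sub>F \<epsilon> in at_right 0. \<epsilon> powr ((s + 1) / 2) \<le> ?A \<epsilon>"
    using C s eventually_at_right_0_in_01 eventually_mult_powr_le[of 0 1 "2 * C", simplified]
      eventually_mult_powr_le[of s "s + 1" "2 * E", simplified]
  proof eventually_elim
    case (elim \<epsilon>)
    have "norm (1 - ?W \<epsilon> * ?b \<epsilon>) \<le> 1 / 2" using elim(1,3,4) by simp
    then have "1 / 2 \<le> norm (?W \<epsilon> * ?b \<epsilon>)"
      using norm_triangle_ineq2[of 1 "1 - ?W \<epsilon> * ?b \<epsilon>"] norm_triangle_ineq4[of 1 "1 - ?W \<epsilon> * ?b \<epsilon>"] by simp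
    also have "\<dots> \<le> E * (?A \<epsilon>)\<^sup>2 * \<epsilon> powr (- s)"
    proof -
      have "0 \<le> weight2 m (\<lambda>\<alpha>. rep_gcomplex (a \<alpha>) \<epsilon>) \<xi>" by (simp add: weight2_def sum_nonneg)
      then show ?thesis unfolding norm_mult using E elim(2) by (intro mult_mono) auto
    qed
    finally have "\<epsilon> powr s \<le> 2 * E * (?A \<epsilon>)\<^sup>2"
      using elim(3) by (simp add: powr_minus field_simps)
    then have "2 * E * \<epsilon> powr (s + 1) \<le> 2 * E * (?A \<epsilon>)\<^sup>2" using elim(5) by linarith
    then have "(\<epsilon> powr ((s + 1) / 2))\<^sup>2 \<le> (?A \<epsilon>)\<^sup>2"
      using E(1) elim(3) by (simp add: power2_eq_square flip: powr_add)
    then show ?case by (rule power2_le_imp_le) (simp add: sum_nonneg)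
  qed
  then show ?thesis by blast
qed

theorem theorem7p7:
  fixes \<Omega> :: "(real^'n::finite) set"
    and m :: nat
    and a :: "('n \<Rightarrow> nat) \<Rightarrow> gcomplex"
  assumes "open \<Omega>"
    and "\<exists>\<xi>\<^sub>0. gweight2 m a \<xi>\<^sub>0 dvd 1"
  shows "\<forall>f\<in>colombeau_c \<Omega>. \<exists>u\<in>colombeau \<Omega>. gPD \<Omega> m a u = f"
proof
  fix f assume "f \<in> colombeau_c \<Omega>"
  then obtain F T where T: "compact T"
    and F: "\<And>\<epsilon>. \<epsilon> \<in> {0<..1} \<Longrightarrow> smooth_on UNIV (F \<epsilon>)" "\<And>\<epsilon> x. x \<notin> T \<Longrightarrow> F \<epsilon> x = 0"
      "\<And>is. \<exists>p. \<forall>\<^sub>F \<epsilon> in at_right 0. \<forall>x. norm (partial_derivs is (F \<epsilon>) x) \<le> \<epsilon> powr (- p)"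
    and FEM: "F \<in> EM \<Omega>" and f: "f = gclass \<Omega> F"
    by (rule compactly_supported_representative[OF assms(1)]) (rule that)
  obtain R where "\<forall>x\<in>T. norm x \<le> R" using compact_imp_bounded[OF T] by (auto simp: bounded_iff)
  then have F0: "F \<epsilon> x = 0" if "x \<notin> cball 0 R" for \<epsilon> x using F(2)[of x \<epsilon>] that by auto
  let ?c = "\<lambda>\<epsilon> \<alpha>. rep_gcomplex (a \<alpha>) \<epsilon>" and ?n = "CARD('n)"
  let ?A = "\<lambda>\<epsilon>. coeff_norm m (?c \<epsilon>)"
  obtain p where p: "\<forall>\<^sub>F \<epsilon> in at_right 0. \<epsilon> powr p \<le> ?A \<epsilon>"
    using assms(2) invertible_weight_imp_sum_coeff_ge by blast
  from ex_approx_solution[of m R, where 'n = 'n] obtain C q where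
    sol: "\<forall>(a :: ('n \<Rightarrow> nat) \<Rightarrow> complex) \<omega> \<delta> H.
      0 < \<omega> \<and> \<omega> \<le> 1 \<and> 0 < \<delta> \<and> 0 < coeff_norm m a \<and>
      smooth_on UNIV H \<and> (\<forall>x. x \<notin> cball 0 R \<longrightarrow> H x = 0) \<longrightarrow>
      (\<exists>u. smooth_on UNIV u \<and> approx_solution C q R m a \<omega> \<delta> H u)"
    by (elim exE)
  \<comment> \<open>Lattice spacing \<open>\<epsilon>\<close> and tolerance
    \<open>\<epsilon> powr (1 / \<epsilon>)\<close>. The latter is eventually below every power, so
    a single choice serves all compact sets, derivatives and orders.\<close>
  let ?sol = "\<lambda>\<epsilon>. approx_solution C q R m (?c \<epsilon>) \<epsilon> (\<epsilon> powr (1 / \<epsilon>)) (F \<epsilon>)"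
  \<comment> \<open>A net must be smooth also at parameters where \<open>?A \<epsilon>\<close>
    vanishes and the construction does not apply. Any smooth function will do there, since
    \<open>p\<close> excludes such parameters for all small \<epsilon>.\<close>
  have "\<forall>\<epsilon>. \<exists>u. smooth_on UNIV u \<and> (0 < \<epsilon> \<and> \<epsilon> \<le> 1 \<and> 0 < ?A \<epsilon> \<longrightarrow> ?sol \<epsilon> u)"
  proof
    fix \<epsilon> :: real
    show "\<exists>u. smooth_on UNIV u \<and> (0 < \<epsilon> \<and> \<epsilon> \<le> 1 \<and> 0 < ?A \<epsilon> \<longrightarrow> ?sol \<epsilon> u)"
    proof (cases "0 < \<epsilon> \<and> \<epsilon> \<le> 1 \<and> 0 < ?A \<epsilon>")
      case True
      then have "\<exists>u. smooth_on UNIV u \<and> ?sol \<epsilon> u"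
        using F(1)[of \<epsilon>] F0 by (intro sol[rule_format]) auto
      then show ?thesis by blast
    qed (use smooth_on_const in blast)
  qed
  from choice[OF this] obtain u where u_sm: "\<And>\<epsilon>. smooth_on UNIV (u \<epsilon>)"
    and u: "\<And>\<epsilon>. 0 < \<epsilon> \<Longrightarrow> \<epsilon> \<le> 1 \<Longrightarrow> 0 < ?A \<epsilon> \<Longrightarrow> ?sol \<epsilon> (u \<epsilon>)" by blast
  have u_net: "smooth_net \<Omega> u" using u_sm smooth_on_subset unfolding smooth_net_def by blast
  have uEM: "u \<in> EM \<Omega>"
    unfolding EM_iff[OF assms(1)]
  proof (intro conjI u_net allI impI)
    fix K and "is" :: "'n list"
    \<comment> \<open>The derivatives of \<open>F\<close> that enter the bound on \<open>u\<close>: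
      one for each set of coordinates, hence finitely many, so they share one exponent.\<close>
    let ?L = "range (\<lambda>S. mi_list (\<lambda>i. if i \<in> S then q + length is else 0))"
    obtain r where "\<And>js. js \<in> ?L \<Longrightarrow>
        norm_le_powr UNIV (\<lambda>\<epsilon>. partial_derivs js (F \<epsilon>)) (- r)"
      by (rule ex_uniform_powr_bound[of ?L UNIV "\<lambda>js \<epsilon>. partial_derivs js (F \<epsilon>)"]) (use F(3) in auto)
    then have r: "\<forall>\<^sub>F \<epsilon> in at_right 0. \<forall>js\<in>?L. \<forall>x. norm (partial_derivs js (F \<epsilon>) x) \<le> \<epsilon> powr (- r)"
      by (intro eventually_ball_finite) auto
    let ?s = "real (?n * (q + length is))"
    \<comment> \<open>In the exponent, \<open>r\<close> comes from \<open>F\<close>,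
      \<open>p\<close> from the lower bound for the coefficients, \<open>?s\<close> from the lattice
      spacing and 1 from the constant.\<close>
    have ev: "\<forall>\<^sub>F \<epsilon> in at_right 0. \<bar>C (length is)\<bar> * \<epsilon> powr (- (r + p + ?s)) \<le> \<epsilon> powr (- (r + p + ?s + 1))"
      by (rule eventually_mult_powr_le) simp
    have "norm_le_powr K (\<lambda>\<epsilon>. partial_derivs is (u \<epsilon>)) (- (r + p + ?s + 1))"
      using r p eventually_at_right_0_in_01 ev
    proof eventually_elim
      case (elim \<epsilon>)
      have A: "0 < ?A \<epsilon>" using elim by (auto intro: less_le_trans[OF _ elim(2)])
      show ?case
      proof
        fix x
        have "norm (partial_derivs is (u \<epsilon>) x) \<le> C (length is) * \<epsilon> powr (- r) / (?A \<epsilon> * \<epsilon> ^ (?n * (q + length is)))"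
          using u[of \<epsilon>] elim A unfolding approx_solution_def by simp
        also have "\<epsilon> ^ (?n * (q + length is)) = \<epsilon> powr ?s"
          by (rule powr_realpow[symmetric]) (use elim in simp)
        also have "C (length is) * \<epsilon> powr (- r) / (?A \<epsilon> * \<epsilon> powr ?s)
            \<le> \<bar>C (length is)\<bar> * \<epsilon> powr (- r) / (\<epsilon> powr p * \<epsilon> powr ?s)"
          using elim A by (intro frac_le mult_mono) auto
        also have "\<dots> = \<bar>C (length is)\<bar> * \<epsilon> powr (- (r + p + ?s))"
          unfolding minus_add_distrib powr_add powr_minus_divide by simp
        also have "\<dots> \<le> \<epsilon> powr (- (r + p + ?s + 1))" by (rule elim(4))
        finally show "norm (partial_derivs is (u \<epsilon>) x) \<le> \<epsilon> powr (- (r + p + ?s + 1))" .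
      qed
    qed
    then show "\<exists>p. norm_le_powr K (\<lambda>\<epsilon>. partial_derivs is (u \<epsilon>)) (- p)" by blast
  qed
  let ?g = "\<lambda>\<epsilon>. pdo m (?c \<epsilon>) (u \<epsilon>)"
  have gEM: "?g \<in> EM \<Omega>" by (rule EM_pdo[OF assms(1) uEM]) (rule moderate_rep)
  have "(\<lambda>\<epsilon> x. ?g \<epsilon> x - F \<epsilon> x) \<in> Null \<Omega>"
    unfolding Null_iff[OF assms(1)]
  proof (intro conjI allI impI)
    show "smooth_net \<Omega> (\<lambda>\<epsilon> x. ?g \<epsilon> x - F \<epsilon> x)"
      using gEM FEM by (intro smooth_net_diff[OF assms(1)]) (auto simp: EM_def)
    fix K and "is" :: "'n list" and s :: real assume K: "compact K \<and> K \<subseteq> \<Omega>"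
    let ?L = "insert is (range (\<lambda>i. i # is))"
    obtain r where "\<And>js. js \<in> ?L \<Longrightarrow>
        norm_le_powr UNIV (\<lambda>\<epsilon>. partial_derivs js (F \<epsilon>)) (- r)"
      by (rule ex_uniform_powr_bound[of ?L UNIV "\<lambda>js \<epsilon>. partial_derivs js (F \<epsilon>)"]) (use F(3) in auto)
    then have r: "\<forall>\<^sub>F \<epsilon> in at_right 0. \<forall>js\<in>?L. \<forall>x. norm (partial_derivs js (F \<epsilon>) x) \<le> \<epsilon> powr (- r)"
      by (intro eventually_ball_finite) auto
    obtain R' where R': "\<forall>x\<in>K. norm x \<le> R'"
      using compact_imp_bounded[of K] K by (auto simp: bounded_iff)
    have small: "\<forall>\<^sub>F \<epsilon> in at_right 0. \<epsilon> < c" if "0 < c" for c :: real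
      using eventually_at_right_real[OF that] by eventually_elim auto
    have pos: "0 < pi / (\<bar>R' + R\<bar> + 1)" "0 < 1 / (\<bar>s + r + 1\<bar> + 1)"
      by (simp_all add: add_nonneg_pos)
    \<comment> \<open>The period grows like 1/\<epsilon>, so one cell eventually has room for
      \<open>K\<close> and the support of \<open>F\<close> together.\<close>
    have ev1: "\<forall>\<^sub>F \<epsilon> in at_right 0. R' + R \<le> pi / \<epsilon>"
      using eventually_at_right_0_in_01 small[OF pos(1)]
    proof eventually_elim
      case (elim \<epsilon>)
      then have "\<bar>R' + R\<bar> + 1 < pi / \<epsilon>" by (simp add: field_simps add_pos_nonneg)
      then show ?case by linarith
    qed
    \<comment> \<open>From here on the tolerance beats the growth
      \<open>\<epsilon> powr (- r)\<close> of the derivatives of \<open>F\<close>, with one power to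
      spare for the constant.\<close>
    have ev2: "\<forall>\<^sub>F \<epsilon> in at_right 0. s + r + 1 \<le> 1 / \<epsilon>"
      using eventually_at_right_0_in_01 small[OF pos(2)]
    proof eventually_elim
      case (elim \<epsilon>)
      then have "\<bar>s + r + 1\<bar> + 1 < 1 / \<epsilon>" by (simp add: field_simps add_pos_nonneg)
      then show ?case by linarith
    qed
    show "norm_le_powr K (\<lambda>\<epsilon>. partial_derivs is (\<lambda>x. ?g \<epsilon> x - F \<epsilon> x)) s"
      using r p eventually_at_right_0_in_01 ev1 ev2
        eventually_mult_powr_le[of s "s + 1" "4 * real ?n", simplified]
    proof eventually_elim
      case (elim \<epsilon>)
      have A: "0 < ?A \<epsilon>" using elim by (auto intro: less_le_trans[OF _ elim(2)])
      have sm: "smooth_on UNIV (?g \<epsilon>)" "smooth_on UNIV (F \<epsilon>)"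
        using partial_derivs_pdo(1)[OF open_UNIV u_sm] F(1) elim(3) by auto
      show ?case
      proof
        fix x assume "x \<in> K"
        then have x: "norm x + R \<le> pi / \<epsilon>" using R' elim(4) by auto
        have "partial_derivs is (\<lambda>x. ?g \<epsilon> x - F \<epsilon> x) x = partial_derivs is (?g \<epsilon>) x - partial_derivs is (F \<epsilon>) x"
          using partial_derivs_linear[OF open_UNIV sm, of x "is" 1 "-1"] by simp
        also have "norm \<dots> \<le> 4 * real ?n * \<epsilon> powr (- r) * \<epsilon> powr (1 / \<epsilon>)"
          using u[of \<epsilon>] elim A x unfolding approx_solution_def by simp
        also have "\<dots> \<le> 4 * real ?n * \<epsilon> powr (- r) * \<epsilon> powr (s + r + 1)"
          using elim by (intro mult_left_mono powr_mono') auto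
        also have "\<dots> = 4 * real ?n * \<epsilon> powr (s + 1)" by (simp add: mult.assoc flip: powr_add)
        also have "\<dots> \<le> \<epsilon> powr s" by (rule elim(6))
        finally show "norm (partial_derivs is (\<lambda>x. ?g \<epsilon> x - F \<epsilon> x) x) \<le> \<epsilon> powr s" .
      qed
    qed
  qed
  then have "gclass \<Omega> ?g = f"
    unfolding f by (rule colombeau_relI[OF assms(1) gEM FEM])
  then have "gPD \<Omega> m a (gclass \<Omega> u) = f" by (simp add: gPD_gclass[OF assms(1) uEM])
  then show "\<exists>u\<in>colombeau \<Omega>. gPD \<Omega> m a u = f" using gclass_in_colombeau[OF uEM] by blast
qed

end
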